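(* Let $q>p\ge 0$ be even integers, let $d\ge 3$, and let $G$ be a finite connected non-bipartite $d$-regular graph with girth larger than $3p+3q$. Let $S=[p,q,p+q]$. Then the polygraph $G_S$ is $(a,b)$-regular, every link of $G_S$ has normalized spectral gap at least $\epsilon$, and $G_S$ itself has normalized spectral gap at least $\epsilon'>0$. Here $a,b$ depend only on $p,q$ (and $d$), $\epsilon>0$ depends only on $p$ and $q$, and $\epsilon'$ depends also on the spectral gap of $G$.
   Context: Let $\rho$ be the graph metric of $G$. For a multiset $S=[l_1,\dots,l_m]$ of non-negative integers, the polygraph $G_S$ has vertex set $V(G)^m$, and $(x_1,\dots,x_m)$, $(y_1,\dots,y_m)$ are adjacent iff the multiset $[\rho(x_1,y_1),\dots,\rho(x_m,y_m)]$ equals $S$. The link of a vertex $v$ is the subgraph induced by its neighbours. A graph is $(a,b)$-regular if it is $a$-regular and every link is $b$-regular. A $k$-regular graph with adjacency eigenvalues $k=\lambda_1\ge\lambda_2\ge\dots$ has normalized spectral gap $1-\lambda_2/k$.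
   Formalization: The bound ε' depends on the two-sided spectral gap of G, 1 − max_{i≥2}|λ_i|/d, instead of 1 − λ_2/d: no positive bound in terms of the latter exists, since nearly bipartite expanders of large girth have λ_n → −d and then the gap of G_S tends to 0. *)

theory Defs
  imports
    "Graph_Theory.Graph_Theory"
    "Jordan_Normal_Form.Char_Poly"
    "HOL-Library.Extended_Nat"
    "HOL-Library.Multiset"
begin

text \<open>
  A finite simple graph is a \<^term>\<open>pair_graph\<close>: each undirected edge is represented by its two
  opposite arcs.
\<close>

text \<open>The graph metric; its value is \<^term>\<open>\<infinity>\<close> between different components.\<close>

definition graph_metric :: "('a, 'b) pre_digraph \<Rightarrow> 'a \<Rightarrow> 'a \<Rightarrow> ereal" where
  "graph_metric G = wf_digraph.\<mu> G (\<lambda>_. 1)"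

text \<open>
  Going back and forth along an edge is a cycle of length 2 of the symmetric digraph, but not a
  cycle of the undirected graph, whence the condition on the length. The girth of a forest is
  \<^term>\<open>\<infinity>\<close>.
\<close>

definition girth :: "('a, 'b) pre_digraph \<Rightarrow> enat" where
  "girth G = (INF p\<in>{p. pre_digraph.cycle G p \<and> length p \<ge> 3}. enat (length p))"

definition bipartite :: "('a, 'b) pre_digraph \<Rightarrow> bool" where
  "bipartite G \<longleftrightarrow> (\<exists>U W. verts G = U \<union> W \<and> U \<inter> W = {} \<and>
     (\<forall>u v. u \<rightarrow>\<^bsub>G\<^esub> v \<longrightarrow> (u \<in> U \<and> v \<in> W) \<or> (u \<in> W \<and> v \<in> U)))"

definition regular :: "nat \<Rightarrow> ('a, 'b) pre_digraph \<Rightarrow> bool" where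
  "regular k G \<longleftrightarrow> (\<forall>v\<in>verts G. out_degree G v = k)"

definition link :: "('a, 'b) pre_digraph \<Rightarrow> 'a \<Rightarrow> ('a, 'b) pre_digraph" where
  "link G v = G \<restriction> {w. v \<rightarrow>\<^bsub>G\<^esub> w}"

definition link_regular :: "nat \<Rightarrow> nat \<Rightarrow> ('a, 'b) pre_digraph \<Rightarrow> bool" where
  "link_regular a b G \<longleftrightarrow> regular a G \<and> (\<forall>v\<in>verts G. regular b (link G v))"

definition polygraph :: "'a pair_pre_digraph \<Rightarrow> nat multiset \<Rightarrow> 'a list pair_pre_digraph" where
  "polygraph G S =
     (let V = {xs. length xs = size S \<and> set xs \<subseteq> pverts G} in
      \<lparr> pverts = V,
        parcs = {(xs, ys). xs \<in> V \<and> ys \<in> V \<and>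
          mset (map2 (graph_metric G) xs ys) = image_mset (\<lambda>l. ereal (real l)) S} \<rparr>)"

text \<open>
  The enumeration of the vertices is arbitrary; a different one conjugates the matrix by a
  permutation matrix and leaves the characteristic polynomial unchanged.
\<close>

definition adj_matrix :: "('a, 'b) pre_digraph \<Rightarrow> real mat" where
  "adj_matrix G =
     (let vs = (SOME vs. distinct vs \<and> set vs = verts G); n = length vs in
      mat n n (\<lambda>(i, j). if vs ! i \<rightarrow>\<^bsub>G\<^esub> vs ! j then 1 else 0))"

text \<open>
  The adjacency eigenvalues with multiplicity in weakly decreasing order, indexed from 0: the
  second largest eigenvalue is the entry with index 1.
\<close>

definition adj_eigenvalues :: "('a, 'b) pre_digraph \<Rightarrow> real list" where
  "adj_eigenvalues G = rev (sorted_list_of_multiset (proots (char_poly (adj_matrix G))))"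

text \<open>The degree \<open>k\<close> of the regular graph is an explicit argument.\<close>

definition normalized_gap :: "nat \<Rightarrow> ('a, 'b) pre_digraph \<Rightarrow> real" where
  "normalized_gap k G = 1 - adj_eigenvalues G ! 1 / real k"

text \<open>
  The two-sided normalized gap, which measures how far all eigenvalues other than the largest one
  are from both \<open>k\<close> and \<open>- k\<close>. A connected regular graph has a positive one-sided gap; its two-sided gap
  is positive iff in addition the graph is not bipartite. For even \<open>l\<close> the graph of pairs at
  distance \<open>l\<close> cannot tell the eigenvalue \<open>- k\<close> of a graph of large girth from \<open>k\<close>, so that a
  gap of a polygraph with even distances is controlled by the two-sided gap of the base graph but
  not by the one-sided gap.
\<close>

definition two_sided_gap :: "nat \<Rightarrow> ('a, 'b) pre_digraph \<Rightarrow> real" where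
  "two_sided_gap k G = 1 - Max (abs ` set (tl (adj_eigenvalues G))) / real k"

end

theory Submission
  imports Defs "Jordan_Normal_Form.Spectral_Radius"
begin

text \<open>
  Balls of radius \<open>3 (p + q) / 2\<close> in \<open>G\<close> are trees, so all vertex counts in \<open>G\<^sub>S\<close> and its links are
  those in a product of three \<open>d\<close>-regular trees; this gives the regularity.

  For the links, the vertices are split into classes according to which of the distances \<open>p\<close>, \<open>q\<close>,
  \<open>p + q\<close> from the centre occurs in which coordinate. Every class pattern of an edge is met by
  about \<open>(d - 1)\<^bsup>p + q\<^esup>\<close> neighbours. In three steps that rotate the distances, each coordinate is
  once extended, once truncated and once replaced by a vertex in a new direction, so that after six
  steps the position within the class is nearly uniform; a step exchanging \<open>p\<close> and \<open>q\<close> then reaches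
  all classes. Comparing energies along these walks yields a Poincare inequality with an absolute
  constant.

  The adjacency operator of \<open>G\<^sub>S\<close> is a sum of tensor products of distance operators of \<open>G\<close>, which
  are polynomials in the adjacency operator. An invariant quadratic form for the recursion of these
  polynomials bounds their normalized values away from 1 uniformly in \<open>d\<close>.
\<close>

section \<open>Spectral theorem for real symmetric matrices\<close>

text \<open>The eigenvalues are sorted roots of a characteristic polynomial, whereas every estimate
  is one of quadratic forms; the spectral theorem and the easy half of the min-max principle connect
  the two. As \<epsilon> must not depend on \<open>d\<close>, counts are kept only up to factors
  uniform in \<open>d\<close>: a branching number \<open>d\<close>, \<open>d - 1\<close> or
  \<open>d - 2\<close> is within a factor 2 of \<open>d - 1\<close>, and three coordinates lose a
  factor 8. In this calculus the link has about \<open>B\<^sup>2\<close> vertices and degree at most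
  of order \<open>B\<close>, where \<open>B = (d - 1) ^ (p + q)\<close>. Three rotation steps reach
  the points of a class that leave the centre in other directions; a third direction, available as
  \<open>d \<ge> 3\<close>, then leads to every point. Rotations preserve the cyclic order of the
  distances, hence the exchange step. It needs triangles with sides \<open>(q, p, q)\<close> and
  \<open>(p + q, p + q, p)\<close>, which exist in a tree because \<open>p\<close> is even. In the
  polygraph the polynomial of \<open>p\<close> may be constant, namely for \<open>p = 0\<close>, so
  the gain comes from \<open>q\<close>. Each coordinate receives \<open>q\<close> in one of at most
  six arrangements of the distances, whence the division by 6 in \<epsilon>'.\<close>

lemma real_symmetric_eigenvalue_exists:
  fixes A :: "real mat"
  assumes A: "A \<in> carrier_mat n n" and sym: "\<And>i j. i < n \<Longrightarrow> j < n \<Longrightarrow> A $$ (i, j) = A $$ (j, i)"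
    and n: "n > 0"
  shows "\<exists>c. eigenvalue A c"
proof -
  define C where "C = map_mat complex_of_real A"
  have C: "C \<in> carrier_mat n n" using A by (simp add: C_def)
  from spectrum_non_empty[OF C n] obtain c where "eigenvalue C c"
    by (auto simp: spectrum_def)
  then obtain v where v: "v \<in> carrier_vec n" "v \<noteq> 0\<^sub>v n" and ev: "C *\<^sub>v v = c \<cdot>\<^sub>v v"
    using C by (auto simp: eigenvalue_def eigenvector_def)
  have row: "(\<Sum>j<n. complex_of_real (A $$ (i, j)) * v $ j) = c * v $ i" if "i < n" for i
  proof -
    have "(C *\<^sub>v v) $ i = c * v $ i" using ev that v by simp
    moreover have "(C *\<^sub>v v) $ i = (\<Sum>j<n. complex_of_real (A $$ (i, j)) * v $ j)"
      using that C v A by (simp add: C_def scalar_prod_def atLeast0LessThan)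
    ultimately show ?thesis by simp
  qed
  \<comment> \<open>The Hermitian form of the eigenvector: it equals \<open>c\<close> times a
    positive number and, by symmetry of \<open>A\<close>, its own conjugate, so \<open>c\<close> is
    real.\<close>
  define s where "s = (\<Sum>i<n. \<Sum>j<n. complex_of_real (A $$ (i, j)) * v $ j * cnj (v $ i))"
  define m where "m = (\<Sum>i<n. (cmod (v $ i))\<^sup>2)"
  have "s = (\<Sum>i<n. c * v $ i * cnj (v $ i))"
    unfolding s_def by (intro sum.cong refl) (simp add: sum_distrib_right [symmetric] row)
  also have "\<dots> = c * of_real m"
    by (simp add: m_def sum_distrib_left mult.assoc flip: complex_norm_square)
  finally have s: "s = c * of_real m" .
  have "cnj s = (\<Sum>i<n. \<Sum>j<n. complex_of_real (A $$ (i, j)) * cnj (v $ j) * v $ i)"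
    by (simp add: s_def)
  also have "\<dots> = (\<Sum>j<n. \<Sum>i<n. complex_of_real (A $$ (i, j)) * cnj (v $ j) * v $ i)"
    by (rule sum.swap)
  also have "\<dots> = s" unfolding s_def
    by (intro sum.cong refl) (use sym in \<open>simp add: mult_ac\<close>)
  finally have cs: "cnj s = s" .
  obtain i where "i < n" "v $ i \<noteq> 0" using v by (metis carrier_vecD eq_vecI index_zero_vec(1,2))
  then have m: "m > 0" unfolding m_def by (intro sum_pos2[of _ i]) auto
  from cs s m have "cnj c = c" by simp
  then obtain r where r: "c = complex_of_real r"
    by (metis Reals_cases Reals_cnj_iff)
  have "poly (char_poly C) c = 0" using \<open>eigenvalue C c\<close> eigenvalue_root_char_poly[OF C] by simp
  moreover have "char_poly C = map_poly complex_of_real (char_poly A)"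
    unfolding C_def using of_real_hom.char_poly_hom[OF A] .
  ultimately have "poly (char_poly A) r = 0" by (simp add: r)
  then show ?thesis using eigenvalue_root_char_poly[OF A] by auto
qed

text \<open>Matrices become plain functions of two indices here, so that the induction below can
  restrict to a smaller block without changing carriers.\<close>

lemma symmetric_function_eigenvector:
  fixes A :: "nat \<Rightarrow> nat \<Rightarrow> real"
  assumes sym: "\<And>i j. i < n \<Longrightarrow> j < n \<Longrightarrow> A i j = A j i" and n: "n > 0"
  shows "\<exists>u c. (\<Sum>i<n. u i * u i) = 1 \<and> (\<forall>i<n. (\<Sum>j<n. A i j * u j) = c * u i)"
proof -
  define M where "M = mat n n (\<lambda>(i, j). A i j)"
  have M: "M \<in> carrier_mat n n" by (simp add: M_def)
  obtain c where "eigenvalue M c"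
    using real_symmetric_eigenvalue_exists[OF M _ n] sym by (auto simp: M_def)
  then obtain v where v: "v \<in> carrier_vec n" "v \<noteq> 0\<^sub>v n" and ev: "M *\<^sub>v v = c \<cdot>\<^sub>v v"
    using M by (auto simp: eigenvalue_def eigenvector_def)
  have row: "(\<Sum>j<n. A i j * v $ j) = c * v $ i" if "i < n" for i
  proof -
    have "(M *\<^sub>v v) $ i = c * v $ i" using ev that v by simp
    then show ?thesis using that M v by (simp add: M_def scalar_prod_def atLeast0LessThan)
  qed
  define m where "m = (\<Sum>i<n. (v $ i) * (v $ i))"
  obtain i where "i < n" "v $ i \<noteq> 0" using v by (metis carrier_vecD eq_vecI index_zero_vec(1,2))
  then have m: "m > 0" unfolding m_def
    by (intro sum_pos2[of _ i]) (auto simp: zero_less_mult_iff)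
  define u where "u = (\<lambda>i. v $ i / sqrt m)"
  have "(\<Sum>i<n. u i * u i) = m / (sqrt m * sqrt m)"
    by (simp add: u_def m_def sum_divide_distrib)
  then have "(\<Sum>i<n. u i * u i) = 1" using m by simp
  moreover have "(\<Sum>j<n. A i j * u j) = c * u i" if "i < n" for i
    using row[OF that] by (simp add: u_def sum_divide_distrib [symmetric])
  ultimately show ?thesis by blast
qed

text \<open>The Householder reflection exchanging a unit vector with the last basis vector.\<close>

lemma orthogonal_symmetric_with_last_column:
  fixes u :: "nat \<Rightarrow> real"
  assumes u: "(\<Sum>i<Suc n. u i * u i) = 1"
  shows "\<exists>H. (\<forall>i j. H i j = H j i) \<and> (\<forall>i<Suc n. H i n = u i) \<and>
    (\<forall>i<Suc n. \<forall>j<Suc n. (\<Sum>k<Suc n. H i k * H k j) = (if i = j then 1 else 0))"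
proof (cases "u n = 1")
  case True
  then have "(\<Sum>i<n. u i * u i) = 0" using u by simp
  then have "\<forall>i<n. u i = 0" by (subst (asm) sum_nonneg_eq_0_iff) auto
  with True show ?thesis
    by (intro exI[of _ "\<lambda>i j. if i = j then 1 else 0"]) (auto simp: if_distrib less_Suc_eq cong: if_cong)
next
  case False
  define w where "w i = u i - (if i = n then 1 else 0)" for i
  \<comment> \<open>As \<open>w\<close> is \<open>u\<close> minus the last basis vector, its squared
    norm is \<open>2 * (1 - u n)\<close>; hence this is the reflection in the hyperplane orthogonal
    to \<open>w\<close>.\<close>
  define H where "H i j = (if i = j then 1 else 0) - w i * w j / (1 - u n)" for i j
  have ww: "(\<Sum>i<Suc n. w i * w i) = 2 * (1 - u n)"
  proof -
    have "(\<Sum>i<Suc n. w i * w i) = (\<Sum>i<n. u i * u i) + (u n - 1) * (u n - 1)"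
      by (simp add: w_def)
    also have "(\<Sum>i<n. u i * u i) = 1 - u n * u n" using u by simp
    finally show ?thesis by (simp add: algebra_simps)
  qed
  have "H i n = u i" for i
    using False by (auto simp: H_def w_def field_simps)
  moreover have "(\<Sum>k<Suc n. H i k * H k j) = (if i = j then 1 else 0)" if "i < Suc n" "j < Suc n" for i j
  proof -
    have "H i k * H k j = (if i = k then (if k = j then 1 else 0) else 0)
        - (if i = k then w k * w j / (1 - u n) else 0) - (if k = j then w i * w k / (1 - u n) else 0)
        + w i * w j / (1 - u n)\<^sup>2 * (w k * w k)" for k
      by (simp add: H_def algebra_simps power2_eq_square)
    then have "(\<Sum>k<Suc n. H i k * H k j) = (\<Sum>k<Suc n. (if i = k then (if k = j then 1 else 0) else 0))
        - (\<Sum>k<Suc n. (if i = k then w k * w j / (1 - u n) else 0))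
        - (\<Sum>k<Suc n. (if k = j then w i * w k / (1 - u n) else 0))
        + w i * w j / (1 - u n)\<^sup>2 * (\<Sum>k<Suc n. w k * w k)"
      by (simp only: sum.distrib sum_subtractf sum_distrib_left)
    also have "\<dots> = (if i = j then 1 else 0) - w i * w j / (1 - u n) - w i * w j / (1 - u n)
        + w i * w j / (1 - u n)\<^sup>2 * (2 * (1 - u n))"
      unfolding ww using that by (simp only: sum.delta sum.delta' finite_lessThan lessThan_iff if_True)
    also have "\<dots> = (if i = j then 1 else 0)"
    proof -
      have "w i * w j / (1 - u n)\<^sup>2 * (2 * (1 - u n)) = 2 * (w i * w j / (1 - u n))"
        using False by (simp add: power2_eq_square divide_simps)
      then show ?thesis by simp
    qed
    finally show ?thesis .
  qed
  moreover have "H i j = H j i" for i j by (auto simp: H_def)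
  ultimately show ?thesis by blast
qed

lemma sum_delta_mult:
  fixes f :: "'b \<Rightarrow> real"
  assumes "finite A" "a \<in> A"
  shows "(\<Sum>b\<in>A. f b * (if a = b then 1 else 0)) = f a" "(\<Sum>b\<in>A. f b * (if b = a then 1 else 0)) = f a"
    "(\<Sum>b\<in>A. (if a = b then 1 else 0) * f b) = f a" "(\<Sum>b\<in>A. (if b = a then 1 else 0) * f b) = f a"
  using assms by (simp_all add: if_distrib [of "\<lambda>x. _ * x"] if_distrib [of "\<lambda>x. x * _"] cong: if_cong)

lemma sum_rotate:
  "(\<Sum>i\<in>A. \<Sum>a\<in>B. \<Sum>b\<in>C. F i a b) = (\<Sum>a\<in>B. \<Sum>b\<in>C. \<Sum>i\<in>A. (F i a b :: real))"
proof -
  have "(\<Sum>i\<in>A. \<Sum>a\<in>B. \<Sum>b\<in>C. F i a b) = (\<Sum>a\<in>B. \<Sum>i\<in>A. \<Sum>b\<in>C. F i a b)"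
    by (rule sum.swap)
  also have "\<dots> = (\<Sum>a\<in>B. \<Sum>b\<in>C. \<Sum>i\<in>A. F i a b)"
    by (intro sum.cong refl sum.swap)
  finally show ?thesis .
qed

text \<open>Deflation: conjugation with the reflection \<open>H\<close>, whose last column is a unit
  eigenvector, clears the last row and column of \<open>A\<close> except for the corner, and the
  induction hypothesis diagonalises the remaining block.\<close>

lemma real_symmetric_spectral:
  fixes A :: "nat \<Rightarrow> nat \<Rightarrow> real"
  assumes "\<And>i j. i < n \<Longrightarrow> j < n \<Longrightarrow> A i j = A j i"
  shows "\<exists>U e. (\<forall>k<n. \<forall>l<n. (\<Sum>i<n. U i k * U i l) = (if k = l then 1 else 0)) \<and>
    (\<forall>i<n. \<forall>j<n. A i j = (\<Sum>k<n. e k * U i k * U j k))"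
  using assms
proof (induction n arbitrary: A)
  case 0
  then show ?case by simp
next
  case (Suc n)
  obtain u c where u: "(\<Sum>i<Suc n. u i * u i) = 1"
    and ev: "\<And>i. i < Suc n \<Longrightarrow> (\<Sum>j<Suc n. A i j * u j) = c * u i"
    using symmetric_function_eigenvector[of "Suc n" A] Suc.prems by auto
  obtain H where Hsym: "\<And>i j. H i j = H j i" and Hn: "\<And>i. i < Suc n \<Longrightarrow> H i n = u i"
    and HH: "\<And>i j. i < Suc n \<Longrightarrow> j < Suc n \<Longrightarrow> (\<Sum>k<Suc n. H i k * H k j) = (if i = j then 1 else 0)"
    using orthogonal_symmetric_with_last_column[OF u] by blast
  define B where "B i j = (\<Sum>a<Suc n. \<Sum>b<Suc n. H i a * A a b * H b j)" for i j
  have Bsym: "B i j = B j i" for i j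
  proof -
    have "B i j = (\<Sum>b<Suc n. \<Sum>a<Suc n. H i a * A a b * H b j)"
      unfolding B_def by (rule sum.swap)
    also have "\<dots> = B j i" unfolding B_def
      by (intro sum.cong refl) (metis Hsym Suc.prems lessThan_iff mult.assoc mult.commute)
    finally show ?thesis .
  qed
  have Bn: "B i n = (if i = n then c else 0)" if "i < Suc n" for i
  proof -
    have "B i n = (\<Sum>a<Suc n. H i a * (\<Sum>b<Suc n. A a b * u b))"
      unfolding B_def sum_distrib_left
      by (intro sum.cong refl) (simp only: lessThan_iff Hn mult.assoc)
    also have "\<dots> = (\<Sum>a<Suc n. c * (H i a * H a n))"
      by (intro sum.cong refl) (simp only: lessThan_iff ev Hn mult.left_commute)
    also have "\<dots> = c * (if i = n then 1 else 0)"
      by (simp only: sum_distrib_left[symmetric] HH[OF that lessI])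
    finally show ?thesis by simp
  qed
  have "\<exists>U e. (\<forall>k<n. \<forall>l<n. (\<Sum>i<n. U i k * U i l) = (if k = l then 1 else 0)) \<and>
    (\<forall>i<n. \<forall>j<n. B i j = (\<Sum>k<n. e k * U i k * U j k))"
    by (rule Suc.IH) (rule Bsym)
  then obtain W e where We: "\<forall>k<n. \<forall>l<n. (\<Sum>i<n. W i k * W i l) = (if k = l then 1 else 0)"
    "\<forall>i<n. \<forall>j<n. B i j = (\<Sum>k<n. e k * W i k * W j k)"
    by blast
  have WW: "\<And>k l. k < n \<Longrightarrow> l < n \<Longrightarrow> (\<Sum>i<n. W i k * W i l) = (if k = l then 1 else 0)"
    and BW: "\<And>i j. i < n \<Longrightarrow> j < n \<Longrightarrow> B i j = (\<Sum>k<n. e k * W i k * W j k)"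
    using We by simp_all
  \<comment> \<open>The block matrix of \<open>W\<close> and a corner entry 1; the product of
    \<open>H\<close> and \<open>W'\<close> then diagonalises \<open>A\<close>.\<close>
  define W' where "W' a k = (if k < n then (if a < n then W a k else 0) else (if a = n then 1 else 0))" for a k
  define e' where "e' k = (if k < n then e k else c)" for k
  define U where "U i k = (\<Sum>a<Suc n. H i a * W' a k)" for i k
  have W': "(\<Sum>a<Suc n. W' a k * W' a l) = (if k = l then 1 else 0)" if "k < Suc n" "l < Suc n" for k l
    using that WW by (auto simp: W'_def less_Suc_eq)
  have BW': "B i j = (\<Sum>k<Suc n. e' k * W' i k * W' j k)" if "i < Suc n" "j < Suc n" for i j
    using that BW Bn Bsym by (auto simp: W'_def e'_def less_Suc_eq)
  have orth: "(\<Sum>i<Suc n. U i k * U i l) = (if k = l then 1 else 0)" if "k < Suc n" "l < Suc n" for k l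
  proof -
    have eq1: "(H i a * W' a k) * (H i b * W' b l) = W' a k * W' b l * (H a i * H i b)" for i a b
      by (simp add: Hsym[of i a])
    have "(\<Sum>i<Suc n. U i k * U i l) = (\<Sum>i<Suc n. \<Sum>a<Suc n. \<Sum>b<Suc n. W' a k * W' b l * (H a i * H i b))"
      unfolding U_def sum_product by (intro sum.cong refl) (rule eq1)
    also have "\<dots> = (\<Sum>a<Suc n. \<Sum>b<Suc n. \<Sum>i<Suc n. W' a k * W' b l * (H a i * H i b))"
      by (rule sum_rotate)
    also have "\<dots> = (\<Sum>a<Suc n. \<Sum>b<Suc n. W' a k * W' b l * (if a = b then 1 else 0))"
      by (intro sum.cong refl) (simp only: sum_distrib_left[symmetric] lessThan_iff HH)
    also have "\<dots> = (\<Sum>a<Suc n. W' a k * W' a l)"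
      by (intro sum.cong refl) (simp only: sum_delta_mult finite_lessThan lessThan_iff)
    finally show ?thesis using W'[OF that] by simp
  qed
  have expand: "A i j = (\<Sum>k<Suc n. e' k * U i k * U j k)" if ij: "i < Suc n" "j < Suc n" for i j
  proof -
    have eq1: "e' k * ((H i a * W' a k) * (H j b * W' b k)) = H i a * (e' k * W' a k * W' b k) * H b j" for k a b
      by (simp add: Hsym[of j b])
    have eq2: "H i a * (H a x * A x y * H y b) * H b j = (H i a * H a x) * A x y * (H y b * H b j)" for a b x y
      by simp
    have "(\<Sum>k<Suc n. e' k * U i k * U j k) =
       (\<Sum>k<Suc n. e' k * (\<Sum>a<Suc n. \<Sum>b<Suc n. (H i a * W' a k) * (H j b * W' b k)))"
      unfolding U_def mult.assoc sum_product by (rule refl)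
    also have "\<dots> = (\<Sum>k<Suc n. \<Sum>a<Suc n. \<Sum>b<Suc n. H i a * (e' k * W' a k * W' b k) * H b j)"
      unfolding sum_distrib_left by (intro sum.cong refl) (rule eq1)
    also have "\<dots> = (\<Sum>a<Suc n. \<Sum>b<Suc n. \<Sum>k<Suc n. H i a * (e' k * W' a k * W' b k) * H b j)"
      by (rule sum_rotate)
    also have "\<dots> = (\<Sum>a<Suc n. \<Sum>b<Suc n. H i a * B a b * H b j)"
      by (intro sum.cong refl) (simp only: sum_distrib_left[symmetric] sum_distrib_right[symmetric] lessThan_iff BW')
    also have "\<dots> = (\<Sum>a<Suc n. \<Sum>b<Suc n. \<Sum>x<Suc n. \<Sum>y<Suc n. (H i a * H a x) * A x y * (H y b * H b j))"
      unfolding B_def sum_distrib_left sum_distrib_right by (intro sum.cong refl) (rule eq2)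
    also have "\<dots> = (\<Sum>x<Suc n. \<Sum>y<Suc n. \<Sum>a<Suc n. \<Sum>b<Suc n. (H i a * H a x) * A x y * (H y b * H b j))"
    proof -
      have "(\<Sum>a<Suc n. \<Sum>b<Suc n. \<Sum>x<Suc n. \<Sum>y<Suc n. F a b x y)
          = (\<Sum>x<Suc n. \<Sum>y<Suc n. \<Sum>a<Suc n. \<Sum>b<Suc n. F a b x y)" for F :: "nat \<Rightarrow> nat \<Rightarrow> nat \<Rightarrow> nat \<Rightarrow> real"
        unfolding sum.cartesian_product
        by (rule sum.reindex_bij_witness[of _ "\<lambda>(x,y,a,b). (a,b,x,y)" "\<lambda>(a,b,x,y). (x,y,a,b)"]) auto
      then show ?thesis .
    qed
    also have "\<dots> = (\<Sum>x<Suc n. \<Sum>y<Suc n. (\<Sum>a<Suc n. H i a * H a x) * A x y * (\<Sum>b<Suc n. H y b * H b j))"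
      by (simp only: sum_distrib_left sum_distrib_right)
         (rule sum.cong[OF refl], rule sum.cong[OF refl], rule sum.swap)
    also have "\<dots> = (\<Sum>x<Suc n. \<Sum>y<Suc n. (if i = x then 1 else 0) * A x y * (if y = j then 1 else 0))"
      by (intro sum.cong refl) (simp only: lessThan_iff HH ij)
    also have "\<dots> = A i j"
      by (simp only: mult.assoc sum_distrib_left[symmetric] sum_delta_mult finite_lessThan lessThan_iff ij)
    finally show ?thesis by simp
  qed
  show ?case
  proof (rule exI[of _ U], rule exI[of _ e'], rule conjI; intro allI impI)
    fix k l assume "k < Suc n" "l < Suc n"
    then show "(\<Sum>i<Suc n. U i k * U i l) = (if k = l then 1 else 0)" by (rule orth)
  next
    fix i j assume "i < Suc n" "j < Suc n"
    then show "A i j = (\<Sum>k<Suc n. e' k * U i k * U j k)" by (rule expand)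
  qed
qed

lemma orthogonal_rows_if_columns:
  fixes U :: "nat \<Rightarrow> nat \<Rightarrow> real"
  assumes "\<And>k l. k < n \<Longrightarrow> l < n \<Longrightarrow> (\<Sum>i<n. U i k * U i l) = (if k = l then 1 else 0)"
    and "i < n" "j < n"
  shows "(\<Sum>k<n. U i k * U j k) = (if i = j then 1 else 0)"
proof -
  define M where "M = mat n n (\<lambda>(i, j). U i j)"
  have M: "M \<in> carrier_mat n n" by (simp add: M_def)
  have "transpose_mat M * M = 1\<^sub>m n"
    by (rule eq_matI) (use assms(1) in \<open>auto simp: M_def scalar_prod_def atLeast0LessThan\<close>)
  then have "M * transpose_mat M = 1\<^sub>m n"
    using mat_mult_left_right_inverse[of "transpose_mat M" n M] M by simp
  then have "(M * transpose_mat M) $$ (i, j) = (1\<^sub>m n :: real mat) $$ (i, j)" by simp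
  then show ?thesis using assms(2,3) by (simp add: M_def scalar_prod_def atLeast0LessThan)
qed

lemma char_poly_orthogonal_diagonal:
  fixes U :: "nat \<Rightarrow> nat \<Rightarrow> real"
  assumes A: "A \<in> carrier_mat n n"
    and UU: "\<And>k l. k < n \<Longrightarrow> l < n \<Longrightarrow> (\<Sum>i<n. U i k * U i l) = (if k = l then 1 else 0)"
    and AU: "\<And>i j. i < n \<Longrightarrow> j < n \<Longrightarrow> A $$ (i, j) = (\<Sum>k<n. e k * U i k * U j k)"
  shows "char_poly A = (\<Prod>a\<leftarrow>map e [0..<n]. [:- a, 1:])"
proof -
  define M where "M = mat n n (\<lambda>(i, j). U i j)"
  define D where "D = mat n n (\<lambda>(i, j). if i = j then e i else 0)"
  have M: "M \<in> carrier_mat n n" and D: "D \<in> carrier_mat n n" by (simp_all add: M_def D_def)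
  have TM: "transpose_mat M * M = 1\<^sub>m n"
    by (rule eq_matI) (use UU in \<open>auto simp: M_def scalar_prod_def atLeast0LessThan\<close>)
  then have MT: "M * transpose_mat M = 1\<^sub>m n"
    using mat_mult_left_right_inverse[of "transpose_mat M" n M] M by simp
  have MD: "M * D = mat n n (\<lambda>(i, k). U i k * e k)"
    by (rule eq_matI) (auto simp: M_def D_def scalar_prod_def atLeast0LessThan if_distrib cong: if_cong)
  have "A = M * D * transpose_mat M"
    unfolding MD by (rule eq_matI)
      (use A AU in \<open>auto simp: M_def scalar_prod_def atLeast0LessThan mult_ac\<close>)
  then have "similar_mat_wit A D M (transpose_mat M)"
    unfolding similar_mat_wit_def Let_def using A M D MT TM by auto
  then have "similar_mat A D" by (auto simp: similar_mat_def)
  then have "char_poly A = char_poly D" by (rule char_poly_similar)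
  also have "\<dots> = (\<Prod>a\<leftarrow>diag_mat D. [:- a, 1:])"
    by (rule char_poly_upper_triangular[OF D]) (auto simp: D_def)
  also have "diag_mat D = map e [0..<n]"
    by (simp add: diag_mat_def D_def)
  finally show ?thesis .
qed

text \<open>The roots of the characteristic polynomial form the multiset of the diagonal entries
  \<open>e\<close>. The permutation \<pi> that sorts them is applied to the eigenvectors too, so
  that \<open>\<phi> k\<close> belongs to entry \<open>k\<close> of the sorted list. Passing from
  indices to vertices by \<open>ix\<close> removes the arbitrary enumeration.\<close>

theorem adj_eigenvalues_spectral:
  fixes H :: "('v, 'e) pre_digraph"
  assumes fin: "finite (verts H)" and sym: "\<And>x y. x \<rightarrow>\<^bsub>H\<^esub> y \<Longrightarrow> y \<rightarrow>\<^bsub>H\<^esub> x"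
  defines "n \<equiv> card (verts H)"
  obtains \<phi> :: "nat \<Rightarrow> 'v \<Rightarrow> real"
  where "length (adj_eigenvalues H) = n"
    and "sorted_wrt (\<ge>) (adj_eigenvalues H)"
    and "\<And>k l. k < n \<Longrightarrow> l < n \<Longrightarrow> (\<Sum>x\<in>verts H. \<phi> k x * \<phi> l x) = (if k = l then 1 else 0)"
    and "\<And>x y. x \<in> verts H \<Longrightarrow> y \<in> verts H \<Longrightarrow> (\<Sum>k<n. \<phi> k x * \<phi> k y) = (if x = y then 1 else 0)"
    and "\<And>x y. x \<in> verts H \<Longrightarrow> y \<in> verts H \<Longrightarrow>
      (\<Sum>k<n. adj_eigenvalues H ! k * \<phi> k x * \<phi> k y) = (if x \<rightarrow>\<^bsub>H\<^esub> y then 1 else 0)"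
proof -
  define vs where "vs = (SOME vs. distinct vs \<and> set vs = verts H)"
  have "\<exists>vs. distinct vs \<and> set vs = verts H" using finite_distinct_list[OF fin] by blast
  then have vs: "distinct vs" "set vs = verts H"
    unfolding vs_def by (metis (mono_tags, lifting) someI_ex)+
  have len: "length vs = n" using vs by (metis distinct_card n_def)
  define A where "A = adj_matrix H"
  have A: "A \<in> carrier_mat n n"
    by (simp add: A_def adj_matrix_def vs_def[symmetric] Let_def len)
  have Aij: "A $$ (i, j) = (if vs ! i \<rightarrow>\<^bsub>H\<^esub> vs ! j then 1 else 0)" if "i < n" "j < n" for i j
    using that by (simp add: A_def adj_matrix_def vs_def[symmetric] Let_def len)
  have "\<exists>U e. (\<forall>k<n. \<forall>l<n. (\<Sum>i<n. U i k * U i l) = (if k = l then 1 else 0)) \<and>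
    (\<forall>i<n. \<forall>j<n. A $$ (i, j) = (\<Sum>k<n. e k * U i k * U j k))"
    by (rule real_symmetric_spectral) (use Aij sym in auto)
  then obtain U e where UU: "\<forall>k<n. \<forall>l<n. (\<Sum>i<n. U i k * U i l) = (if k = l then 1 else 0)"
    and AU: "\<forall>i<n. \<forall>j<n. A $$ (i, j) = (\<Sum>k<n. e k * U i k * U j k)"
    by blast
  have UUt: "(\<Sum>k<n. U i k * U j k) = (if i = j then 1 else 0)" if "i < n" "j < n" for i j
    by (rule orthogonal_rows_if_columns) (use UU that in auto)
  define es where "es = adj_eigenvalues H"
  have "proots (char_poly A) = mset (map e [0..<n])"
  proof -
    have "char_poly A = (\<Prod>a\<leftarrow>map e [0..<n]. [:- a, 1:])"
      by (rule char_poly_orthogonal_diagonal[OF A]) (use UU AU in auto)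
    moreover have "proots (\<Prod>a\<leftarrow>xs. [:- a, 1:]) = mset xs" for xs :: "real list"
    proof (induction xs)
      case (Cons a xs)
      have "(\<Prod>a\<leftarrow>xs. [:- a, 1:]) \<noteq> (0 :: real poly)" by (induction xs) (simp_all del: mult_pCons_left)
      then show ?case using Cons by (simp add: proots_mult del: mult_pCons_left)
    qed simp
    ultimately show ?thesis by (simp only:)
  qed
  then have es_mset: "mset es = mset (map e [0..<n])"
    by (simp add: es_def adj_eigenvalues_def A_def)
  then have es_len: "length es = n" by (metis length_map length_upt minus_nat.diff_0 size_mset)
  have es_sorted: "sorted_wrt (\<ge>) es"
    by (simp add: es_def adj_eigenvalues_def sorted_wrt_rev)
  obtain \<pi> where \<pi>: "\<pi> permutes {..<length (map e [0..<n])}" "permute_list \<pi> (map e [0..<n]) = es"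
    using mset_eq_permutation[OF es_mset] by blast
  then have \<pi>n: "\<pi> permutes {..<n}" by simp
  have es_nth: "es ! k = e (\<pi> k)" if "k < n" for k
    using \<pi> permute_list_nth[OF \<pi>(1), of k] permutes_in_image[OF \<pi>n, of k] that by simp
  define ix where "ix = inv_into {..<n} ((!) vs)"
  have bij: "bij_betw ((!) vs) {..<n} (verts H)"
    using bij_betw_nth[OF vs(1), of "{..<n}" "verts H"] vs(2) len by simp
  have ix: "ix (vs ! i) = i" if "i < n" for i
    using that bij by (simp add: ix_def bij_betw_inv_into_left)
  have ixv: "ix x < n" "vs ! ix x = x" if "x \<in> verts H" for x
    using that bij unfolding ix_def
    by (auto simp: bij_betw_inv_into_right dest: bij_betw_inv_into bij_betwE)
  define \<phi> where "\<phi> k x = U (ix x) (\<pi> k)" for k x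
  have 1: "(\<Sum>x\<in>verts H. \<phi> k x * \<phi> l x) = (if k = l then 1 else 0)" if "k < n" "l < n" for k l
  proof -
    have "(\<Sum>x\<in>verts H. \<phi> k x * \<phi> l x) = (\<Sum>i<n. \<phi> k (vs ! i) * \<phi> l (vs ! i))"
      by (rule sum.reindex_bij_betw[OF bij, symmetric])
    also have "\<dots> = (\<Sum>i<n. U i (\<pi> k) * U i (\<pi> l))"
      by (intro sum.cong refl) (simp add: \<phi>_def ix)
    also have "\<dots> = (if \<pi> k = \<pi> l then 1 else 0)"
      using UU permutes_in_image[OF \<pi>n] that by simp
    also have "\<pi> k = \<pi> l \<longleftrightarrow> k = l"
      using permutes_inj[OF \<pi>n] by (auto dest: injD)
    finally show ?thesis .
  qed
  have reind: "(\<Sum>k<n. g (\<pi> k)) = (\<Sum>k<n. g k)" for g :: "nat \<Rightarrow> real"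
    using sum.permute[OF \<pi>n, of g] by (simp add: o_def)
  have 2: "(\<Sum>k<n. \<phi> k x * \<phi> k y) = (if x = y then 1 else 0)"
    if "x \<in> verts H" "y \<in> verts H" for x y
  proof -
    have "(\<Sum>k<n. \<phi> k x * \<phi> k y) = (\<Sum>k<n. U (ix x) k * U (ix y) k)"
      unfolding \<phi>_def by (rule reind)
    also have "\<dots> = (if ix x = ix y then 1 else 0)" using UUt ixv that by simp
    also have "ix x = ix y \<longleftrightarrow> x = y" using ixv that by metis
    finally show ?thesis .
  qed
  have 3: "(\<Sum>k<n. es ! k * \<phi> k x * \<phi> k y) = (if x \<rightarrow>\<^bsub>H\<^esub> y then 1 else 0)"
    if "x \<in> verts H" "y \<in> verts H" for x y
  proof -
    have "(\<Sum>k<n. es ! k * \<phi> k x * \<phi> k y) = (\<Sum>k<n. e (\<pi> k) * U (ix x) (\<pi> k) * U (ix y) (\<pi> k))"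
      unfolding \<phi>_def by (intro sum.cong refl) (simp add: es_nth)
    also have "\<dots> = (\<Sum>k<n. e k * U (ix x) k * U (ix y) k)" by (rule reind)
    also have "\<dots> = A $$ (ix x, ix y)" using AU ixv that by simp
    also have "\<dots> = (if x \<rightarrow>\<^bsub>H\<^esub> y then 1 else 0)" using Aij ixv that by simp
    finally show ?thesis .
  qed
  show thesis
    by (rule that[of \<phi>]) (use 1 2 3 es_len es_sorted in \<open>simp_all add: es_def\<close>)
qed

text \<open>The easy half of the min-max principle: the span of the two leading eigenvectors
  contains a nonzero \<open>f\<close> orthogonal to \<open>w\<close>, on which the form is at least
  the second eigenvalue times the squared norm. For the links \<open>w\<close> will be constant, for
  the polygraph a tensor power.\<close>

theorem second_eigenvalue_le:
  fixes H :: "('v, 'e) pre_digraph" and w :: "'v \<Rightarrow> real"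
  assumes fin: "finite (verts H)" and sym: "\<And>x y. x \<rightarrow>\<^bsub>H\<^esub> y \<Longrightarrow> y \<rightarrow>\<^bsub>H\<^esub> x"
    and card: "card (verts H) \<ge> 2"
    and form: "\<And>f. (\<Sum>x\<in>verts H. f x * w x) = 0 \<Longrightarrow>
      (\<Sum>x\<in>verts H. \<Sum>y\<in>verts H. (if x \<rightarrow>\<^bsub>H\<^esub> y then 1 else 0) * f x * f y)
        \<le> c * (\<Sum>x\<in>verts H. f x * f x)"
  shows "adj_eigenvalues H ! 1 \<le> c"
proof -
  define V n es where "V = verts H" "n = card (verts H)" "es = adj_eigenvalues H"
  note defs = V_n_es_def
  have finV: "finite V" using fin by (simp add: defs)
  obtain \<phi> :: "nat \<Rightarrow> 'v \<Rightarrow> real"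
    where len: "length es = n" and sorted: "sorted_wrt (\<ge>) es"
      and orth: "\<And>k l. k < n \<Longrightarrow> l < n \<Longrightarrow> (\<Sum>x\<in>V. \<phi> k x * \<phi> l x) = (if k = l then 1 else 0)"
      and "\<And>x y. x \<in> V \<Longrightarrow> y \<in> V \<Longrightarrow> (\<Sum>k<n. \<phi> k x * \<phi> k y) = (if x = y then 1 else 0)"
      and kern: "\<And>x y. x \<in> V \<Longrightarrow> y \<in> V \<Longrightarrow>
        (\<Sum>k<n. es ! k * \<phi> k x * \<phi> k y) = (if x \<rightarrow>\<^bsub>H\<^esub> y then 1 else 0)"
    by (rule adj_eigenvalues_spectral[OF fin, folded defs], erule sym) blast
  have n: "1 < n" "0 < n" using card by (simp_all add: defs)
  define s where "s k = (\<Sum>x\<in>V. \<phi> k x * w x)" for k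
  obtain a b :: real where ab: "a * s 0 + b * s 1 = 0" "a * a + b * b > 0"
  proof (cases "s 0 = 0 \<and> s 1 = 0")
    case True
    then show ?thesis using that[of 1 0] by simp
  next
    case False
    then have "s 1 * s 1 + - s 0 * - s 0 > 0"
      by (metis minus_mult_minus sum_squares_gt_zero_iff)
    then show ?thesis using that[of "s 1" "- s 0"] by simp
  qed
  define f where "f x = a * \<phi> 0 x + b * \<phi> 1 x" for x
  have "(\<Sum>x\<in>V. f x * w x) = a * s 0 + b * s 1"
    by (simp add: f_def s_def sum_distrib_left sum.distrib algebra_simps)
  then have fw: "(\<Sum>x\<in>V. f x * w x) = 0" using ab by simp
  define t where "t k = (if k = 0 then a else if k = 1 then b else 0)" for k :: nat
  have ft: "(\<Sum>x\<in>V. f x * \<phi> k x) = t k" if "k < n" for k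
  proof -
    have "(\<Sum>x\<in>V. f x * \<phi> k x) = a * (\<Sum>x\<in>V. \<phi> 0 x * \<phi> k x) + b * (\<Sum>x\<in>V. \<phi> 1 x * \<phi> k x)"
      by (simp add: f_def sum_distrib_left sum.distrib algebra_simps)
    then show ?thesis using orth[OF n(2) that] orth[OF n(1) that] by (simp add: t_def)
  qed
  have ff: "(\<Sum>x\<in>V. f x * f x) = a * a + b * b"
  proof -
    have "(\<Sum>x\<in>V. f x * f x) = a * (\<Sum>x\<in>V. f x * \<phi> 0 x) + b * (\<Sum>x\<in>V. f x * \<phi> 1 x)"
      unfolding sum_distrib_left sum.distrib[symmetric]
      by (intro sum.cong refl) (simp add: f_def algebra_simps)
    then show ?thesis using ft[OF n(1)] ft[OF n(2)] by (simp add: t_def)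
  qed
  have "(\<Sum>x\<in>V. \<Sum>y\<in>V. (if x \<rightarrow>\<^bsub>H\<^esub> y then 1 else 0) * f x * f y)
      = (\<Sum>x\<in>V. \<Sum>y\<in>V. \<Sum>k<n. es ! k * (f x * \<phi> k x) * (f y * \<phi> k y))"
    by (intro sum.cong refl, subst kern[symmetric]) (simp_all add: sum_distrib_left sum_distrib_right mult_ac)
  also have "\<dots> = (\<Sum>k<n. \<Sum>x\<in>V. \<Sum>y\<in>V. es ! k * (f x * \<phi> k x) * (f y * \<phi> k y))"
    by (rule sum_rotate[symmetric])
  also have "\<dots> = (\<Sum>k<n. es ! k * t k * t k)"
  proof (intro sum.cong refl)
    fix k assume "k \<in> {..<n}"
    then have k: "k < n" by simp
    have "(\<Sum>x\<in>V. \<Sum>y\<in>V. es ! k * (f x * \<phi> k x) * (f y * \<phi> k y))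
        = es ! k * ((\<Sum>x\<in>V. f x * \<phi> k x) * (\<Sum>y\<in>V. f y * \<phi> k y))"
      unfolding sum_product unfolding sum_distrib_left mult.assoc ..
    then show "(\<Sum>x\<in>V. \<Sum>y\<in>V. es ! k * (f x * \<phi> k x) * (f y * \<phi> k y)) = es ! k * t k * t k"
      by (simp add: ft[OF k])
  qed
  also have "\<dots> = (\<Sum>k\<in>{0, 1}. es ! k * t k * t k)"
    by (rule sum.mono_neutral_right) (use n in \<open>auto simp: t_def\<close>)
  also have "\<dots> = es ! 0 * a * a + es ! 1 * b * b" by (simp add: t_def)
  finally have "es ! 0 * a * a + es ! 1 * b * b \<le> c * (a * a + b * b)"
    using form[of f] fw ff by (simp add: defs)
  moreover have "es ! 1 \<le> es ! 0" using sorted n len by (simp add: sorted_wrt_iff_nth_less)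
  then have "es ! 1 * (a * a) \<le> es ! 0 * (a * a)" by (intro mult_right_mono) auto
  ultimately have "es ! 1 * (a * a + b * b) \<le> c * (a * a + b * b)"
    by (simp add: algebra_simps)
  then show ?thesis using ab(2) by (simp add: defs)
qed

section \<open>Graphs of large girth\<close>

text \<open>A metric in the natural numbers in place of the \<open>ereal\<close> valued one. For an
  unreachable pair the \<open>LEAST\<close> is an unspecified value; the results below assume
  connectedness or reachability.\<close>

definition rel_dist :: "('a \<times> 'a) set \<Rightarrow> 'a \<Rightarrow> 'a \<Rightarrow> nat" where
  "rel_dist E x y = (LEAST n. (x, y) \<in> E ^^ n)"

lemma rel_dist_le: "(x, y) \<in> E ^^ n \<Longrightarrow> rel_dist E x y \<le> n"
  unfolding rel_dist_def by (rule Least_le)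

lemma rel_dist_relpow: "(x, y) \<in> E\<^sup>* \<Longrightarrow> (x, y) \<in> E ^^ rel_dist E x y"
  unfolding rel_dist_def by (metis LeastI_ex rtrancl_imp_relpow)

text \<open>
  A finite \<open>d\<close>-regular graph metric in which the balls of radius at most \<open>R / 2\<close> are trees:
  within that distance of \<open>y\<close> no edge joins two vertices of equal distance to \<open>y\<close>, and every
  other vertex has one neighbour nearer to \<open>y\<close>.
\<close>

locale local_tree =
  fixes V :: "'a set" and \<rho> :: "'a \<Rightarrow> 'a \<Rightarrow> nat" and d R :: nat
  assumes finite_V: "finite V"
    and dist_0_iff: "\<And>x y. x \<in> V \<Longrightarrow> y \<in> V \<Longrightarrow> \<rho> x y = 0 \<longleftrightarrow> x = y"
    and dist_commute: "\<And>x y. x \<in> V \<Longrightarrow> y \<in> V \<Longrightarrow> \<rho> x y = \<rho> y x"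
    and dist_triangle: "\<And>x y z. x \<in> V \<Longrightarrow> y \<in> V \<Longrightarrow> z \<in> V \<Longrightarrow> \<rho> x z \<le> \<rho> x y + \<rho> y z"
    and degree: "\<And>x. x \<in> V \<Longrightarrow> card {y \<in> V. \<rho> x y = 1} = d"
    and ex_nearer: "\<And>x y. x \<in> V \<Longrightarrow> y \<in> V \<Longrightarrow> x \<noteq> y \<Longrightarrow> \<exists>a\<in>V. \<rho> x a = 1 \<and> \<rho> a y + 1 = \<rho> x y"
    and nearer_unique: "\<And>x y a b. x \<in> V \<Longrightarrow> y \<in> V \<Longrightarrow> a \<in> V \<Longrightarrow> b \<in> V \<Longrightarrow> \<rho> x a = 1 \<Longrightarrow> \<rho> x b = 1 \<Longrightarrow>
      \<rho> a y + 1 = \<rho> x y \<Longrightarrow> \<rho> b y + 1 = \<rho> x y \<Longrightarrow> 2 * \<rho> x y \<le> R \<Longrightarrow> a = b"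
    and no_level_edge: "\<And>x y a. x \<in> V \<Longrightarrow> y \<in> V \<Longrightarrow> a \<in> V \<Longrightarrow> \<rho> x a = 1 \<Longrightarrow> 2 * \<rho> x y + 1 \<le> R \<Longrightarrow> \<rho> a y \<noteq> \<rho> x y"

context pair_graph
begin

lemma ex_awalk_length_iff:
  assumes "u \<in> pverts G"
  shows "(\<exists>p. awalk u p v \<and> length p = n) \<longleftrightarrow> (u, v) \<in> parcs G ^^ n"
  using assms
proof (induction n arbitrary: u)
  case 0
  then show ?case by (auto simp: awalk_Nil_iff)
next
  case (Suc n)
  show ?case
  proof
    assume "\<exists>p. awalk u p v \<and> length p = Suc n"
    then obtain e p where "awalk u (e # p) v" "length p = n" by (metis length_Suc_conv)
    then have "e \<in> parcs G" "fst e = u" "awalk (snd e) p v" by (auto simp: awalk_Cons_iff)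
    then show "(u, v) \<in> parcs G ^^ Suc n"
      using Suc.IH[of "snd e"] \<open>length p = n\<close> arc_snd_in_verts
      by (metis prod.collapse relpow_Suc_I2)
  next
    assume "(u, v) \<in> parcs G ^^ Suc n"
    then obtain w where w: "(u, w) \<in> parcs G" "(w, v) \<in> parcs G ^^ n"
      by (rule relpow_Suc_E2)
    then obtain p where "awalk w p v" "length p = n"
      using Suc.IH[of w] in_arcsD2 by blast
    then show "\<exists>p. awalk u p v \<and> length p = Suc n"
      using w by (intro exI[of _ "(u, w) # p"]) (auto simp: awalk_Cons_iff)
  qed
qed

lemma rtrancl_if_connected:
  assumes conn: "Digraph_Component.connected G" and xy: "x \<in> pverts G" "y \<in> pverts G"
  shows "(x, y) \<in> (parcs G)\<^sup>*"
proof -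
  have "strongly_connected G"
    using symmetric_connected_imp_strongly_connected[OF pair_sym_arcs conn] .
  then have "x \<rightarrow>\<^sup>*\<^bsub>G\<^esub> y" using xy by (auto simp: strongly_connected_def)
  then obtain p where "awalk x p y" by (auto simp: reachable_awalk)
  then show ?thesis
    using ex_awalk_length_iff[OF xy(1), of y "length p"] relpow_imp_rtrancl by blast
qed

lemma rel_dist_eq_1_iff:
  assumes "Digraph_Component.connected G" "x \<in> pverts G" "y \<in> pverts G"
  shows "rel_dist (parcs G) x y = 1 \<longleftrightarrow> (x, y) \<in> parcs G"
proof
  note walk = rel_dist_relpow[OF rtrancl_if_connected[OF assms]]
  show "(x, y) \<in> parcs G" if "rel_dist (parcs G) x y = 1" using walk that by simp
  show "rel_dist (parcs G) x y = 1" if xy: "(x, y) \<in> parcs G"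
  proof -
    have "x \<noteq> y" using xy no_loops' by blast
    then have "rel_dist (parcs G) x y \<noteq> 0" using walk by (metis relpow_0_E)
    moreover have "rel_dist (parcs G) x y \<le> 1" using xy by (intro rel_dist_le) simp
    ultimately show ?thesis by simp
  qed
qed

lemma graph_metric_eq:
  assumes u: "u \<in> pverts G" and reach: "(u, v) \<in> (parcs G)\<^sup>*"
  shows "graph_metric G u v = ereal (real (rel_dist (parcs G) u v))"
proof -
  have cost: "awalk_cost (\<lambda>_. 1) p = real (length p)" for p
    by (induction p) auto
  have "graph_metric G u v = (INF p\<in>{p. awalk u p v}. ereal (real (length p)))"
    by (simp add: graph_metric_def \<mu>_def cost)
  also have "\<dots> = ereal (real (rel_dist (parcs G) u v))"
  proof (rule INF_eqI)
    fix p assume "p \<in> {p. awalk u p v}"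
    then have "(u, v) \<in> parcs G ^^ length p" using ex_awalk_length_iff[OF u] by blast
    then show "ereal (real (rel_dist (parcs G) u v)) \<le> ereal (real (length p))"
      by (simp add: rel_dist_le)
  next
    fix y assume y: "\<And>p. p \<in> {p. awalk u p v} \<Longrightarrow> y \<le> ereal (real (length p))"
    obtain p where p: "awalk u p v" "length p = rel_dist (parcs G) u v"
      using ex_awalk_length_iff[OF u] rel_dist_relpow[OF reach] by blast
    show "y \<le> ereal (real (rel_dist (parcs G) u v))" using y[of p] p by simp
  qed
  finally show ?thesis .
qed

text \<open>A bridge from vertex lists to the arc lists of \<open>cycle\<close>; at least three
  vertices are required because \<open>girth\<close> discards back-and-forth walks.\<close>

lemma girth_le_closed_path:
  assumes dist: "distinct vs" and len: "length vs \<ge> 3"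
    and arcs: "successively (\<lambda>u v. (u, v) \<in> parcs G) vs" and close: "(last vs, hd vs) \<in> parcs G"
  shows "girth G \<le> enat (length vs)"
proof -
  define p where "p = zip vs (tl vs) @ [(last vs, hd vs)]"
  have ne: "vs \<noteq> []" using len by auto
  have walk: "successively (\<lambda>u v. (u, v) \<in> parcs G) vs \<Longrightarrow> vs \<noteq> [] \<Longrightarrow> hd vs \<in> pverts G \<Longrightarrow>
      awalk (hd vs) (zip vs (tl vs)) (last vs) \<and> awalk_verts (hd vs) (zip vs (tl vs)) = vs" for vs
  proof (induction vs rule: induct_list012)
    case (3 x y zs)
    then show ?case using in_arcsD2 by (auto simp: awalk_Cons_iff)
  qed (auto simp: awalk_Nil_iff)
  have hd: "hd vs \<in> pverts G" using close in_arcsD2 by blast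
  note w = walk[OF arcs ne hd]
  have aw: "awalk (hd vs) p (hd vs)"
    unfolding p_def by (rule awalk_appendI[OF conjunct1[OF w]])
      (use close in_arcsD1 in_arcsD2 in \<open>auto simp: awalk_Cons_iff awalk_Nil_iff\<close>)
  have "awalk_verts (hd vs) p = vs @ [hd vs]"
    using awalk_verts_append[OF aw[unfolded p_def]] w unfolding p_def by auto
  then have "distinct (tl (awalk_verts (hd vs) p))"
    using dist ne by (cases vs) auto
  moreover have lp: "length p = length vs" using ne by (simp add: p_def)
  ultimately have "cycle p" using aw len by (auto simp: cycle_def)
  then show ?thesis
    unfolding girth_def using lp len by (intro INF_lower2[of p]) auto
qed

text \<open>Descend from \<open>s\<close> and \<open>s'\<close> towards \<open>y\<close> one level
  at a time until the two geodesics meet. Before that the two vertices of a level differ, so the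
  path is simple; it has two vertices on each level passed and one meeting point. The bound on the
  levels lets a vertex farther out be appended later.\<close>

lemma merging_geodesics:
  assumes conn: "\<And>x y. x \<in> pverts G \<Longrightarrow> y \<in> pverts G \<Longrightarrow> (x, y) \<in> (parcs G)\<^sup>*"
    and "s \<in> pverts G" "s' \<in> pverts G" "y \<in> pverts G" "s \<noteq> s'"
    and "rel_dist (parcs G) s y = n" "rel_dist (parcs G) s' y = n"
  shows "\<exists>vs. distinct vs \<and> 3 \<le> length vs \<and> length vs \<le> 2 * n + 1 \<and> hd vs = s \<and> last vs = s' \<and>
    (\<forall>v\<in>set vs. rel_dist (parcs G) v y \<le> n) \<and> successively (\<lambda>u v. (u, v) \<in> parcs G) vs"
  using assms(2-)
proof (induction n arbitrary: s s')
  case 0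
  then have "s = y" "s' = y"
    using rel_dist_relpow[OF conn[of s y]] rel_dist_relpow[OF conn[of s' y]] by simp_all
  then show ?case using 0 by simp
next
  case (Suc n)
  have next_ex: "\<exists>t. (s, t) \<in> parcs G \<and> t \<in> pverts G \<and> rel_dist (parcs G) t y = n"
    if s: "s \<in> pverts G" "rel_dist (parcs G) s y = Suc n" for s
  proof -
    have "(s, y) \<in> parcs G ^^ Suc n" using rel_dist_relpow[OF conn[OF s(1) Suc.prems(3)]] s(2) by simp
    then obtain t where t: "(s, t) \<in> parcs G" "(t, y) \<in> parcs G ^^ n" by (rule relpow_Suc_E2)
    have "(s, y) \<in> parcs G ^^ Suc (rel_dist (parcs G) t y)"
      using t by (meson relpow_Suc_I2 rel_dist_relpow relpow_imp_rtrancl)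
    then have "Suc n \<le> Suc (rel_dist (parcs G) t y)" using rel_dist_le s(2) by metis
    then show ?thesis using t rel_dist_le[OF t(2)] in_arcsD2 by (intro exI[of _ t]) auto
  qed
  obtain t where t: "(s, t) \<in> parcs G" "t \<in> pverts G" "rel_dist (parcs G) t y = n"
    using next_ex Suc.prems by blast
  obtain t' where t': "(s', t') \<in> parcs G" "t' \<in> pverts G" "rel_dist (parcs G) t' y = n"
    using next_ex Suc.prems by blast
  have rev: "(t', s') \<in> parcs G" using t'(1) arcs_symmetric by blast
  show ?case
  proof (cases "t = t'")
    case True
    then show ?thesis using t t' rev Suc.prems by (intro exI[of _ "[s, t, s']"]) auto
  next
    case False
    obtain vs where vs: "distinct vs" "3 \<le> length vs" "length vs \<le> 2 * n + 1" "hd vs = t" "last vs = t'"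
      "\<forall>v\<in>set vs. rel_dist (parcs G) v y \<le> n" "successively (\<lambda>u v. (u, v) \<in> parcs G) vs"
      using Suc.IH[OF t(2) t'(2) Suc.prems(3) False t(3) t'(3)] by blast
    have "vs \<noteq> []" using vs by auto
    then have "successively (\<lambda>u v. (u, v) \<in> parcs G) (s # vs @ [s'])"
      using vs t rev by (simp add: successively_Cons successively_append_iff)
    moreover have "s \<notin> set vs" "s' \<notin> set vs" using vs(6) Suc.prems by fastforce+
    ultimately show ?thesis
      using vs Suc.prems by (intro exI[of _ "s # vs @ [s']"]) (auto simp: le_SucI)
  qed
qed

text \<open>Two geodesics, or a geodesic from each end of an edge, close up to a short cycle.\<close>

lemma local_tree_if_large_girth:
  assumes conn: "Digraph_Component.connected G" and reg: "regular d G" and girth: "girth G > enat R"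
  shows "local_tree (pverts G) (rel_dist (parcs G)) d R"
proof -
  let ?\<rho> = "rel_dist (parcs G)"
  note star = rtrancl_if_connected[OF conn]
  have walk: "(x, y) \<in> parcs G ^^ ?\<rho> x y" if "x \<in> pverts G" "y \<in> pverts G" for x y
    using rel_dist_relpow[OF star[OF that]] .
  have zero: "?\<rho> x y = 0 \<longleftrightarrow> x = y" if "x \<in> pverts G" "y \<in> pverts G" for x y
    using walk[OF that] rel_dist_le[of x y 0 "parcs G"] by auto
  note one = rel_dist_eq_1_iff[OF conn]
  have rev: "(x, y) \<in> parcs G ^^ n \<Longrightarrow> (y, x) \<in> parcs G ^^ n" for x y n
  proof (induction n arbitrary: y)
    case (Suc n)
    then obtain z where "(x, z) \<in> parcs G ^^ n" "(z, y) \<in> parcs G" by auto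
    then show ?case using Suc.IH arcs_symmetric relpow_Suc_I2 by meson
  qed simp
  have symm: "?\<rho> x y = ?\<rho> y x" for x y
    unfolding rel_dist_def using rev by metis
  show ?thesis
  proof
    show "finite (pverts G)" by (rule pair_finite_verts)
    show "?\<rho> x y = 0 \<longleftrightarrow> x = y" if "x \<in> pverts G" "y \<in> pverts G" for x y by (rule zero[OF that])
    show "?\<rho> x y = ?\<rho> y x" for x y by (rule symm)
    show "?\<rho> x z \<le> ?\<rho> x y + ?\<rho> y z" if "x \<in> pverts G" "y \<in> pverts G" "z \<in> pverts G" for x y z
    proof (rule rel_dist_le)
      show "(x, z) \<in> parcs G ^^ (?\<rho> x y + ?\<rho> y z)"
        unfolding relpow_add using walk that by blast
    qed
    show "card {y \<in> pverts G. ?\<rho> x y = 1} = d" if "x \<in> pverts G" for x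
    proof -
      have "bij_betw snd (out_arcs G x) {y \<in> pverts G. ?\<rho> x y = 1}"
        by (rule bij_betw_imageI)
           (use one that in_arcsD2 in \<open>force simp: inj_on_def out_arcs_def image_iff\<close>)+
      then show ?thesis
        using reg that bij_betw_same_card by (fastforce simp: regular_def out_degree_def)
    qed
    show "\<exists>a\<in>pverts G. ?\<rho> x a = 1 \<and> ?\<rho> a y + 1 = ?\<rho> x y"
      if xy: "x \<in> pverts G" "y \<in> pverts G" "x \<noteq> y" for x y
    proof -
      obtain n where n: "?\<rho> x y = Suc n" using zero xy by (cases "?\<rho> x y") auto
      then have "(x, y) \<in> parcs G ^^ Suc n" using walk[OF xy(1,2)] by simp
      then obtain t where t: "(x, t) \<in> parcs G" "(t, y) \<in> parcs G ^^ n" by (rule relpow_Suc_E2)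
      have tV: "t \<in> pverts G" using t in_arcsD2 by blast
      have "(x, y) \<in> parcs G ^^ Suc (?\<rho> t y)" using t(1) walk[OF tV xy(2)] by (rule relpow_Suc_I2)
      then have "Suc n \<le> Suc (?\<rho> t y)" using rel_dist_le n by metis
      then show ?thesis using t tV rel_dist_le[OF t(2)] n one[OF xy(1) tV]
        by (intro bexI[of _ t]) auto
    qed
    show "a = b" if V: "x \<in> pverts G" "y \<in> pverts G" "a \<in> pverts G" "b \<in> pverts G"
      and ab: "?\<rho> x a = 1" "?\<rho> x b = 1" "?\<rho> a y + 1 = ?\<rho> x y" "?\<rho> b y + 1 = ?\<rho> x y" "2 * ?\<rho> x y \<le> R"
      for x y a b
    proof (rule ccontr)
      assume "a \<noteq> b"
      then obtain vs where vs: "distinct vs" "3 \<le> length vs" "length vs \<le> 2 * ?\<rho> a y + 1"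
        "hd vs = a" "last vs = b" "\<forall>v\<in>set vs. ?\<rho> v y \<le> ?\<rho> a y" "successively (\<lambda>u v. (u, v) \<in> parcs G) vs"
        using merging_geodesics[OF star V(3,4,2), of "?\<rho> a y"] ab by auto
      have "vs \<noteq> []" using vs by auto
      moreover have "x \<notin> set vs" using vs(6) ab(3) by fastforce
      moreover have "(x, a) \<in> parcs G" "(b, x) \<in> parcs G" using ab one V arcs_symmetric by blast+
      \<comment> \<open>The path from \<open>a\<close> to \<open>b\<close> has at most
        \<open>2 * \<rho> a y + 1\<close> vertices and \<open>x\<close> adds one, in total at most
        \<open>2 * \<rho> x y\<close>, which does not exceed \<open>R\<close>.\<close>
      ultimately have "girth G \<le> enat (length (x # vs))"
        by (intro girth_le_closed_path) (use vs in \<open>auto simp: successively_Cons\<close>)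
      also have "\<dots> \<le> enat R" using vs(3) ab by simp
      finally show False using girth by simp
    qed
    show "?\<rho> a y \<noteq> ?\<rho> x y" if V: "x \<in> pverts G" "y \<in> pverts G" "a \<in> pverts G"
      and xa: "?\<rho> x a = 1" "2 * ?\<rho> x y + 1 \<le> R" for x y a
    proof
      assume eq: "?\<rho> a y = ?\<rho> x y"
      have "x \<noteq> a" using zero[OF V(1,3)] xa by auto
      then obtain vs where vs: "distinct vs" "3 \<le> length vs" "length vs \<le> 2 * ?\<rho> x y + 1"
        "hd vs = x" "last vs = a" "successively (\<lambda>u v. (u, v) \<in> parcs G) vs"
        using merging_geodesics[OF star V(1,3,2) _ refl eq] by auto
      have "(a, x) \<in> parcs G" using xa one V arcs_symmetric by blast
      then have "girth G \<le> enat (length vs)" using vs by (intro girth_le_closed_path) auto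
      also have "\<dots> \<le> enat R" using vs(3) xa by simp
      finally show False using girth by simp
    qed
  qed
qed

lemma graph_metric_eq_rel_dist:
  assumes "Digraph_Component.connected G" "u \<in> pverts G" "v \<in> pverts G"
  shows "graph_metric G u v = ereal (real (rel_dist (parcs G) u v))"
  using graph_metric_eq rtrancl_if_connected assms by blast

end

section \<open>Counting vertices in locally tree-like graphs\<close>

text \<open>
  The number of vertices \<open>z\<close> at distance \<open>\<beta>\<close> from \<open>x\<close> and \<open>\<gamma>\<close> from \<open>y\<close> in a \<open>d\<close>-regular tree,
  where \<open>\<alpha>\<close> is the distance of \<open>x\<close> and \<open>y\<close>: the branch to \<open>z\<close> leaves the geodesic from \<open>x\<close>
  to \<open>y\<close> at distance \<open>h\<close> from \<open>x\<close> and has length \<open>k\<close>.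
\<close>

definition tree_count :: "nat \<Rightarrow> nat \<Rightarrow> nat \<Rightarrow> nat \<Rightarrow> nat" where
  "tree_count d \<alpha> \<beta> \<gamma> =
    (if \<alpha> \<le> \<beta> + \<gamma> \<and> \<beta> \<le> \<alpha> + \<gamma> \<and> \<gamma> \<le> \<alpha> + \<beta> \<and> even (\<alpha> + \<beta> + \<gamma>) then
      let h = (\<alpha> + \<beta> - \<gamma>) div 2; k = (\<beta> + \<gamma> - \<alpha>) div 2 in
      if k = 0 then 1
      else (d - (if 0 < h then 1 else 0) - (if h < \<alpha> then 1 else 0)) * (d - 1) ^ (k - 1)
     else 0)"

context local_tree
begin

text \<open>A set instead of a vertex: it is empty for \<open>x = y\<close> and a singleton within
  the tree radius, so that having no common first step is disjointness, also when one of the points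
  is the centre itself.\<close>

definition dir :: "'a \<Rightarrow> 'a \<Rightarrow> 'a set" where
  "dir x y = {a \<in> V. \<rho> x a = 1 \<and> \<rho> a y + 1 = \<rho> x y}"

lemma dist_neighbour_le:
  assumes "x \<in> V" "y \<in> V" "a \<in> V" "\<rho> x a = 1"
  shows "\<rho> a y \<le> \<rho> x y + 1" "\<rho> x y \<le> \<rho> a y + 1"
  using dist_triangle[of a x y] dist_triangle[of x a y] dist_commute[of x a] assms by auto

lemma dist_self [simp]: "x \<in> V \<Longrightarrow> \<rho> x x = 0"
  using dist_0_iff by simp

lemma dir_self [simp]: "x \<in> V \<Longrightarrow> dir x x = {}"
  by (auto simp: dir_def)

lemma finite_dir [simp]: "finite (dir x y)"
  using finite_V by (simp add: dir_def)

lemma dir_nonempty: "x \<in> V \<Longrightarrow> y \<in> V \<Longrightarrow> x \<noteq> y \<Longrightarrow> dir x y \<noteq> {}"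
  using ex_nearer[of x y] by (auto simp: dir_def)

lemma dir_eqI:
  assumes "x \<in> V" "y \<in> V" "2 * \<rho> x y \<le> R" "a \<in> dir x y"
  shows "dir x y = {a}"
  using assms nearer_unique[of x y] unfolding dir_def by blast

lemma card_dir:
  assumes "x \<in> V" "y \<in> V" "2 * \<rho> x y \<le> R"
  shows "card (dir x y) = (if x = y then 0 else 1)"
proof (cases "x = y")
  case False
  then obtain a where "a \<in> dir x y" using dir_nonempty assms by blast
  then show ?thesis using dir_eqI[OF assms, of a] False by simp
qed (use assms in simp)

lemma dir_disjoint_if_between:
  assumes "m \<in> V" "x \<in> V" "y \<in> V" "\<rho> x y = \<rho> m x + \<rho> m y"
  shows "dir m x \<inter> dir m y = {}"
proof -
  have False if a: "a \<in> V" "\<rho> a x + 1 = \<rho> m x" "\<rho> a y + 1 = \<rho> m y" for a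
    using dist_triangle[of x a y] dist_commute[of x a] a assms by simp
  then show ?thesis by (auto simp: dir_def)
qed

text \<open>Moving \<open>m\<close> one step towards \<open>x\<close> keeps the perimeter of the triangle.\<close>

lemma dist_add_if_dir_disjoint:
  assumes "m \<in> V" "x \<in> V" "y \<in> V" "dir m x \<inter> dir m y = {}" "\<rho> m x + \<rho> m y + \<rho> x y \<le> R"
  shows "\<rho> x y = \<rho> m x + \<rho> m y"
  using assms
proof (induction "\<rho> m x" arbitrary: m)
  case 0
  then show ?case using dist_0_iff[of m x] by simp
next
  case (Suc n)
  note V = Suc.prems(1-3)
  have tri: "\<rho> m y \<le> \<rho> m x + \<rho> x y" "\<rho> m x \<le> \<rho> m y + \<rho> x y"
    using dist_triangle[of m x y] dist_triangle[of m y x] dist_commute[of x y] V by auto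
  have "m \<noteq> x" using Suc.hyps(2) V by auto
  then obtain a where a: "a \<in> V" "\<rho> m a = 1" "\<rho> a x + 1 = \<rho> m x"
    using ex_nearer V by metis
  have an: "\<rho> a x = n" using a Suc.hyps by simp
  have tri': "\<rho> a y \<le> \<rho> a x + \<rho> x y" using dist_triangle V a by simp
  have "a \<in> dir m x" using a by (simp add: dir_def)
  then have "a \<notin> dir m y" using Suc.prems(4) by blast
  then have "\<rho> a y + 1 \<noteq> \<rho> m y" using a by (simp add: dir_def)
  moreover have "\<rho> a y \<noteq> \<rho> m y"
  proof
    assume eq: "\<rho> a y = \<rho> m y"
    \<comment> \<open>Twice a side of a triangle is at most its perimeter; the unit gained by moving
      to \<open>a\<close> leaves room for the extra 1.\<close>
    then have "2 * \<rho> m y + 1 \<le> R" using tri' a Suc.prems(5) by linarith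
    then show False using no_level_edge[of m y a] V a eq by simp
  qed
  ultimately have ay: "\<rho> a y = \<rho> m y + 1" using dist_neighbour_le[of m y a] V a by linarith
  have m_dir: "m \<in> dir a y" using ay a V dist_commute[of m a] by (simp add: dir_def)
  have "2 * \<rho> a y \<le> R" using tri' a ay Suc.prems(5) by linarith
  then have "dir a y = {m}" using dir_eqI[of a y m] m_dir V a by simp
  moreover have "m \<notin> dir a x" using a by (simp add: dir_def)
  ultimately have "dir a x \<inter> dir a y = {}" by simp
  moreover have "\<rho> a x + \<rho> a y + \<rho> x y \<le> R" using Suc.prems(5) ay a by simp
  ultimately have "\<rho> x y = \<rho> a x + \<rho> a y" using Suc.hyps(1)[of a] an a V by simp
  then show ?case using ay a by simp
qed

text \<open>Move \<open>x\<close> along a first step common to \<open>y\<close> and \<open>z\<close>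
  as long as there is one; each move shortens the perimeter by 2. Once the directions are disjoint,
  \<open>x\<close> lies between \<open>y\<close> and \<open>z\<close> and is the median.\<close>

lemma median_exists:
  assumes "x \<in> V" "y \<in> V" "z \<in> V" "\<rho> x y + \<rho> x z + \<rho> y z \<le> R"
  shows "\<exists>m\<in>V. \<rho> x y = \<rho> x m + \<rho> m y \<and> \<rho> x z = \<rho> x m + \<rho> m z \<and> \<rho> y z = \<rho> y m + \<rho> m z"
  using assms
proof (induction "\<rho> x y" arbitrary: x)
  case 0
  then show ?case using dist_0_iff[of x y] by (intro bexI[of _ y]) auto
next
  case (Suc n)
  note V = Suc.prems(1-3)
  show ?case
  proof (cases "dir x y \<inter> dir x z = {}")
    case True
    then have "\<rho> y z = \<rho> x y + \<rho> x z"
      using dist_add_if_dir_disjoint V Suc.prems(4) by blast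
    then show ?thesis using V dist_commute[of x y] by (intro bexI[of _ x]) auto
  next
    case False
    then obtain a where a: "a \<in> V" "\<rho> x a = 1" "\<rho> a y + 1 = \<rho> x y" "\<rho> a z + 1 = \<rho> x z"
      by (auto simp: dir_def)
    have "n = \<rho> a y" "\<rho> a y + \<rho> a z + \<rho> y z \<le> R"
      using a Suc.hyps Suc.prems by auto
    then obtain m where m: "m \<in> V" "\<rho> a y = \<rho> a m + \<rho> m y" "\<rho> a z = \<rho> a m + \<rho> m z"
      "\<rho> y z = \<rho> y m + \<rho> m z"
      using Suc.hyps(1)[of a] a V by blast
    have "\<rho> x m = \<rho> a m + 1"
      using dist_neighbour_le[of x m a] dist_triangle[of x m y] a m V by simp
    then show ?thesis using a m by (intro bexI[of _ m]) auto
  qed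
qed

text \<open>The first step towards \<open>m\<close> is also one towards \<open>y\<close>, hence the
  only element of \<open>dir x y\<close>, and the same holds for \<open>m'\<close>; so both points
  are approached by the same step.\<close>

lemma geodesic_point_unique:
  assumes "x \<in> V" "y \<in> V" "m \<in> V" "m' \<in> V" "2 * \<rho> x y \<le> R"
    and "\<rho> x y = \<rho> x m + \<rho> m y" "\<rho> x y = \<rho> x m' + \<rho> m' y" "\<rho> x m = \<rho> x m'"
  shows "m = m'"
  using assms
proof (induction "\<rho> x m" arbitrary: x)
  case 0
  then show ?case using dist_0_iff[of x m] dist_0_iff[of x m'] by auto
next
  case (Suc n)
  have near: "\<exists>a. dir x y = {a} \<and> a \<in> V \<and> \<rho> x a = 1 \<and> \<rho> a w + 1 = \<rho> x w \<and> \<rho> a y = \<rho> a w + \<rho> w y"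
    if w: "w \<in> V" "\<rho> x y = \<rho> x w + \<rho> w y" "\<rho> x w = Suc n" for w
  proof -
    have "x \<noteq> w" using w Suc.prems by auto
    then obtain a where a: "a \<in> V" "\<rho> x a = 1" "\<rho> a w + 1 = \<rho> x w"
      using ex_nearer w Suc.prems by metis
    then have ay: "\<rho> a y + 1 = \<rho> x y"
      using dist_triangle[of a w y] dist_neighbour_le[of x y a] w Suc.prems by linarith
    then have "a \<in> dir x y" using a by (simp add: dir_def)
    then have "dir x y = {a}" using dir_eqI Suc.prems by blast
    then show ?thesis using a ay w by (intro exI[of _ a]) auto
  qed
  obtain a where a: "dir x y = {a}" "a \<in> V" "\<rho> x a = 1" "\<rho> a m + 1 = \<rho> x m" "\<rho> a y = \<rho> a m + \<rho> m y"
    using near[of m] Suc.hyps Suc.prems by metis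
  have a': "\<rho> a m' + 1 = \<rho> x m'" "\<rho> a y = \<rho> a m' + \<rho> m' y"
  proof -
    have "\<rho> x m' = Suc n" using Suc.hyps Suc.prems by simp
    then obtain b where b: "dir x y = {b}" "\<rho> b m' + 1 = \<rho> x m'" "\<rho> b y = \<rho> b m' + \<rho> m' y"
      using near[of m'] Suc.prems by blast
    then have "b = a" using a(1) by simp
    then show "\<rho> a m' + 1 = \<rho> x m'" "\<rho> a y = \<rho> a m' + \<rho> m' y" using b by simp_all
  qed
  show ?case
    using Suc.hyps(1)[of a] Suc.hyps(2) Suc.prems a a' by simp
qed

lemma geodesic_point_exists:
  assumes "x \<in> V" "y \<in> V" "h \<le> \<rho> x y"
  shows "\<exists>m\<in>V. \<rho> x m = h \<and> \<rho> x y = \<rho> x m + \<rho> m y"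
  using assms
proof (induction h arbitrary: x)
  case 0
  then show ?case by (intro bexI[of _ x]) auto
next
  case (Suc h)
  then have "x \<noteq> y" by auto
  then obtain a where a: "a \<in> V" "\<rho> x a = 1" "\<rho> a y + 1 = \<rho> x y"
    using ex_nearer Suc.prems by metis
  then obtain m where m: "m \<in> V" "\<rho> a m = h" "\<rho> a y = \<rho> a m + \<rho> m y"
    using Suc.IH[of a] Suc.prems by auto
  have "\<rho> x m = Suc h"
    using dist_neighbour_le[of x m a] dist_triangle[of x m y] a m Suc.prems by simp
  then show ?case using a m by (intro bexI[of _ m]) auto
qed

text \<open>Every vertex of the next sphere has one parent and inherits its direction from
  \<open>m\<close>, and every parent has \<open>d - 1\<close> children; only the first step is
  restricted by \<open>F\<close>.\<close>

lemma card_avoiding_sphere: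
  assumes m: "m \<in> V" and F: "F \<subseteq> {a \<in> V. \<rho> m a = 1}" and k: "1 \<le> k" "2 * k \<le> R"
  shows "card {z \<in> V. \<rho> m z = k \<and> dir m z \<inter> F = {}} = (d - card F) * (d - 1) ^ (k - 1)"
  using k
proof (induction k rule: nat_induct_at_least)
  case base
  have "dir m z = {z}" if "z \<in> V" "\<rho> m z = 1" for z
    using that dist_0_iff by (auto simp: dir_def)
  then have "{z \<in> V. \<rho> m z = 1 \<and> dir m z \<inter> F = {}} = {a \<in> V. \<rho> m a = 1} - F"
    by auto
  then show ?case using card_Diff_subset[OF finite_subset[OF F] F] finite_V degree[OF m] by simp
next
  case (Suc k)
  define S where "S k = {z \<in> V. \<rho> m z = k \<and> dir m z \<inter> F = {}}" for k
  define C where "C w = {z \<in> V. \<rho> w z = 1 \<and> \<rho> m z = Suc k}" for w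
  have same_dir: "dir m z = dir m w" if wz: "w \<in> V" "z \<in> V" "\<rho> w z = 1" "\<rho> m z = Suc k" "\<rho> m w = k" for w z
  proof -
    have "m \<noteq> w" using wz Suc.hyps m by auto
    then obtain a where a: "a \<in> dir m w" using dir_nonempty[of m w] m wz by blast
    then have aV: "a \<in> V" "\<rho> m a = 1" "\<rho> a w + 1 = k" using wz by (auto simp: dir_def)
    then have "\<rho> a z + 1 = \<rho> m z"
      using dist_triangle[of a w z] dist_neighbour_le[of m z a] wz m by simp
    then have "a \<in> dir m z" using aV by (simp add: dir_def)
    then show ?thesis
      using dir_eqI[of m z a] dir_eqI[of m w a] a wz m Suc.prems by simp
  qed
  have "S (Suc k) = (\<Union>w\<in>S k. C w)"
  proof (intro equalityI subsetI)
    fix z assume "z \<in> S (Suc k)"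
    then have z: "z \<in> V" "\<rho> m z = Suc k" "dir m z \<inter> F = {}" by (auto simp: S_def)
    then have "z \<noteq> m" using m by auto
    then obtain w where w: "w \<in> V" "\<rho> z w = 1" "\<rho> w m + 1 = \<rho> z m"
      using ex_nearer z m by metis
    then have "\<rho> w z = 1" "\<rho> m w = k" using dist_commute z m by auto
    then show "z \<in> (\<Union>w\<in>S k. C w)" using z w same_dir[of w z] by (auto simp: S_def C_def)
  next
    fix z assume "z \<in> (\<Union>w\<in>S k. C w)"
    then show "z \<in> S (Suc k)" using same_dir by (auto simp: S_def C_def)
  qed
  moreover have "card (\<Union>w\<in>S k. C w) = (\<Sum>w\<in>S k. card (C w))"
  proof (rule card_UN_disjoint)
    show "finite (S k)" "\<forall>w\<in>S k. finite (C w)" using finite_V by (auto simp: S_def C_def)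
    show "\<forall>w\<in>S k. \<forall>w'\<in>S k. w \<noteq> w' \<longrightarrow> C w \<inter> C w' = {}"
    proof (intro ballI impI, rule ccontr)
      fix w w' assume w: "w \<in> S k" "w' \<in> S k" "w \<noteq> w'" and "C w \<inter> C w' \<noteq> {}"
      then obtain z where "z \<in> V" "\<rho> w z = 1" "\<rho> w' z = 1" "\<rho> m z = Suc k" by (auto simp: C_def)
      moreover have "w \<in> V" "w' \<in> V" "\<rho> m w = k" "\<rho> m w' = k" using w by (auto simp: S_def)
      ultimately show False
        using nearer_unique[of z m w w'] w(3) m dist_commute Suc.prems by simp
    qed
  qed
  moreover have "card (C w) = d - 1" if "w \<in> S k" for w
  proof -
    have w: "w \<in> V" "\<rho> m w = k" "\<rho> w m = k" "w \<noteq> m" using that Suc.hyps m dist_commute by (auto simp: S_def)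
    \<comment> \<open>No edge stays on a level, so every neighbour of \<open>w\<close> except its
      parent lies one level farther out.\<close>
    have "C w = {a \<in> V. \<rho> w a = 1} - dir w m"
    proof -
      have "\<rho> m a = Suc k \<longleftrightarrow> \<rho> a m + 1 \<noteq> \<rho> w m" if a: "a \<in> V" "\<rho> w a = 1" for a
      proof -
        have "\<rho> a m \<le> k + 1" "k \<le> \<rho> a m + 1" "\<rho> m a = \<rho> a m"
          using dist_neighbour_le[of w m a] dist_commute[of a m] a w m by auto
        moreover have "\<rho> a m \<noteq> k" using no_level_edge[of w m a] a w m Suc.prems by simp
        ultimately show ?thesis unfolding w(3) by linarith
      qed
      then show ?thesis by (auto simp: C_def dir_def)
    qed
    moreover have "dir w m \<subseteq> {a \<in> V. \<rho> w a = 1}" by (auto simp: dir_def)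
    moreover have "card (dir w m) = 1" using card_dir[of w m] w m Suc.prems by simp
    ultimately show ?thesis using card_Diff_subset[of "dir w m"] degree[OF w(1)] by simp
  qed
  ultimately have "card (S (Suc k)) = card (S k) * (d - 1)" by simp
  also have "card (S k) = (d - card F) * (d - 1) ^ (k - 1)"
    using Suc.IH Suc.prems by (simp add: S_def)
  finally show ?case using Suc.hyps by (cases k) (simp_all add: S_def)
qed

text \<open>The median of \<open>x\<close>, \<open>y\<close>, \<open>z\<close> lies on the geodesic
  from \<open>x\<close> to \<open>y\<close> at a distance \<open>h\<close> fixed by the side
  lengths, so it is the same point \<open>m\<close> for all \<open>z\<close>. The set is therefore a
  sphere about \<open>m\<close> without the directions back to \<open>x\<close> and
  \<open>y\<close>.\<close>

theorem card_triangle: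
  assumes V: "x \<in> V" "y \<in> V" and bound: "\<rho> x y + \<beta> + \<gamma> \<le> R"
  shows "card {z \<in> V. \<rho> x z = \<beta> \<and> \<rho> y z = \<gamma>} = tree_count d (\<rho> x y) \<beta> \<gamma>"
proof -
  define \<alpha> where "\<alpha> = \<rho> x y"
  define Z where "Z = {z \<in> V. \<rho> x z = \<beta> \<and> \<rho> y z = \<gamma>}"
  have med: "\<exists>m\<in>V. \<alpha> = \<rho> x m + \<rho> m y \<and> \<beta> = \<rho> x m + \<rho> m z \<and> \<gamma> = \<rho> y m + \<rho> m z" if "z \<in> Z" for z
  proof -
    have "z \<in> V" "\<rho> x z = \<beta>" "\<rho> y z = \<gamma>" using that by (auto simp: Z_def)
    then show ?thesis using median_exists[of x y z] bound V by (simp add: \<alpha>_def)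
  qed
  show ?thesis
  proof (cases "\<alpha> \<le> \<beta> + \<gamma> \<and> \<beta> \<le> \<alpha> + \<gamma> \<and> \<gamma> \<le> \<alpha> + \<beta> \<and> even (\<alpha> + \<beta> + \<gamma>)")
    case False
    have "z \<notin> Z" for z
    proof
      assume "z \<in> Z"
      from med[OF this] obtain m where "m \<in> V" "\<alpha> = \<rho> x m + \<rho> m y" "\<beta> = \<rho> x m + \<rho> m z" "\<gamma> = \<rho> y m + \<rho> m z"
        by blast
      then show False using False V dist_commute[of y m] by auto
    qed
    then have "card Z = 0" by (metis card.empty equals0I)
    moreover have "tree_count d \<alpha> \<beta> \<gamma> = 0" by (simp only: tree_count_def False if_False)
    ultimately show ?thesis by (simp add: \<alpha>_def Z_def)
  next
    case True
    define h k where "h = (\<alpha> + \<beta> - \<gamma>) div 2" and "k = (\<beta> + \<gamma> - \<alpha>) div 2"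
    define l where "l = (\<alpha> + \<gamma> - \<beta>) div 2"
    have l: "\<alpha> = h + l" "\<beta> = h + k" "\<gamma> = l + k"
    proof -
      have "2 dvd \<alpha> + \<beta> + \<gamma>" using True by simp
      then obtain s where s: "\<alpha> + \<beta> + \<gamma> = 2 * s" by blast
      then have "\<alpha> + \<beta> - \<gamma> = 2 * (s - \<gamma>)" "\<beta> + \<gamma> - \<alpha> = 2 * (s - \<alpha>)"
        "\<alpha> + \<gamma> - \<beta> = 2 * (s - \<beta>)" by auto
      then have "h = s - \<gamma>" "k = s - \<alpha>" "l = s - \<beta>" by (simp_all add: h_def k_def l_def)
      then show "\<alpha> = h + l" "\<beta> = h + k" "\<gamma> = l + k" using s True by auto
    qed
    obtain m where m: "m \<in> V" "\<rho> x m = h" "\<alpha> = \<rho> x m + \<rho> m y"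
      using geodesic_point_exists[OF V, of h] l by (auto simp: \<alpha>_def)
    then have my: "\<rho> m y = l" "\<rho> m x = h" "\<rho> y m = l" using l V dist_commute by auto
    define F where "F = dir m x \<union> dir m y"
    have disj: "dir m x \<inter> dir m y = {}"
      using dir_disjoint_if_between[of m x y] m my V l by (simp add: \<alpha>_def)
    \<comment> \<open>One direction is lost for each end of the geodesic that differs from
      \<open>m\<close>.\<close>
    have cF: "card F = (if 0 < h then 1 else 0) + (if h < \<alpha> then 1 else 0)"
    proof -
      have "2 * \<rho> m x \<le> R" "2 * \<rho> m y \<le> R" using my l bound by (simp_all add: \<alpha>_def[symmetric])
      moreover have "m = x \<longleftrightarrow> h = 0" "m = y \<longleftrightarrow> l = 0" using dist_0_iff m my V by metis+
      ultimately show ?thesis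
        unfolding F_def using card_Un_disjoint[OF _ _ disj] card_dir m V l by auto
    qed
    have Z: "Z = {z \<in> V. \<rho> m z = k \<and> dir m z \<inter> F = {}}"
    proof (intro equalityI subsetI)
      fix z assume z: "z \<in> Z"
      from med[OF z] obtain m' where m': "m' \<in> V" "\<alpha> = \<rho> x m' + \<rho> m' y" "\<beta> = \<rho> x m' + \<rho> m' z" "\<gamma> = \<rho> y m' + \<rho> m' z"
        by blast
      have zV: "z \<in> V" "\<rho> x z = \<beta>" "\<rho> y z = \<gamma>" using z by (auto simp: Z_def)
      have "\<rho> x m' = h" using m' l V dist_commute[of y m'] by simp
      moreover have "2 * \<rho> x y \<le> R" using bound l by (simp add: \<alpha>_def)
      ultimately have "m = m'"
        using geodesic_point_unique[of x y m m'] m m' V by (simp add: \<alpha>_def)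
      then have mz: "\<rho> m z = k" using m' l m by simp
      have "dir m z \<inter> dir m x = {}" "dir m z \<inter> dir m y = {}"
        using dir_disjoint_if_between[of m x z] dir_disjoint_if_between[of m y z] zV V m mz my l by auto
      then show "z \<in> {z \<in> V. \<rho> m z = k \<and> dir m z \<inter> F = {}}" using zV mz by (auto simp: F_def)
    next
      fix z assume "z \<in> {z \<in> V. \<rho> m z = k \<and> dir m z \<inter> F = {}}"
      then have z: "z \<in> V" "\<rho> m z = k" "dir m x \<inter> dir m z = {}" "dir m y \<inter> dir m z = {}"
        by (auto simp: F_def)
      have "\<rho> x z \<le> h + k" "\<rho> y z \<le> l + k"
        using dist_triangle[of x m z] dist_triangle[of y m z] V m my z by auto
      then have "\<rho> x z = h + k" "\<rho> y z = l + k"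
        using dist_add_if_dir_disjoint[of m x z] dist_add_if_dir_disjoint[of m y z] V m my z l bound
        by (simp_all add: \<alpha>_def[symmetric])
      then show "z \<in> Z" using z l by (simp add: Z_def)
    qed
    have "card Z = (if k = 0 then 1 else (d - card F) * (d - 1) ^ (k - 1))"
    proof (cases "k = 0")
      case True
      then have "Z = {m}" using Z m dist_0_iff by auto
      then show ?thesis using True by simp
    next
      case False
      have "2 * k \<le> R" using bound l by (simp add: \<alpha>_def[symmetric])
      then show ?thesis
        using card_avoiding_sphere[of m F k] False m by (simp add: Z F_def dir_def subset_iff)
    qed
    then show ?thesis
      unfolding Z_def[symmetric] \<alpha>_def[symmetric] tree_count_def Let_def h_def[symmetric] k_def[symmetric] cF
      using True by simp
  qed
qed

lemma card_sphere:
  assumes "x \<in> V" "2 * k \<le> R"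
  shows "card {z \<in> V. \<rho> x z = k} = tree_count d 0 k k"
  using card_triangle[of x x k k] assms by simp

end

section \<open>Energies of product kernels\<close>

definition tuples :: "nat \<Rightarrow> 'a set \<Rightarrow> 'a list set" where
  "tuples n V = {xs. length xs = n \<and> set xs \<subseteq> V}"

lemma finite_tuples [simp]: "finite V \<Longrightarrow> finite (tuples n V)"
  unfolding tuples_def using finite_lists_length_eq[of V n] by (simp add: conj_commute)

lemma tuples_nth: "xs \<in> tuples n V \<Longrightarrow> i < n \<Longrightarrow> xs ! i \<in> V"
  by (auto simp: tuples_def)

text \<open>Distributivity; it reduces the counts and kernel products on triples to a single
  coordinate.\<close>

lemma sum_prod_tuples:
  fixes g :: "nat \<Rightarrow> 'a \<Rightarrow> 'b::comm_semiring_1"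
  assumes "finite V"
  shows "(\<Sum>xs\<in>tuples n V. \<Prod>i<n. g i (xs ! i)) = (\<Prod>i<n. \<Sum>x\<in>V. g i x)"
proof (induction n arbitrary: g)
  case 0
  have "tuples 0 V = {[]}" by (auto simp: tuples_def)
  then show ?case by simp
next
  case (Suc n)
  have bij: "bij_betw (\<lambda>(x, xs). x # xs) (V \<times> tuples n V) (tuples (Suc n) V)"
    by (rule bij_betwI[of _ _ _ "\<lambda>xs. (hd xs, tl xs)"]) (auto simp: tuples_def length_Suc_conv)
  have "(\<Sum>xs\<in>tuples (Suc n) V. \<Prod>i<Suc n. g i (xs ! i))
      = (\<Sum>(x, xs)\<in>V \<times> tuples n V. g 0 x * (\<Prod>i<n. g (Suc i) (xs ! i)))"
    by (subst sum.reindex_bij_betw[OF bij, symmetric])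
       (simp add: case_prod_unfold prod.lessThan_Suc_shift del: prod.lessThan_Suc)
  also have "\<dots> = (\<Sum>x\<in>V. g 0 x) * (\<Sum>xs\<in>tuples n V. \<Prod>i<n. g (Suc i) (xs ! i))"
    by (simp add: sum.cartesian_product[symmetric] sum_product)
  also have "\<dots> = (\<Prod>i<Suc n. \<Sum>x\<in>V. g i x)"
    unfolding Suc.IH[of "\<lambda>i. g (Suc i)"] by (simp add: prod.lessThan_Suc_shift del: prod.lessThan_Suc)
  finally show ?case .
qed

lemma prod_of_bool:
  "finite A \<Longrightarrow> (\<Prod>i\<in>A. of_bool (P i)) = (of_bool (\<forall>i\<in>A. P i) :: 'b::comm_semiring_1)"
  by (induction A rule: finite_induct) auto

lemma card_tuples_if:
  assumes "finite V"
  shows "card {xs \<in> tuples n V. \<forall>i<n. P i (xs ! i)} = (\<Prod>i<n. card {x \<in> V. P i x})"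
proof -
  have card: "card {x \<in> A. Q x} = (\<Sum>x\<in>A. of_bool (Q x))" if "finite A" for A :: "'c set" and Q
    using that by (simp add: sum.If_cases of_bool_def Int_def)
  have "card {xs \<in> tuples n V. \<forall>i<n. P i (xs ! i)} = (\<Sum>xs\<in>tuples n V. \<Prod>i<n. of_bool (P i (xs ! i)))"
    using assms by (simp add: card prod_of_bool Ball_def)
  also have "\<dots> = (\<Prod>i<n. card {x \<in> V. P i x})"
    unfolding sum_prod_tuples[OF assms, of "\<lambda>i x. of_bool (P i x)"] using assms by (simp add: card)
  finally show ?thesis .
qed

text \<open>The Dirichlet form of the weights \<open>K\<close>, taken over ordered pairs; an
  undirected edge thus contributes twice.\<close>

definition energy :: "'a set \<Rightarrow> ('a \<Rightarrow> real) \<Rightarrow> ('a \<Rightarrow> 'a \<Rightarrow> real) \<Rightarrow> real" where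
  "energy X f K = (\<Sum>x\<in>X. \<Sum>y\<in>X. K x y * (f x - f y)\<^sup>2)"

definition kcomp :: "'a set \<Rightarrow> ('a \<Rightarrow> 'a \<Rightarrow> real) \<Rightarrow> ('a \<Rightarrow> 'a \<Rightarrow> real) \<Rightarrow> 'a \<Rightarrow> 'a \<Rightarrow> real" where
  "kcomp X K L x z = (\<Sum>y\<in>X. K x y * L y z)"

lemma energy_mono:
  assumes "\<And>x y. x \<in> X \<Longrightarrow> y \<in> X \<Longrightarrow> c * K x y \<le> L x y"
  shows "c * energy X f K \<le> energy X f L"
  unfolding energy_def sum_distrib_left mult.assoc[symmetric]
  by (intro sum_mono mult_right_mono assms) auto

lemma energy_nonneg: "(\<And>x y. x \<in> X \<Longrightarrow> y \<in> X \<Longrightarrow> 0 \<le> K x y) \<Longrightarrow> 0 \<le> energy X f K"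
  unfolding energy_def by (intro sum_nonneg mult_nonneg_nonneg) auto

text \<open>Split the difference of \<open>f\<close> along a two-step path at its middle vertex, at
  the price of a factor 2. A first step then occurs once for each continuation, whence the row sums
  of \<open>L\<close>, and a second step once for each arrival, whence the column sums of
  \<open>K\<close>.\<close>

lemma energy_kcomp_le:
  assumes K: "\<And>x y. x \<in> X \<Longrightarrow> y \<in> X \<Longrightarrow> 0 \<le> K x y" and L: "\<And>x y. x \<in> X \<Longrightarrow> y \<in> X \<Longrightarrow> 0 \<le> L x y"
    and row: "\<And>y. y \<in> X \<Longrightarrow> (\<Sum>z\<in>X. L y z) \<le> r"
    and col: "\<And>y. y \<in> X \<Longrightarrow> (\<Sum>x\<in>X. K x y) \<le> c"
  shows "energy X f (kcomp X K L) \<le> 2 * (r * energy X f K + c * energy X f L)"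
proof -
  have sq: "(a - b)\<^sup>2 \<le> 2 * ((a - e)\<^sup>2 + (e - b)\<^sup>2)" for a b e :: real
  proof -
    have "0 \<le> ((a - e) - (e - b))\<^sup>2" by simp
    then show ?thesis by (simp add: power2_eq_square algebra_simps)
  qed
  have "energy X f (kcomp X K L) = (\<Sum>x\<in>X. \<Sum>z\<in>X. \<Sum>y\<in>X. K x y * L y z * (f x - f z)\<^sup>2)"
    by (simp add: energy_def kcomp_def sum_distrib_right)
  also have "\<dots> \<le> (\<Sum>x\<in>X. \<Sum>z\<in>X. \<Sum>y\<in>X. K x y * L y z * (2 * ((f x - f y)\<^sup>2 + (f y - f z)\<^sup>2)))"
    by (intro sum_mono mult_left_mono sq mult_nonneg_nonneg K L)
  also have "\<dots> = 2 * ((\<Sum>x\<in>X. \<Sum>z\<in>X. \<Sum>y\<in>X. L y z * (K x y * (f x - f y)\<^sup>2))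
      + (\<Sum>x\<in>X. \<Sum>z\<in>X. \<Sum>y\<in>X. K x y * (L y z * (f y - f z)\<^sup>2)))"
  proof -
    have "K x y * L y z * (2 * ((f x - f y)\<^sup>2 + (f y - f z)\<^sup>2))
        = 2 * (L y z * (K x y * (f x - f y)\<^sup>2) + K x y * (L y z * (f y - f z)\<^sup>2))" for x y z
      by (simp add: distrib_left)
    then show ?thesis by (simp only: sum.distrib sum_distrib_left[symmetric])
  qed
  also have "(\<Sum>x\<in>X. \<Sum>z\<in>X. \<Sum>y\<in>X. L y z * (K x y * (f x - f y)\<^sup>2))
      = (\<Sum>x\<in>X. \<Sum>y\<in>X. (\<Sum>z\<in>X. L y z) * (K x y * (f x - f y)\<^sup>2))"
    unfolding sum_distrib_right by (rule sum.cong[OF refl], rule sum.swap)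
  also have "(\<Sum>x\<in>X. \<Sum>z\<in>X. \<Sum>y\<in>X. K x y * (L y z * (f y - f z)\<^sup>2))
      = (\<Sum>z\<in>X. \<Sum>y\<in>X. (\<Sum>x\<in>X. K x y) * (L y z * (f y - f z)\<^sup>2))"
    unfolding sum_distrib_right by (rule sum_rotate)
  also have "\<dots> = (\<Sum>y\<in>X. \<Sum>z\<in>X. (\<Sum>x\<in>X. K x y) * (L y z * (f y - f z)\<^sup>2))"
    by (rule sum.swap)
  also have "(\<Sum>x\<in>X. \<Sum>y\<in>X. (\<Sum>z\<in>X. L y z) * (K x y * (f x - f y)\<^sup>2)) \<le> r * energy X f K"
    unfolding energy_def sum_distrib_left
    by (intro sum_mono mult_right_mono row mult_nonneg_nonneg K) auto
  also have "(\<Sum>y\<in>X. \<Sum>z\<in>X. (\<Sum>x\<in>X. K x y) * (L y z * (f y - f z)\<^sup>2)) \<le> c * energy X f L"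
    unfolding energy_def sum_distrib_left
    by (intro sum_mono mult_right_mono col mult_nonneg_nonneg L) auto
  finally show ?thesis by simp
qed

lemma kcomp_nonneg:
  assumes "\<And>x y. x \<in> X \<Longrightarrow> y \<in> X \<Longrightarrow> 0 \<le> K x y" "\<And>x y. x \<in> X \<Longrightarrow> y \<in> X \<Longrightarrow> 0 \<le> L x y" "x \<in> X" "y \<in> X"
  shows "0 \<le> kcomp X K L x y"
  unfolding kcomp_def by (intro sum_nonneg mult_nonneg_nonneg assms)

lemma kcomp_col_le:
  assumes K: "\<And>y. y \<in> X \<Longrightarrow> (\<Sum>x\<in>X. K x y) \<le> c" and L: "\<And>y. y \<in> X \<Longrightarrow> (\<Sum>x\<in>X. L x y) \<le> c'"
    and "\<And>x y. x \<in> X \<Longrightarrow> y \<in> X \<Longrightarrow> 0 \<le> L x y" "0 \<le> c" "z \<in> X"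
  shows "(\<Sum>x\<in>X. kcomp X K L x z) \<le> c * c'"
proof -
  have "(\<Sum>x\<in>X. kcomp X K L x z) = (\<Sum>y\<in>X. (\<Sum>x\<in>X. K x y) * L y z)"
    unfolding kcomp_def sum_distrib_right by (rule sum.swap)
  also have "\<dots> \<le> (\<Sum>y\<in>X. c * L y z)"
    by (intro sum_mono mult_right_mono K assms)
  also have "\<dots> \<le> c * c'"
    unfolding sum_distrib_left[symmetric] by (intro mult_left_mono L assms)
  finally show ?thesis .
qed

definition pkern :: "nat \<Rightarrow> (nat \<Rightarrow> 'a \<Rightarrow> 'a \<Rightarrow> real) \<Rightarrow> 'a list \<Rightarrow> 'a list \<Rightarrow> real" where
  "pkern n F x y = (\<Prod>i<n. F i (x ! i) (y ! i))"

text \<open>Because of this, walks of product kernels on triples can be constructed separately in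
  each coordinate.\<close>

lemma kcomp_pkern:
  assumes "finite V"
  shows "kcomp (tuples n V) (pkern n F) (pkern n G) = pkern n (\<lambda>i. kcomp V (F i) (G i))"
proof (intro ext)
  fix x z
  show "kcomp (tuples n V) (pkern n F) (pkern n G) x z = pkern n (\<lambda>i. kcomp V (F i) (G i)) x z"
    unfolding kcomp_def pkern_def prod.distrib[symmetric]
    by (rule sum_prod_tuples[OF assms, where g = "\<lambda>i y. F i (x ! i) y * G i y (z ! i)"])
qed

lemma pkern_row: "finite V \<Longrightarrow> (\<Sum>y\<in>tuples n V. pkern n F x y) = (\<Prod>i<n. \<Sum>y\<in>V. F i (x ! i) y)"
  unfolding pkern_def by (rule sum_prod_tuples[where g = "\<lambda>i. F i (x ! i)"])

lemma pkern_col: "finite V \<Longrightarrow> (\<Sum>x\<in>tuples n V. pkern n F x y) = (\<Prod>i<n. \<Sum>x\<in>V. F i x (y ! i))"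
  unfolding pkern_def by (rule sum_prod_tuples[where g = "\<lambda>i x. F i x (y ! i)"])

lemma pkern_nonneg: "(\<And>i x y. 0 \<le> F i x y) \<Longrightarrow> 0 \<le> pkern n F x y"
  unfolding pkern_def by (intro prod_nonneg) auto

lemma pkern_mono:
  assumes "\<And>i x y. i < n \<Longrightarrow> x \<in> V \<Longrightarrow> y \<in> V \<Longrightarrow> c i * F i x y \<le> G i x y"
    and "\<And>i x y. 0 \<le> F i x y" "\<And>i. i < n \<Longrightarrow> 0 \<le> c i" and "x \<in> tuples n V" "y \<in> tuples n V"
  shows "(\<Prod>i<n. c i) * pkern n F x y \<le> pkern n G x y"
  unfolding pkern_def prod.distrib[symmetric]
  using assms by (intro prod_mono) (auto simp: tuples_nth)

section \<open>Tree counts up to factors independent of the degree\<close>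

lemma tree_count_eq:
  "tree_count d (h + l) (h + k) (l + k) =
    (if k = 0 then 1 else (d - (if 0 < h then 1 else 0) - (if 0 < l then 1 else 0)) * (d - 1) ^ (k - 1))"
proof -
  have "(h + l + (h + k) - (l + k)) div 2 = h" "(h + k + (l + k) - (h + l)) div 2 = k" by auto
  then show ?thesis unfolding tree_count_def Let_def by auto
qed

text \<open>The branch starts with \<open>d\<close>, \<open>d - 1\<close> or \<open>d - 2\<close>
  choices. For \<open>d \<ge> 3\<close> each of these is within a factor 2 of
  \<open>d - 1\<close>.\<close>

lemma tree_count_bounds:
  assumes "3 \<le> d"
  shows "(d - 1) ^ k \<le> 2 * tree_count d (h + l) (h + k) (l + k)"
    and "tree_count d (h + l) (h + k) (l + k) \<le> 2 * (d - 1) ^ k"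
proof -
  define e :: nat where "e = d - (if 0 < h then 1 else 0) - (if 0 < l then 1 else 0)"
  have e: "d - 1 \<le> 2 * e" "e \<le> 2 * (d - 1)" using assms by (auto simp: e_def)
  have tc: "tree_count d (h + l) (h + k) (l + k) = (if k = 0 then 1 else e * (d - 1) ^ (k - 1))"
    unfolding tree_count_eq e_def ..
  show "(d - 1) ^ k \<le> 2 * tree_count d (h + l) (h + k) (l + k)"
    unfolding tc using mult_right_mono[OF e(1), of "(d - 1) ^ (k - 1)"]
    by (cases k) (simp_all add: algebra_simps)
  show "tree_count d (h + l) (h + k) (l + k) \<le> 2 * (d - 1) ^ k"
    unfolding tc using mult_right_mono[OF e(2), of "(d - 1) ^ (k - 1)"]
    by (cases k) (simp_all add: algebra_simps)
qed

text \<open>Three legs that meet in a median: one formula for the triangle inequalities and the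
  parity condition of \<open>tree_count\<close>.\<close>

definition tripod :: "nat \<Rightarrow> nat \<Rightarrow> nat \<Rightarrow> bool" where
  "tripod \<alpha> \<beta> \<gamma> \<longleftrightarrow> (\<exists>h k l. \<alpha> = h + l \<and> \<beta> = h + k \<and> \<gamma> = l + k)"

lemma tripod_iff:
  "tripod \<alpha> \<beta> \<gamma> \<longleftrightarrow> \<alpha> \<le> \<beta> + \<gamma> \<and> \<beta> \<le> \<alpha> + \<gamma> \<and> \<gamma> \<le> \<alpha> + \<beta> \<and> even (\<alpha> + \<beta> + \<gamma>)"
proof
  assume r: "\<alpha> \<le> \<beta> + \<gamma> \<and> \<beta> \<le> \<alpha> + \<gamma> \<and> \<gamma> \<le> \<alpha> + \<beta> \<and> even (\<alpha> + \<beta> + \<gamma>)"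
  then obtain s where "\<alpha> + \<beta> + \<gamma> = 2 * s" by blast
  then have "\<alpha> = (s - \<gamma>) + (s - \<beta>)" "\<beta> = (s - \<gamma>) + (s - \<alpha>)" "\<gamma> = (s - \<beta>) + (s - \<alpha>)"
    using r by auto
  then show "tripod \<alpha> \<beta> \<gamma>" unfolding tripod_def by blast
qed (auto simp: tripod_def)

lemma tripod_swap: "tripod \<alpha> \<beta> \<gamma> \<Longrightarrow> tripod \<beta> \<alpha> \<gamma>"
  by (auto simp: tripod_iff)

lemma tree_count_eq_0: "\<not> tripod \<alpha> \<beta> \<gamma> \<Longrightarrow> tree_count d \<alpha> \<beta> \<gamma> = 0"
  by (simp only: tripod_iff tree_count_def if_False)

text \<open>The branch lengths \<open>k i\<close> solve
  \<open>\<beta> i + \<gamma> i = \<alpha> i + 2 * k i\<close>, so only their total \<open>s\<close>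
  enters the product of the powers; every index costs one factor 2.\<close>

lemma prod_tree_count_bounds:
  assumes d: "3 \<le> d" and I: "finite I" "\<And>i. i \<in> I \<Longrightarrow> tripod (\<alpha> i) (\<beta> i) (\<gamma> i)"
    and s: "(\<Sum>i\<in>I. \<beta> i) + (\<Sum>i\<in>I. \<gamma> i) = (\<Sum>i\<in>I. \<alpha> i) + 2 * s"
  shows "(d - 1) ^ s \<le> 2 ^ card I * (\<Prod>i\<in>I. tree_count d (\<alpha> i) (\<beta> i) (\<gamma> i))"
    and "(\<Prod>i\<in>I. tree_count d (\<alpha> i) (\<beta> i) (\<gamma> i)) \<le> 2 ^ card I * (d - 1) ^ s"
proof -
  have "\<forall>i\<in>I. \<exists>k. \<beta> i + \<gamma> i = \<alpha> i + 2 * k \<and> (d - 1) ^ k \<le> 2 * tree_count d (\<alpha> i) (\<beta> i) (\<gamma> i) \<and>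
      tree_count d (\<alpha> i) (\<beta> i) (\<gamma> i) \<le> 2 * (d - 1) ^ k"
  proof
    fix i assume "i \<in> I"
    then obtain h k l where "\<alpha> i = h + l" "\<beta> i = h + k" "\<gamma> i = l + k"
      using I(2) unfolding tripod_def by blast
    then show "\<exists>k. \<beta> i + \<gamma> i = \<alpha> i + 2 * k \<and> (d - 1) ^ k \<le> 2 * tree_count d (\<alpha> i) (\<beta> i) (\<gamma> i) \<and>
      tree_count d (\<alpha> i) (\<beta> i) (\<gamma> i) \<le> 2 * (d - 1) ^ k"
      using tree_count_bounds[OF d, where h = h and k = k and l = l] by (intro exI[of _ k]) auto
  qed
  from bchoice[OF this] obtain k where
    "\<forall>i\<in>I. \<beta> i + \<gamma> i = \<alpha> i + 2 * k i \<and> (d - 1) ^ k i \<le> 2 * tree_count d (\<alpha> i) (\<beta> i) (\<gamma> i) \<and>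
      tree_count d (\<alpha> i) (\<beta> i) (\<gamma> i) \<le> 2 * (d - 1) ^ k i" ..
  then have k: "\<And>i. i \<in> I \<Longrightarrow> \<beta> i + \<gamma> i = \<alpha> i + 2 * k i"
    "\<And>i. i \<in> I \<Longrightarrow> (d - 1) ^ k i \<le> 2 * tree_count d (\<alpha> i) (\<beta> i) (\<gamma> i)"
    "\<And>i. i \<in> I \<Longrightarrow> tree_count d (\<alpha> i) (\<beta> i) (\<gamma> i) \<le> 2 * (d - 1) ^ k i"
    by blast+
  have "(\<Sum>i\<in>I. \<beta> i + \<gamma> i) = (\<Sum>i\<in>I. \<alpha> i + 2 * k i)" using k(1) by (intro sum.cong) auto
  then have "(\<Sum>i\<in>I. k i) = s" using s by (simp add: sum.distrib sum_distrib_left[symmetric])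
  then have pow: "(\<Prod>i\<in>I. (d - 1) ^ k i) = (d - 1) ^ s" by (simp add: power_sum[symmetric])
  have "(\<Prod>i\<in>I. (d - 1) ^ k i) \<le> (\<Prod>i\<in>I. 2 * tree_count d (\<alpha> i) (\<beta> i) (\<gamma> i))"
    by (intro prod_mono) (use k(2) in auto)
  then show "(d - 1) ^ s \<le> 2 ^ card I * (\<Prod>i\<in>I. tree_count d (\<alpha> i) (\<beta> i) (\<gamma> i))"
    unfolding pow prod.distrib prod_constant .
  have "(\<Prod>i\<in>I. tree_count d (\<alpha> i) (\<beta> i) (\<gamma> i)) \<le> (\<Prod>i\<in>I. 2 * (d - 1) ^ k i)"
    by (intro prod_mono) (use k(3) in auto)
  then show "(\<Prod>i\<in>I. tree_count d (\<alpha> i) (\<beta> i) (\<gamma> i)) \<le> 2 ^ card I * (d - 1) ^ s"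
    unfolding prod.distrib prod_constant pow .
qed

section \<open>The six ways to distribute three labels over the coordinates\<close>

lemma mset_eq_012D:
  assumes m: "mset t = {#0, 1, 2::nat#}"
  shows "t \<in> {[0, 1, 2], [0, 2, 1], [1, 0, 2], [1, 2, 0], [2, 0, 1], [2, 1, 0]}"
proof -
  have "length t = size {#0, 1, 2::nat#}" using m by (metis size_mset)
  then have "length t = 3" by simp
  then obtain a b c where t: "t = [a, b, c]" by (auto simp: numeral_3_eq_3 length_Suc_conv)
  have "sum_list t = sum_mset {#0, 1, 2::nat#}" unfolding m[symmetric] sum_mset_sum_list ..
  then have s: "a + b + c = 3" by (simp add: t)
  \<comment> \<open>The sum 3 alone would admit \<open>[1, 1, 1]\<close>; the sum of squares
    excludes it.\<close>
  have "sum_list (map (\<lambda>x. x * x) t) = sum_mset (image_mset (\<lambda>x. x * x) {#0, 1, 2::nat#})"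
    unfolding m[symmetric] mset_map[symmetric] sum_mset_sum_list ..
  then have s2: "a * a + b * b + c * c = 5" by (simp add: t)
  have "a \<in># mset t" "b \<in># mset t" "c \<in># mset t" by (simp_all add: t)
  then have "a = 0 \<or> a = 1 \<or> a = 2" "b = 0 \<or> b = 1 \<or> b = 2" "c = 0 \<or> c = 1 \<or> c = 2"
    unfolding m by simp_all
  with s s2 show ?thesis
    unfolding t insert_iff empty_iff by (elim disjE; hypsubst; simp)
qed
text \<open>Labels instead of lengths: for \<open>p = 0\<close> two lengths agree, and a map such as
  \<open>rot\<close> would not be well defined on lengths.\<close>

definition labellings :: "nat list set" where
  "labellings = {t. mset t = {#0, 1, 2#}}"

lemma labellings_eq: "labellings = {[0, 1, 2], [0, 2, 1], [1, 0, 2], [1, 2, 0], [2, 0, 1], [2, 1, 0]}"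
proof
  show "{[0, 1, 2], [0, 2, 1], [1, 0, 2], [1, 2, 0], [2, 0, 1], [2, 1, 0]} \<subseteq> labellings"
    unfolding labellings_def by simp
qed (unfold labellings_def, rule subsetI, drule CollectD, erule mset_eq_012D)

lemma finite_labellings [simp]: "finite labellings"
  and card_labellings: "card labellings = 6"
  by (simp_all add: labellings_eq)

lemma length_labelling: "t \<in> labellings \<Longrightarrow> length t = 3"
  unfolding labellings_eq by (elim insertE emptyE) simp_all

lemma nth_labelling:
  assumes t: "t \<in> labellings" and "i < 3"
  shows "t ! i < 3"
proof -
  have "t ! i \<in> set t" using length_labelling[OF t] assms(2) by simp
  moreover have "set t \<subseteq> {..<3}" using t unfolding labellings_eq by (elim insertE emptyE) simp_all
  ultimately show ?thesis by blast
qed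

lemma sum_labelling:
  fixes g :: "nat \<Rightarrow> 'b::comm_monoid_add"
  assumes "t \<in> labellings"
  shows "(\<Sum>i<3. g (t ! i)) = g 0 + g 1 + g 2"
proof -
  have "(\<Sum>i<3. g (t ! i)) = g (t ! 0) + g (t ! 1) + g (t ! 2)"
    by (simp add: numeral_3_eq_3 numeral_2_eq_2)
  then show ?thesis
    using assms unfolding labellings_eq by (elim insertE emptyE) (simp_all add: ac_simps)
qed

lemma prod_labelling:
  fixes g :: "nat \<Rightarrow> 'b::comm_monoid_mult"
  assumes "t \<in> labellings"
  shows "(\<Prod>i<3. g (t ! i)) = g 0 * g 1 * g 2"
proof -
  have "(\<Prod>i<3. g (t ! i)) = g (t ! 0) * g (t ! 1) * g (t ! 2)"
    by (simp add: numeral_3_eq_3 numeral_2_eq_2)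
  then show ?thesis
    using assms unfolding labellings_eq by (elim insertE emptyE) (simp_all add: ac_simps)
qed

lemma mset_eq_iff_labelling:
  assumes "length u = 3"
  shows "mset u = image_mset f {#0, 1, 2#} \<longleftrightarrow> (\<exists>t\<in>labellings. u = map f t)"
proof
  define l :: "nat list" where "l = [0, 1, 2]"
  have l: "mset l = {#0, 1, 2#}" by (simp add: l_def)
  assume "mset u = image_mset f {#0, 1, 2#}"
  then have "mset u = mset (map f l)" by (simp add: l)
  from mset_eq_permutation[OF this] obtain \<pi>
    where \<pi>: "\<pi> permutes {..<length (map f l)}" "permute_list \<pi> (map f l) = u" .
  then have \<pi>l: "\<pi> permutes {..<length l}" by simp
  have "u = map f (permute_list \<pi> l)"
    using \<pi>(2) permute_list_map[OF \<pi>l, of f] by simp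
  moreover have "permute_list \<pi> l \<in> labellings"
    unfolding labellings_def mem_Collect_eq mset_permute_list[OF \<pi>l] by (rule l)
  ultimately show "\<exists>t\<in>labellings. u = map f t" by blast
next
  assume "\<exists>t\<in>labellings. u = map f t"
  then obtain t where "mset t = {#0, 1, 2#}" "u = map f t" unfolding labellings_def by blast
  then show "mset u = image_mset f {#0, 1, 2#}" by (simp only: mset_map)
qed

section \<open>The link of a triple\<close>

text \<open>
  The labels \<open>0, 1, 2\<close> stand for the entries \<open>p, q, p + q\<close> of the multiset. For \<open>p = 0\<close> two
  labels have the same length, and the classes below coincide in pairs.
\<close>

locale link_of_triple = local_tree V \<rho> d "3 * (p + q)"
  for V :: "'a set" and \<rho> :: "'a \<Rightarrow> 'a \<Rightarrow> nat" and d p q :: nat +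
  fixes v :: "'a list"
  assumes d3: "3 \<le> d" and even_p: "even p" and even_q: "even q" and less: "p < q"
    and v: "v \<in> tuples 3 V"
begin

definition len :: "nat \<Rightarrow> nat" where
  "len a = (if a = 0 then p else if a = 1 then q else p + q)"

lemma len_simps [simp]: "len 0 = p" "len (Suc 0) = q" "len 1 = q" "len 2 = p + q"
  by (simp_all add: len_def)

lemma len_le: "len a \<le> p + q"
  by (simp add: len_def)

abbreviation S :: "nat multiset" where "S \<equiv> {#p, q, p + q#}"

lemma S_eq: "S = image_mset len {#0, 1, 2#}"
  by simp

text \<open>Up to a factor 8 the number of ways to complete an edge by a vertex with prescribed
  admissible labels. Each labelling has total length \<open>2 * (p + q)\<close>, so the branches in
  the three coordinates have total length \<open>p + q\<close>.\<close>

definition B :: real where "B = real ((d - 1) ^ (p + q))"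

lemma B_ge_1: "1 \<le> B"
  using d3 by (simp add: B_def)

definition L :: "'a list set" where "L = tuples 3 V"

lemma finite_L [simp]: "finite L"
  by (simp add: L_def finite_V)

lemma v_nth: "i < 3 \<Longrightarrow> v ! i \<in> V"
  using tuples_nth[OF v] .

lemma L_nth: "x \<in> L \<Longrightarrow> i < 3 \<Longrightarrow> x ! i \<in> V"
  unfolding L_def by (rule tuples_nth)

definition X :: "'a list set" where
  "X = {x \<in> L. mset (map2 \<rho> v x) = S}"

text \<open>The adjacency of the link, extended by 0 to all triples, because the product kernels to
  be compared with it live on \<open>L\<close> and not on \<open>X\<close>.\<close>

definition link_kern :: "'a list \<Rightarrow> 'a list \<Rightarrow> real" where
  "link_kern x y = of_bool (x \<in> X \<and> y \<in> X \<and> mset (map2 \<rho> x y) = S)"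

lemma mset_map2_iff:
  assumes "x \<in> L" "y \<in> L"
  shows "mset (map2 \<rho> x y) = S \<longleftrightarrow> (\<exists>t\<in>labellings. \<forall>i<3. \<rho> (x ! i) (y ! i) = len (t ! i))"
proof -
  have len: "length x = 3" "length y = 3" using assms by (auto simp: L_def tuples_def)
  have "map2 \<rho> x y = map len t \<longleftrightarrow> (\<forall>i<3. \<rho> (x ! i) (y ! i) = len (t ! i))" if "t \<in> labellings" for t
    using len length_labelling[OF that] by (auto simp: list_eq_iff_nth_eq)
  then show ?thesis
    unfolding S_eq using mset_eq_iff_labelling[of "map2 \<rho> x y" len] len by auto
qed

lemma v_in_L: "v \<in> L"
  using v by (simp add: L_def)

text \<open>For an edge \<open>xy\<close> of the link of \<open>v\<close>, the labels \<open>a\<close>, \<open>\<sigma> a\<close>, \<open>\<kappa> a\<close> belong to \<open>vx\<close>, \<open>vy\<close>, \<open>xy\<close>.\<close>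

definition link_step :: "(nat \<Rightarrow> nat) \<Rightarrow> (nat \<Rightarrow> nat) \<Rightarrow> bool" where
  "link_step \<sigma> \<kappa> \<longleftrightarrow> (\<forall>t\<in>labellings. map \<sigma> t \<in> labellings \<and> map \<kappa> t \<in> labellings) \<and>
    (\<forall>a<3. tripod (len a) (len (\<sigma> a)) (len (\<kappa> a)))"

definition step_kern :: "(nat \<Rightarrow> nat) \<Rightarrow> (nat \<Rightarrow> nat) \<Rightarrow> nat list \<Rightarrow> 'a list \<Rightarrow> 'a list \<Rightarrow> real" where
  "step_kern \<sigma> \<kappa> t = pkern 3 (\<lambda>i x y.
    of_bool (\<rho> (v ! i) x = len (t ! i) \<and> \<rho> (v ! i) y = len (\<sigma> (t ! i)) \<and> \<rho> x y = len (\<kappa> (t ! i))))"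

text \<open>Joins a whole class to a whole class. Summed over all labels it dominates the variance,
  so the aim is to bound its energy by that of the link.\<close>

definition full_kern :: "nat list \<Rightarrow> nat list \<Rightarrow> 'a list \<Rightarrow> 'a list \<Rightarrow> real" where
  "full_kern t t' = pkern 3 (\<lambda>i x y. of_bool (\<rho> (v ! i) x = len (t ! i) \<and> \<rho> (v ! i) y = len (t' ! i)))"

text \<open>The pairs within a class that three rotation steps connect well, because in each
  coordinate they leave the centre in disjoint directions.\<close>

definition apart_kern :: "nat list \<Rightarrow> 'a list \<Rightarrow> 'a list \<Rightarrow> real" where
  "apart_kern t = pkern 3 (\<lambda>i x y. of_bool (\<rho> (v ! i) x = len (t ! i) \<and> \<rho> (v ! i) y = len (t ! i) \<and>
    dir (v ! i) x \<inter> dir (v ! i) y = {}))"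

lemma kern_nonneg [simp]:
  "0 \<le> step_kern \<sigma> \<kappa> t x y" "0 \<le> full_kern t t' x y" "0 \<le> apart_kern t x y" "0 \<le> link_kern x y"
  by (simp_all add: step_kern_def full_kern_def apart_kern_def link_kern_def pkern_nonneg)

lemma sum_of_bool_eq_card: "(\<Sum>y\<in>V. of_bool (P y)) = real (card {y \<in> V. P y})"
  using finite_V by (simp add: of_bool_def sum.If_cases Int_def)

lemma card_triangle_len:
  assumes "u \<in> V" "x \<in> V" "\<rho> u x = len a"
  shows "card {y \<in> V. \<rho> u y = len b \<and> \<rho> x y = len c} = tree_count d (len a) (len b) (len c)"
proof -
  have "\<rho> u x + len b + len c \<le> 3 * (p + q)"
    using len_le[of a] len_le[of b] len_le[of c] assms by simp
  from card_triangle[OF assms(1,2) this] assms(3) show ?thesis by simp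
qed

lemma prod_tree_count_labelling:
  assumes "t \<in> labellings" "t' \<in> labellings" "t'' \<in> labellings"
    and "\<And>i. i < 3 \<Longrightarrow> tripod (len (t ! i)) (len (t' ! i)) (len (t'' ! i))"
  shows "B / 8 \<le> (\<Prod>i<3. real (tree_count d (len (t ! i)) (len (t' ! i)) (len (t'' ! i))))"
    and "(\<Prod>i<3. real (tree_count d (len (t ! i)) (len (t' ! i)) (len (t'' ! i)))) \<le> 8 * B"
proof -
  define P where "P = (\<Prod>i<3. tree_count d (len (t ! i)) (len (t' ! i)) (len (t'' ! i)))"
  have s: "(\<Sum>i<3. len (t' ! i)) + (\<Sum>i<3. len (t'' ! i)) = (\<Sum>i<3. len (t ! i)) + 2 * (p + q)"
    using assms(1-3) by (simp add: sum_labelling)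
  have "(d - 1) ^ (p + q) \<le> 8 * P" "P \<le> 8 * (d - 1) ^ (p + q)"
    using prod_tree_count_bounds[OF d3 _ _ s] assms(4) by (simp_all add: P_def)
  then have "real ((d - 1) ^ (p + q)) \<le> real (8 * P)" "real P \<le> real (8 * (d - 1) ^ (p + q))"
    by (simp_all only: of_nat_le_iff)
  then have "B \<le> 8 * real P" "real P \<le> 8 * B" by (simp_all add: B_def)
  then show "B / 8 \<le> (\<Prod>i<3. real (tree_count d (len (t ! i)) (len (t' ! i)) (len (t'' ! i))))"
    and "(\<Prod>i<3. real (tree_count d (len (t ! i)) (len (t' ! i)) (len (t'' ! i)))) \<le> 8 * B"
    by (simp_all add: P_def)
qed

lemma step_row_le:
  assumes st: "link_step \<sigma> \<kappa>" and t: "t \<in> labellings" and x: "x \<in> L"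
  shows "(\<Sum>y\<in>L. step_kern \<sigma> \<kappa> t x y) \<le> 8 * B"
proof -
  have t': "map \<sigma> t \<in> labellings" "map \<kappa> t \<in> labellings" using st t by (auto simp: link_step_def)
  have "(\<Sum>y\<in>L. step_kern \<sigma> \<kappa> t x y) = (\<Prod>i<3. \<Sum>y\<in>V. of_bool (\<rho> (v ! i) (x ! i) = len (t ! i) \<and>
      \<rho> (v ! i) y = len (\<sigma> (t ! i)) \<and> \<rho> (x ! i) y = len (\<kappa> (t ! i))))"
    unfolding step_kern_def L_def pkern_row[OF finite_V] ..
  also have "\<dots> \<le> (\<Prod>i<3. real (tree_count d (len (t ! i)) (len (map \<sigma> t ! i)) (len (map \<kappa> t ! i))))"
  proof (intro prod_mono conjI)
    fix i :: nat assume "i \<in> {..<3}"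
    then have i: "i < 3" by simp
    show "(\<Sum>y\<in>V. of_bool (\<rho> (v ! i) (x ! i) = len (t ! i) \<and> \<rho> (v ! i) y = len (\<sigma> (t ! i)) \<and>
        \<rho> (x ! i) y = len (\<kappa> (t ! i)))) \<le> real (tree_count d (len (t ! i)) (len (map \<sigma> t ! i)) (len (map \<kappa> t ! i)))"
    proof (cases "\<rho> (v ! i) (x ! i) = len (t ! i)")
      case True
      then show ?thesis
        using card_triangle_len[OF v_nth[OF i] L_nth[OF x i] True] i length_labelling[OF t]
        by (simp add: sum_of_bool_eq_card)
    qed (use length_labelling[OF t] in simp)
  qed (auto intro: sum_nonneg)
  also have "\<dots> \<le> 8 * B"
    by (rule prod_tree_count_labelling[OF t t'])
       (use st t length_labelling[OF t] nth_labelling in \<open>auto simp: link_step_def\<close>)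
  finally show ?thesis .
qed

lemma step_col_eq:
  assumes "i < 3" and y: "y \<in> L"
  shows "(\<Sum>x\<in>V. of_bool (\<rho> (v ! i) x = len a \<and> \<rho> (v ! i) (y ! i) = len b \<and> \<rho> x (y ! i) = len c))
    = of_bool (\<rho> (v ! i) (y ! i) = len b) * real (tree_count d (len b) (len a) (len c))"
proof (cases "\<rho> (v ! i) (y ! i) = len b")
  case True
  have "{x \<in> V. \<rho> (v ! i) x = len a \<and> \<rho> x (y ! i) = len c} = {x \<in> V. \<rho> (v ! i) x = len a \<and> \<rho> (y ! i) x = len c}"
    using dist_commute[OF _ L_nth[OF y assms(1)]] by (intro Collect_cong) auto
  then show ?thesis
    using card_triangle_len[OF v_nth[OF assms(1)] L_nth[OF y assms(1)] True] True
    by (simp add: sum_of_bool_eq_card)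
qed simp

lemma step_col_le:
  assumes st: "link_step \<sigma> \<kappa>" and t: "t \<in> labellings" and y: "y \<in> L"
  shows "(\<Sum>x\<in>L. step_kern \<sigma> \<kappa> t x y) \<le> 8 * B"
proof -
  have t': "map \<sigma> t \<in> labellings" "map \<kappa> t \<in> labellings" using st t by (auto simp: link_step_def)
  have "(\<Sum>x\<in>L. step_kern \<sigma> \<kappa> t x y) = (\<Prod>i<3. \<Sum>x\<in>V. of_bool (\<rho> (v ! i) x = len (t ! i) \<and>
      \<rho> (v ! i) (y ! i) = len (\<sigma> (t ! i)) \<and> \<rho> x (y ! i) = len (\<kappa> (t ! i))))"
    unfolding step_kern_def L_def pkern_col[OF finite_V] ..
  also have "\<dots> \<le> (\<Prod>i<3. real (tree_count d (len (map \<sigma> t ! i)) (len (t ! i)) (len (map \<kappa> t ! i))))"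
    by (intro prod_mono conjI sum_nonneg) (use step_col_eq[OF _ y] length_labelling[OF t] in auto)
  also have "\<dots> \<le> 8 * B"
    by (rule prod_tree_count_labelling[OF t'(1) t t'(2)])
       (use st t length_labelling[OF t] nth_labelling tripod_swap in \<open>auto simp: link_step_def\<close>)
  finally show ?thesis .
qed

lemma step_le_link_kern:
  assumes st: "link_step \<sigma> \<kappa>" and t: "t \<in> labellings" and x: "x \<in> L" and y: "y \<in> L"
  shows "step_kern \<sigma> \<kappa> t x y \<le> link_kern x y"
proof -
  have t': "map \<sigma> t \<in> labellings" "map \<kappa> t \<in> labellings" using st t by (auto simp: link_step_def)
  have eq: "step_kern \<sigma> \<kappa> t x y = of_bool (\<forall>i<3. \<rho> (v ! i) (x ! i) = len (t ! i) \<and>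
      \<rho> (v ! i) (y ! i) = len (map \<sigma> t ! i) \<and> \<rho> (x ! i) (y ! i) = len (map \<kappa> t ! i))"
    using length_labelling[OF t] by (simp add: step_kern_def pkern_def prod_of_bool Ball_def)
  show ?thesis
  proof (cases "\<forall>i<3. \<rho> (v ! i) (x ! i) = len (t ! i) \<and>
      \<rho> (v ! i) (y ! i) = len (map \<sigma> t ! i) \<and> \<rho> (x ! i) (y ! i) = len (map \<kappa> t ! i)")
    case True
    then have "mset (map2 \<rho> v x) = S" "mset (map2 \<rho> v y) = S" "mset (map2 \<rho> x y) = S"
      using mset_map2_iff v_in_L x y t t' by blast+
    then show ?thesis by (simp add: eq link_kern_def X_def x y)
  qed (simp only: eq, simp)
qed

lemma sphere_bounds:
  "u \<in> V \<Longrightarrow> real (card {y \<in> V. \<rho> u y = len a}) = real (tree_count d 0 (len a) (len a))"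
  using card_sphere[of u "len a"] len_le[of a] by simp

definition N :: real where
  "N = real (tree_count d 0 p p) * real (tree_count d 0 q q) * real (tree_count d 0 (p + q) (p + q))"

lemma N_eq: "t \<in> labellings \<Longrightarrow> (\<Prod>i<3. real (tree_count d 0 (len (t ! i)) (len (t ! i)))) = N"
  using prod_labelling[of t "\<lambda>a. real (tree_count d 0 (len a) (len a))"] by (simp add: N_def)

lemma N_bounds: "B\<^sup>2 / 8 \<le> N" "N \<le> 8 * B\<^sup>2"
proof -
  have t: "[0, 1, 2] \<in> labellings" by (simp add: labellings_def)
  define P where "P = (\<Prod>i<3. tree_count d 0 (len ([0, 1, 2] ! i)) (len ([0, 1, 2] ! i)))"
  \<comment> \<open>A sphere is the degenerate triangle with first side 0; the branch lengths then
    add up to \<open>2 * (p + q)\<close>, twice the exponent of \<open>B\<close>.\<close>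
  have s: "(\<Sum>i<3. len ([0, 1, 2] ! i)) + (\<Sum>i<3. len ([0, 1, 2] ! i)) = (\<Sum>i<(3::nat). 0::nat) + 2 * (2 * (p + q))"
    unfolding sum_labelling[OF t] by simp
  have "(d - 1) ^ (2 * (p + q)) \<le> 2 ^ card {..<3::nat} * P" "P \<le> 2 ^ card {..<3::nat} * (d - 1) ^ (2 * (p + q))"
    unfolding P_def by (rule prod_tree_count_bounds[OF d3 _ _ s]; simp add: tripod_iff)+
  then have "real ((d - 1) ^ (2 * (p + q))) \<le> real (8 * P)" "real P \<le> real (8 * (d - 1) ^ (2 * (p + q)))"
    unfolding of_nat_le_iff by simp_all
  moreover have "real ((d - 1) ^ (2 * (p + q))) = B\<^sup>2"
    unfolding B_def of_nat_power power_mult[symmetric] by (simp only: mult.commute)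
  moreover have "real P = N" unfolding N_eq[OF t, symmetric] P_def of_nat_prod ..
  ultimately show "B\<^sup>2 / 8 \<le> N" "N \<le> 8 * B\<^sup>2" by simp_all
qed

lemma N_pos: "0 < N"
proof -
  have "1 \<le> B\<^sup>2" using B_ge_1 by (rule one_le_power)
  then show ?thesis using N_bounds(1) by linarith
qed

end

section \<open>Rotation and exchange steps in the link\<close>

lemma (in local_tree) dir_along_geodesic:
  assumes "u \<in> V" "m \<in> V" "w \<in> V" "\<rho> u w = \<rho> u m + \<rho> m w" "2 * \<rho> u w \<le> R"
  shows "dir u m \<subseteq> dir u w"
proof
  fix a assume "a \<in> dir u m"
  then have a: "a \<in> V" "\<rho> u a = 1" "\<rho> a m + 1 = \<rho> u m" by (auto simp: dir_def)
  then have "\<rho> a w + 1 = \<rho> u w"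
    using dist_triangle[of a m w] dist_neighbour_le[of u w a] assms by simp
  then show "a \<in> dir u w" using a by (simp add: dir_def)
qed

lemma energy_pkern_mono:
  assumes "\<And>i x y. i < n \<Longrightarrow> x \<in> V \<Longrightarrow> y \<in> V \<Longrightarrow> c i * F i x y \<le> G i x y"
    and F: "\<And>i x y. 0 \<le> F i x y" and "\<And>i. i < n \<Longrightarrow> 0 \<le> c i" and C: "C \<le> (\<Prod>i<n. c i)"
  shows "C * energy (tuples n V) f (pkern n F) \<le> energy (tuples n V) f (pkern n G)"
proof (rule energy_mono)
  fix x y assume "x \<in> tuples n V" "y \<in> tuples n V"
  have "C * pkern n F x y \<le> (\<Prod>i<n. c i) * pkern n F x y"
    by (intro mult_right_mono C pkern_nonneg F)
  also have "\<dots> \<le> pkern n G x y"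
    by (rule pkern_mono) (fact assms | fact)+
  finally show "C * pkern n F x y \<le> pkern n G x y" .
qed

text \<open>Cycles the distances from the centre through \<open>p\<close>, \<open>q\<close>,
  \<open>p + q\<close>. Each coordinate then spans a flat triangle, whose third side has the
  remaining label \<open>rot (rot a)\<close>.\<close>

definition rot :: "nat \<Rightarrow> nat" where "rot a = (if a = 0 then 1 else if a = 1 then 2 else 0)"
text \<open>Rotations preserve the cyclic order of the labels; this odd permutation, combined with
  them, reaches all six labellings.\<close>

definition exch :: "nat \<Rightarrow> nat" where "exch a = (if a = 0 then 1 else if a = 1 then 0 else 2)"
definition exch_side :: "nat \<Rightarrow> nat" where "exch_side a = (if a = 0 then 2 else if a = 1 then 1 else 0)"

lemma rot_simps [simp]: "rot 0 = 1" "rot (Suc 0) = 2" "rot 1 = 2" "rot 2 = 0"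
  by (simp_all add: rot_def)

lemma map_labelling:
  assumes t: "t \<in> labellings" and "[f 0, f 1, f 2] \<in> labellings"
  shows "map f t \<in> labellings"
proof -
  have "mset (map f t) = image_mset f {#0, 1, 2#}" using t by (simp add: labellings_def)
  also have "\<dots> = mset [f 0, f 1, f 2]" by simp
  finally show ?thesis using assms(2) by (simp add: labellings_def)
qed

context link_of_triple
begin

lemma link_step_rot: "link_step rot (\<lambda>a. rot (rot a))"
proof -
  have "map rot t \<in> labellings \<and> map (\<lambda>a. rot (rot a)) t \<in> labellings" if "t \<in> labellings" for t
    by (intro conjI map_labelling that) (simp_all add: labellings_eq)
  moreover have "tripod (len a) (len (rot a)) (len (rot (rot a)))" if "a < 3" for a
  proof -
    have "a = 0 \<or> a = 1 \<or> a = 2" using that by linarith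
    then show ?thesis by (elim disjE) (auto simp: tripod_iff)
  qed
  ultimately show ?thesis by (auto simp: link_step_def)
qed

text \<open>The triangles have sides \<open>(p, q, p + q)\<close>, \<open>(q, p, q)\<close> and
  \<open>(p + q, p + q, p)\<close>; the last two occur in a tree because \<open>p\<close> is
  even.\<close>

lemma link_step_exch: "link_step exch exch_side"
proof -
  have "map exch t \<in> labellings \<and> map exch_side t \<in> labellings" if "t \<in> labellings" for t
    by (intro conjI map_labelling that) (simp_all add: labellings_eq exch_def exch_side_def)
  moreover have "tripod (len a) (len (exch a)) (len (exch_side a))" if "a < 3" for a
  proof -
    have "a = 0 \<or> a = 1 \<or> a = 2" using that by linarith
    then show ?thesis
      using even_p even_q less by (elim disjE) (auto simp: tripod_iff exch_def exch_side_def)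
  qed
  ultimately show ?thesis by (auto simp: link_step_def)
qed

lemma card_triangle_len':
  assumes "u \<in> V" "y \<in> V" "\<rho> u y = len b"
  shows "card {z \<in> V. \<rho> u z = len a \<and> \<rho> z y = len c} = tree_count d (len b) (len a) (len c)"
proof -
  have "{z \<in> V. \<rho> u z = len a \<and> \<rho> z y = len c} = {z \<in> V. \<rho> u z = len a \<and> \<rho> y z = len c}"
    using dist_commute[OF _ assms(2)] by (intro Collect_cong) auto
  then show ?thesis using card_triangle_len[OF assms] by simp
qed

lemma prod_sphere_le:
  assumes t: "t \<in> labellings"
    and F: "\<And>i y. i < 3 \<Longrightarrow> y \<in> V \<Longrightarrow> F i y \<le> of_bool (\<rho> (v ! i) y = len (t ! i))" "\<And>i y. 0 \<le> F i y"
  shows "(\<Prod>i<3. \<Sum>y\<in>V. F i y) \<le> N"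
proof -
  have "(\<Prod>i<3. \<Sum>y\<in>V. F i y) \<le> (\<Prod>i<3. real (tree_count d 0 (len (t ! i)) (len (t ! i))))"
  proof (intro prod_mono conjI sum_nonneg F)
    fix i :: nat assume "i \<in> {..<3}"
    then have i: "i < 3" by simp
    have "(\<Sum>y\<in>V. F i y) \<le> (\<Sum>y\<in>V. of_bool (\<rho> (v ! i) y = len (t ! i)))"
      by (intro sum_mono F i)
    then show "(\<Sum>y\<in>V. F i y) \<le> real (tree_count d 0 (len (t ! i)) (len (t ! i)))"
      using sphere_bounds[OF v_nth[OF i]] by (simp add: sum_of_bool_eq_card)
  qed
  then show ?thesis by (simp add: N_eq[OF t])
qed

lemma full_col_le:
  assumes "t \<in> labellings"
  shows "(\<Sum>x\<in>L. full_kern t t' x y) \<le> N"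
  unfolding full_kern_def L_def pkern_col[OF finite_V] by (rule prod_sphere_le[OF assms]) auto

lemma apart_row_le:
  assumes "t \<in> labellings"
  shows "(\<Sum>y\<in>L. apart_kern t x y) \<le> N"
  unfolding apart_kern_def L_def pkern_row[OF finite_V] by (rule prod_sphere_le[OF assms]) auto

lemma apart_col_le:
  assumes "t \<in> labellings"
  shows "(\<Sum>x\<in>L. apart_kern t x y) \<le> N"
  unfolding apart_kern_def L_def pkern_col[OF finite_V] by (rule prod_sphere_le[OF assms]) auto

lemma energy_step_le:
  assumes "link_step \<sigma> \<kappa>" "t \<in> labellings"
  shows "energy L f (step_kern \<sigma> \<kappa> t) \<le> energy L f link_kern"
  using energy_mono[of L 1 "step_kern \<sigma> \<kappa> t" link_kern f] step_le_link_kern[OF assms] by simp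

text \<open>A jump from class \<open>t\<close> to class \<open>t'\<close> followed by a link step
  reaches each pair of the new kernel through at least \<open>B / 8\<close> middle vertices. With
  row sums at most \<open>8 * B\<close> of the step and column sums at most
  \<open>N \<le> 8 * B\<^sup>2\<close> of the jump, the factor is 128 = 8 * 2 * 8.\<close>

lemma full_kern_step:
  assumes st: "link_step \<sigma> \<kappa>" and t: "t \<in> labellings" "t' \<in> labellings"
  shows "energy L f (full_kern t (map \<sigma> t')) \<le>
    128 * energy L f (full_kern t t') + 128 * (B * energy L f link_kern)"
proof -
  have t'': "map \<sigma> t' \<in> labellings" "map \<kappa> t' \<in> labellings" using st t by (auto simp: link_step_def)
  have nth: "map g t' ! i = g (t' ! i)" if "i < 3" for g :: "nat \<Rightarrow> nat" and i
    using that length_labelling[OF t(2)] by simp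
  have "B / 8 * energy L f (full_kern t (map \<sigma> t')) \<le> energy L f (kcomp L (full_kern t t') (step_kern \<sigma> \<kappa> t'))"
    unfolding full_kern_def step_kern_def L_def kcomp_pkern[OF finite_V]
  proof (rule energy_pkern_mono)
    \<comment> \<open>The middle vertex is counted from the end of the walk, so the label
      \<open>\<sigma>\<close> of the end comes first.\<close>
    show "B / 8 \<le> (\<Prod>i<3. real (tree_count d (len (map \<sigma> t' ! i)) (len (t' ! i)) (len (map \<kappa> t' ! i))))"
    proof (rule prod_tree_count_labelling(1)[OF t''(1) t(2) t''(2)])
      fix i :: nat assume i: "i < 3"
      show "tripod (len (map \<sigma> t' ! i)) (len (t' ! i)) (len (map \<kappa> t' ! i))"
        unfolding nth[OF i] using st nth_labelling[OF t(2) i] by (auto simp: link_step_def intro: tripod_swap)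
    qed
    fix i :: nat and x y :: 'a assume i: "i < 3" and V: "x \<in> V" "y \<in> V"
    show "real (tree_count d (len (map \<sigma> t' ! i)) (len (t' ! i)) (len (map \<kappa> t' ! i))) *
        of_bool (\<rho> (v ! i) x = len (t ! i) \<and> \<rho> (v ! i) y = len (map \<sigma> t' ! i))
      \<le> kcomp V (\<lambda>x y. of_bool (\<rho> (v ! i) x = len (t ! i) \<and> \<rho> (v ! i) y = len (t' ! i)))
        (\<lambda>x y. of_bool (\<rho> (v ! i) x = len (t' ! i) \<and> \<rho> (v ! i) y = len (\<sigma> (t' ! i)) \<and>
          \<rho> x y = len (\<kappa> (t' ! i)))) x y"
    proof (cases "\<rho> (v ! i) x = len (t ! i) \<and> \<rho> (v ! i) y = len (map \<sigma> t' ! i)")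
      case True
      have "kcomp V (\<lambda>x y. of_bool (\<rho> (v ! i) x = len (t ! i) \<and> \<rho> (v ! i) y = len (t' ! i)))
        (\<lambda>x y. of_bool (\<rho> (v ! i) x = len (t' ! i) \<and> \<rho> (v ! i) y = len (\<sigma> (t' ! i)) \<and>
          \<rho> x y = len (\<kappa> (t' ! i)))) x y
        = (\<Sum>z\<in>V. of_bool (\<rho> (v ! i) z = len (t' ! i) \<and> \<rho> z y = len (\<kappa> (t' ! i))))"
        unfolding kcomp_def by (intro sum.cong refl) (use True nth[OF i] in auto)
      also have "\<dots> = real (tree_count d (len (map \<sigma> t' ! i)) (len (t' ! i)) (len (map \<kappa> t' ! i)))"
        using card_triangle_len'[OF v_nth[OF i] V(2) conjunct2[OF True]] nth[OF i]
        by (simp add: sum_of_bool_eq_card)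
      finally show ?thesis using True by simp
    next
      case False
      then show ?thesis by (simp only: of_bool_eq mult_zero_right) (auto simp: kcomp_def intro!: sum_nonneg)
    qed
  qed auto
  also have "\<dots> \<le> 2 * (8 * B * energy L f (full_kern t t') + N * energy L f (step_kern \<sigma> \<kappa> t'))"
    by (rule energy_kcomp_le) (use step_row_le[OF st t(2)] full_col_le[OF t(1)] in auto)
  also have "\<dots> \<le> 2 * (8 * B * energy L f (full_kern t t') + 8 * B\<^sup>2 * energy L f link_kern)"
    using mult_mono[OF N_bounds(2) energy_step_le[OF st t(2), of f]] energy_nonneg[of L "step_kern \<sigma> \<kappa> t'" f]
    by simp
  also have "\<dots> = B / 8 * (128 * energy L f (full_kern t t') + 128 * (B * energy L f link_kern))"
    by (simp add: algebra_simps power2_eq_square)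
  finally show ?thesis using B_ge_1 by (simp add: mult_le_cancel_left)
qed

text \<open>The points \<open>w\<close> and \<open>w'\<close> on the way to \<open>x\<close> and
  \<open>z\<close> have the same first steps from \<open>u\<close> as these, so the route from
  \<open>w\<close> to \<open>w'\<close> through \<open>u\<close> is a geodesic.\<close>

lemma dist_across:
  assumes V: "u \<in> V" "x \<in> V" "z \<in> V" "w \<in> V" "w' \<in> V"
    and le: "\<rho> u x \<le> p + q" "\<rho> u z \<le> p + q" and disj: "dir u x \<inter> dir u z = {}"
    and w: "\<rho> u w = p" "\<rho> u x = \<rho> u w + \<rho> w x" and w': "\<rho> u w' = q" "\<rho> u z = \<rho> u w' + \<rho> w' z"
  shows "\<rho> w w' = p + q"
proof -
  have "dir u w \<subseteq> dir u x" "dir u w' \<subseteq> dir u z"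
    using dir_along_geodesic V w w' le by auto
  then have "dir u w \<inter> dir u w' = {}" using disj by blast
  moreover have "\<rho> w w' \<le> p + q"
    using dist_triangle[of w u w'] dist_commute[of w u] V w w' by simp
  ultimately show ?thesis
    using dist_add_if_dir_disjoint[of u w w'] V w w' by simp
qed

definition rot_kern :: "'a \<Rightarrow> nat \<Rightarrow> 'a \<Rightarrow> 'a \<Rightarrow> real" where
  "rot_kern u a x y = of_bool (\<rho> u x = len a \<and> \<rho> u y = len (rot a) \<and> \<rho> x y = len (rot (rot a)))"

text \<open>
  In three rotation steps each coordinate is once extended, once truncated, and once replaced by
  a vertex in a new direction; hence the end of the walk is arbitrary up to its direction.
\<close>

lemma rot_walk:
  assumes V: "u \<in> V" "x \<in> V" "z \<in> V" and a: "a < 3"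
    and x: "\<rho> u x = len a" and z: "\<rho> u z = len a" and disj: "dir u x \<inter> dir u z = {}"
  shows "(if a = 0 then real ((d - 1) ^ q) / 2 else if a = 1 then real ((d - 1) ^ p) / 2 else 1 / 2)
    \<le> kcomp V (kcomp V (rot_kern u a) (rot_kern u (rot a))) (rot_kern u (rot (rot a))) x z"
proof -
  have nn: "0 \<le> rot_kern u b s t" for b s t by (simp add: rot_kern_def)
  have inner: "1 \<le> kcomp V (rot_kern u a) (rot_kern u (rot a)) x w2"
    if "w1 \<in> V" "rot_kern u a x w1 = 1" "rot_kern u (rot a) w1 w2 = 1" for w1 w2
  proof -
    have "rot_kern u a x w1 * rot_kern u (rot a) w1 w2 \<le> kcomp V (rot_kern u a) (rot_kern u (rot a)) x w2"
      unfolding kcomp_def by (rule member_le_sum) (use that finite_V nn in auto)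
    then show ?thesis using that by simp
  qed
  have "(d - 1) ^ q \<le> 2 * tree_count d p (p + q) q" "(d - 1) ^ p \<le> 2 * tree_count d q (p + q) p"
    using tree_count_bounds(1)[OF d3, of q p 0] tree_count_bounds(1)[OF d3, of p q 0]
    by (simp_all add: add.commute)
  then have "real ((d - 1) ^ q) \<le> real (2 * tree_count d p (p + q) q)"
    "real ((d - 1) ^ p) \<le> real (2 * tree_count d q (p + q) p)"
    by (simp_all only: of_nat_le_iff)
  then have tree: "real ((d - 1) ^ q) / 2 \<le> real (tree_count d p (p + q) q)"
    "real ((d - 1) ^ p) / 2 \<le> real (tree_count d q (p + q) p)"
    by simp_all
  consider "a = 0" | "a = 1" | "a = 2" using a by linarith
  then show ?thesis
  proof cases
    case 1
    \<comment> \<open>\<open>w2\<close> extends \<open>z\<close> by \<open>q\<close> steps, in about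
      \<open>(d - 1) ^ q\<close> ways, and \<open>w1\<close> is the point at distance
      \<open>q\<close> on the way from the centre to \<open>w2\<close>. It shares no direction with
      \<open>x\<close>, which gives the first step its length \<open>p + q\<close>.\<close>
    have "real (tree_count d p (p + q) q) = (\<Sum>w2\<in>V. of_bool (\<rho> u w2 = p + q \<and> \<rho> z w2 = q))"
      using card_triangle_len[of u z 0 2 1] V z 1 by (simp add: sum_of_bool_eq_card)
    also have "\<dots> \<le> kcomp V (kcomp V (rot_kern u a) (rot_kern u (rot a))) (rot_kern u (rot (rot a))) x z"
      unfolding kcomp_def[of V "kcomp _ _ _"]
    proof (rule sum_mono)
      fix w2 assume w2: "w2 \<in> V"
      show "of_bool (\<rho> u w2 = p + q \<and> \<rho> z w2 = q)
        \<le> kcomp V (rot_kern u a) (rot_kern u (rot a)) x w2 * rot_kern u (rot (rot a)) w2 z"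
      proof (cases "\<rho> u w2 = p + q \<and> \<rho> z w2 = q")
        case True
        then obtain w1 where w1: "w1 \<in> V" "\<rho> u w1 = q" "\<rho> u w2 = \<rho> u w1 + \<rho> w1 w2"
          using geodesic_point_exists[of u w2 q] V w2 by auto
        have ux: "\<rho> u x = p" "\<rho> u z = p" using x z 1 by simp_all
        have "dir u x \<inter> dir u w1 = {}"
        \<comment> \<open>For \<open>p = 0\<close> the vertex \<open>x\<close> is the centre and has
          no direction.\<close>
        proof (cases "p = 0")
          case True
          then have "x = u" using ux dist_0_iff[of u x] V by simp
          then show ?thesis using V by simp
        next
          case False
          then obtain b where b: "b \<in> dir u z" using dir_nonempty[of u z] ux V by fastforce
          have "b \<in> dir u w2"
            using dir_along_geodesic[of u z w2] b V w2 True ux by auto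
          then have "dir u w2 = {b}" using dir_eqI[of u w2 b] V w2 True by simp
          moreover have "dir u w1 \<subseteq> dir u w2"
            using dir_along_geodesic[of u w1 w2] V w1 w2 True by simp
          ultimately have "dir u w1 \<subseteq> dir u z" using b by fastforce
          then show ?thesis using disj by blast
        qed
        then have "\<rho> x w1 = p + q"
          by (intro dist_across[of u x w1 x w1]) (use V w1 ux in simp_all)
        moreover have "\<rho> w1 w2 = p" using w1 True by simp
        moreover have "\<rho> w2 z = q" using True dist_commute[of w2 z] w2 V by simp
        ultimately have "rot_kern u a x w1 = 1" "rot_kern u (rot a) w1 w2 = 1" "rot_kern u (rot (rot a)) w2 z = 1"
          unfolding rot_kern_def using 1 w1(2) True ux by simp_all
        then show ?thesis using inner[OF w1(1)] True by simp
      qed (auto intro!: mult_nonneg_nonneg kcomp_nonneg nn V w2)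
    qed
    finally show ?thesis using tree(1) 1 by simp
  next
    case 2
    \<comment> \<open>\<open>w1\<close> extends \<open>x\<close> by \<open>p\<close> steps, in about
      \<open>(d - 1) ^ p\<close> ways; \<open>w2\<close> is its truncation to distance
      \<open>p\<close>, and the last step goes across the centre to \<open>z\<close>.\<close>
    have "real (tree_count d q (p + q) p) = (\<Sum>w1\<in>V. of_bool (\<rho> u w1 = p + q \<and> \<rho> x w1 = p))"
      using card_triangle_len[of u x 1 2 0] V x 2 by (simp add: sum_of_bool_eq_card)
    also have "\<dots> \<le> (\<Sum>w1\<in>V. \<Sum>w2\<in>V. rot_kern u a x w1 * rot_kern u (rot a) w1 w2 * rot_kern u (rot (rot a)) w2 z)"
    proof (rule sum_mono)
      fix w1 assume w1: "w1 \<in> V"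
      show "of_bool (\<rho> u w1 = p + q \<and> \<rho> x w1 = p)
        \<le> (\<Sum>w2\<in>V. rot_kern u a x w1 * rot_kern u (rot a) w1 w2 * rot_kern u (rot (rot a)) w2 z)"
      proof (cases "\<rho> u w1 = p + q \<and> \<rho> x w1 = p")
        case True
        then obtain w2 where w2: "w2 \<in> V" "\<rho> u w2 = p" "\<rho> u w1 = \<rho> u w2 + \<rho> w2 w1"
          using geodesic_point_exists[of u w1 p] V w1 by auto
        have ux: "\<rho> u x = q" "\<rho> u z = q" using x z 2 by simp_all
        obtain b where b: "b \<in> dir u x" using dir_nonempty[of u x] ux V less by fastforce
        have "b \<in> dir u w1"
          using dir_along_geodesic[of u x w1] b V w1 True ux by auto
        then have "dir u w1 = {b}" using dir_eqI[of u w1 b] V w1 True by simp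
        then have "dir u w1 \<inter> dir u z = {}" using b disj by (simp add: disjoint_iff)
        then have "\<rho> w2 z = p + q"
          by (intro dist_across[of u w1 z w2 z]) (use V w1 w2 ux True in simp_all)
        moreover have "\<rho> w1 w2 = q" using w2 True dist_commute[of w1 w2] w1 by simp
        ultimately have "rot_kern u a x w1 * rot_kern u (rot a) w1 w2 * rot_kern u (rot (rot a)) w2 z = 1"
          unfolding rot_kern_def using 2 w2(2) True ux by simp
        moreover have "rot_kern u a x w1 * rot_kern u (rot a) w1 w2 * rot_kern u (rot (rot a)) w2 z
          \<le> (\<Sum>w2\<in>V. rot_kern u a x w1 * rot_kern u (rot a) w1 w2 * rot_kern u (rot (rot a)) w2 z)"
          by (rule member_le_sum) (use w2 finite_V nn in auto)
        ultimately show ?thesis using True by simp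
      qed (auto intro!: sum_nonneg mult_nonneg_nonneg nn)
    qed
    also have "\<dots> = kcomp V (kcomp V (rot_kern u a) (rot_kern u (rot a))) (rot_kern u (rot (rot a))) x z"
      unfolding kcomp_def sum_distrib_right by (rule sum.swap)
    finally show ?thesis using tree(2) 2 by simp
  next
    case 3
    have ux: "\<rho> u x = p + q" "\<rho> u z = p + q" using x z 3 by simp_all
    \<comment> \<open>\<open>w1\<close> truncates \<open>x\<close>, the middle step crosses the
      centre to \<open>w2\<close>, and \<open>w2\<close> is extended to \<open>z\<close>; a single
      walk suffices.\<close>
    obtain w1 where w1: "w1 \<in> V" "\<rho> u w1 = p" "\<rho> u x = \<rho> u w1 + \<rho> w1 x"
      using geodesic_point_exists[of u x p] V ux by auto
    obtain w2 where w2: "w2 \<in> V" "\<rho> u w2 = q" "\<rho> u z = \<rho> u w2 + \<rho> w2 z"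
      using geodesic_point_exists[of u z q] V ux by auto
    have "\<rho> w1 w2 = p + q"
      by (intro dist_across[of u x z w1 w2]) (use V w1 w2 ux disj in simp_all)
    moreover have "\<rho> x w1 = q" using w1 ux dist_commute[of x w1] V by simp
    moreover have "\<rho> w2 z = p" using w2 ux by simp
    ultimately have one: "rot_kern u a x w1 = 1" "rot_kern u (rot a) w1 w2 = 1" "rot_kern u (rot (rot a)) w2 z = 1"
      unfolding rot_kern_def using 3 w1(2) w2(2) ux by simp_all
    have "kcomp V (rot_kern u a) (rot_kern u (rot a)) x w2 * rot_kern u (rot (rot a)) w2 z
      \<le> kcomp V (kcomp V (rot_kern u a) (rot_kern u (rot a))) (rot_kern u (rot (rot a))) x z"
      unfolding kcomp_def[of V "kcomp _ _ _"]
      by (rule member_le_sum) (auto simp: w2 finite_V V intro!: mult_nonneg_nonneg kcomp_nonneg nn)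
    then show ?thesis using inner[OF w1(1) one(1,2)] one(3) 3 by simp
  qed
qed

end

section \<open>Energy comparison and the Poincare inequality for the link\<close>

context link_of_triple
begin

abbreviation rot_step :: "nat list \<Rightarrow> 'a list \<Rightarrow> 'a list \<Rightarrow> real" where
  "rot_step \<equiv> step_kern rot (\<lambda>a. rot (rot a))"

abbreviation D :: "('a list \<Rightarrow> real) \<Rightarrow> real" where
  "D f \<equiv> energy L f link_kern"

lemma rot_step_eq: "rot_step t = pkern 3 (\<lambda>i. rot_kern (v ! i) (t ! i))"
  by (simp add: step_kern_def rot_kern_def[abs_def])

lemma map_rot: "t \<in> labellings \<Longrightarrow> map rot t \<in> labellings"
  using link_step_rot by (simp add: link_step_def)

text \<open>Each label occurs once, so the three factors of \<open>rot_walk\<close> are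
  \<open>(d - 1) ^ q / 2\<close>, \<open>(d - 1) ^ p / 2\<close> and \<open>1 / 2\<close>, with
  product \<open>B / 8\<close>. Two uses of \<open>energy_kcomp_le\<close> with sums
  \<open>8 * B\<close> of the single steps yield 5120 = 8 * 2 * (8 * 2 * 16 + 64).\<close>

lemma apart_energy_le:
  assumes t: "t \<in> labellings"
  shows "energy L f (apart_kern t) \<le> 5120 * (B * D f)"
proof -
  define t1 where "t1 = map rot t"
  define t2 where "t2 = map rot t1"
  have t1: "t1 \<in> labellings" and t2: "t2 \<in> labellings"
    unfolding t2_def t1_def by (intro map_rot t)+
  have nth: "t1 ! i = rot (t ! i)" "t2 ! i = rot (rot (t ! i))" if "i < 3" for i
    using that length_labelling[OF t] by (simp_all add: t1_def t2_def)
  define c where "c a = (if a = 0 then real ((d - 1) ^ q) / 2 else if a = 1 then real ((d - 1) ^ p) / 2 else 1 / 2)"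
    for a :: nat
  have "B / 8 * energy L f (apart_kern t) \<le> energy L f (kcomp L (kcomp L (rot_step t) (rot_step t1)) (rot_step t2))"
    unfolding rot_step_eq apart_kern_def L_def kcomp_pkern[OF finite_V]
  proof (rule energy_pkern_mono)
    show "B / 8 \<le> (\<Prod>i<3. c (t ! i))"
      unfolding prod_labelling[OF t] by (simp add: c_def B_def power_add)
    show "0 \<le> c (t ! i)" for i by (simp add: c_def)
    fix i :: nat and x z :: 'a assume i: "i < 3" and V: "x \<in> V" "z \<in> V"
    show "c (t ! i) * of_bool (\<rho> (v ! i) x = len (t ! i) \<and> \<rho> (v ! i) z = len (t ! i) \<and>
        dir (v ! i) x \<inter> dir (v ! i) z = {})
      \<le> kcomp V (kcomp V (rot_kern (v ! i) (t ! i)) (rot_kern (v ! i) (t1 ! i))) (rot_kern (v ! i) (t2 ! i)) x z"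
    proof (cases "\<rho> (v ! i) x = len (t ! i) \<and> \<rho> (v ! i) z = len (t ! i) \<and> dir (v ! i) x \<inter> dir (v ! i) z = {}")
      case True
      then show ?thesis
        using rot_walk[OF v_nth[OF i] V nth_labelling[OF t i]] by (simp add: nth[OF i] c_def)
    next
      case False
      have "0 \<le> rot_kern u b s w" for u b s w by (simp add: rot_kern_def)
      then show ?thesis unfolding of_bool_def if_not_P[OF False] mult_zero_right
        by (intro kcomp_nonneg V)
    qed
  qed simp
  also have "\<dots> \<le> 2 * (8 * B * energy L f (kcomp L (rot_step t) (rot_step t1)) + 8 * B * (8 * B) * energy L f (rot_step t2))"
    using step_row_le[OF link_step_rot t2] step_col_le[OF link_step_rot t] step_col_le[OF link_step_rot t1] B_ge_1
    by (intro energy_kcomp_le kcomp_col_le kcomp_nonneg) auto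
  also have "energy L f (kcomp L (rot_step t) (rot_step t1)) \<le> 2 * (8 * B * energy L f (rot_step t) + 8 * B * energy L f (rot_step t1))"
    using step_row_le[OF link_step_rot t1] step_col_le[OF link_step_rot t]
    by (intro energy_kcomp_le) auto
  also have "2 * (8 * B * (2 * (8 * B * energy L f (rot_step t) + 8 * B * energy L f (rot_step t1)))
        + 8 * B * (8 * B) * energy L f (rot_step t2))
      \<le> 2 * (8 * B * (2 * (8 * B * D f + 8 * B * D f)) + 8 * B * (8 * B) * D f)"
    using B_ge_1 by (intro mult_left_mono add_mono energy_step_le link_step_rot t t1 t2) auto
  also have "\<dots> = B / 8 * (5120 * (B * D f))" by simp
  finally show ?thesis using B_ge_1 by (simp add: mult_le_cancel_left)
qed

text \<open>At most two of the \<open>d\<close> directions are forbidden, and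
  \<open>d - 2 \<ge> d / 3\<close> for \<open>d \<ge> 3\<close>. A sphere of radius 0 consists of
  the centre, which has no direction.\<close>

lemma card_avoiding_two:
  assumes V: "u \<in> V" "x \<in> V" "z \<in> V" and x: "\<rho> u x = len a" and z: "\<rho> u z = len a"
  shows "real (tree_count d 0 (len a) (len a)) / 3
    \<le> real (card {y \<in> V. \<rho> u y = len a \<and> dir u x \<inter> dir u y = {} \<and> dir u y \<inter> dir u z = {}})"
proof (cases "len a = 0")
  case True
  then have "x = u" "z = u" using x z dist_0_iff V by auto
  then have "{y \<in> V. \<rho> u y = len a \<and> dir u x \<inter> dir u y = {} \<and> dir u y \<inter> dir u z = {}} = {u}"
    using True V dist_0_iff by auto
  then show ?thesis using True by (simp add: tree_count_def)
next
  case False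
  define F where "F = dir u x \<union> dir u z"
  define k where "k = len a - 1"
  have k: "len a = Suc k" using False by (simp add: k_def)
  have "2 * len a \<le> 3 * (p + q)" using len_le[of a] by simp
  then have "card (dir u x) \<le> 1" "card (dir u z) \<le> 1" using card_dir V x z by simp_all
  then have F: "card F \<le> 2" using card_Un_le[of "dir u x" "dir u z"] by (simp add: F_def)
  have "{y \<in> V. \<rho> u y = len a \<and> dir u x \<inter> dir u y = {} \<and> dir u y \<inter> dir u z = {}}
      = {y \<in> V. \<rho> u y = len a \<and> dir u y \<inter> F = {}}"
    by (auto simp: F_def)
  moreover have "card {y \<in> V. \<rho> u y = len a \<and> dir u y \<inter> F = {}} = (d - card F) * (d - 1) ^ k"
    using card_avoiding_sphere[of u F "len a"] V \<open>2 * len a \<le> 3 * (p + q)\<close> k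
    by (simp add: F_def dir_def subset_iff)
  moreover have "d * (d - 1) ^ k \<le> 3 * ((d - card F) * (d - 1) ^ k)"
    unfolding mult.assoc[symmetric] using F d3 by (intro mult_right_mono) auto
  then have "real (d * (d - 1) ^ k) \<le> real (3 * ((d - card F) * (d - 1) ^ k))"
    unfolding of_nat_le_iff .
  moreover have "tree_count d 0 (len a) (len a) = d * (d - 1) ^ k"
    using tree_count_eq[of d 0 0 "len a"] k by simp
  ultimately show ?thesis by simp
qed

text \<open>Any two vertices of a class have at least \<open>N / 27\<close> vertices of the class
  apart from both, so two moves of \<open>apart_kern\<close> connect the whole class. The constant
  is 27 * 4 * 5120.\<close>

lemma full_energy_same_le:
  assumes t: "t \<in> labellings"
  shows "energy L f (full_kern t t) \<le> 552960 * (B * D f)"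
proof -
  have "N / 27 * energy L f (full_kern t t) \<le> energy L f (kcomp L (apart_kern t) (apart_kern t))"
    unfolding full_kern_def apart_kern_def L_def kcomp_pkern[OF finite_V]
  proof (rule energy_pkern_mono)
    have "(\<Prod>i<3. real (tree_count d 0 (len (t ! i)) (len (t ! i))) / 3) = N / 27"
      using N_eq[OF t] by (simp add: prod_dividef)
    then show "N / 27 \<le> (\<Prod>i<3. real (tree_count d 0 (len (t ! i)) (len (t ! i))) / 3)" by simp
    fix i :: nat and x z :: 'a assume i: "i < 3" and V: "x \<in> V" "z \<in> V"
    let ?K = "\<lambda>x y. of_bool (\<rho> (v ! i) x = len (t ! i) \<and> \<rho> (v ! i) y = len (t ! i) \<and>
        dir (v ! i) x \<inter> dir (v ! i) y = {}) :: real"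
    show "real (tree_count d 0 (len (t ! i)) (len (t ! i))) / 3 *
        of_bool (\<rho> (v ! i) x = len (t ! i) \<and> \<rho> (v ! i) z = len (t ! i)) \<le> kcomp V ?K ?K x z"
    proof (cases "\<rho> (v ! i) x = len (t ! i) \<and> \<rho> (v ! i) z = len (t ! i)")
      case True
      have "kcomp V ?K ?K x z = (\<Sum>y\<in>V. of_bool (\<rho> (v ! i) y = len (t ! i) \<and>
          dir (v ! i) x \<inter> dir (v ! i) y = {} \<and> dir (v ! i) y \<inter> dir (v ! i) z = {}))"
        unfolding kcomp_def by (intro sum.cong refl) (use True in auto)
      then show ?thesis
        using card_avoiding_two[OF v_nth[OF i] V, of "t ! i"] True by (simp add: sum_of_bool_eq_card)
    next
      case False
      show ?thesis unfolding of_bool_def if_not_P[OF False] mult_zero_right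
        by (auto simp: kcomp_def intro!: sum_nonneg)
    qed
  qed auto
  also have "\<dots> \<le> 2 * (N * energy L f (apart_kern t) + N * energy L f (apart_kern t))"
    using apart_row_le[OF t] apart_col_le[OF t] by (intro energy_kcomp_le) auto
  also have "\<dots> \<le> 2 * (N * (5120 * (B * D f)) + N * (5120 * (B * D f)))"
    using N_pos by (intro mult_left_mono add_mono apart_energy_le[OF t]) auto
  also have "\<dots> = N / 27 * (552960 * (B * D f))" by simp
  finally show ?thesis using N_pos by (simp add: mult_le_cancel_left)
qed

lemma labelling_reachable:
  assumes "t \<in> labellings" "t' \<in> labellings"
  shows "t' \<in> {t, map rot t, map rot (map rot t), map exch t, map exch (map rot t),
    map exch (map rot (map rot t))}"
proof -
  show ?thesis
    using assms unfolding labellings_eq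
    by (elim insertE emptyE; hypsubst; simp add: rot_def exch_def)
qed

lemma full_energy_le:
  assumes t: "t \<in> labellings" and t': "t' \<in> labellings"
  shows "energy L f (full_kern t t') \<le> 10 ^ 13 * (B * D f)"
proof -
  define t1 where "t1 = map rot t"
  define t2 where "t2 = map rot t1"
  have t1: "t1 \<in> labellings" and t2: "t2 \<in> labellings"
    unfolding t2_def t1_def by (intro map_rot t)+
  have nn: "0 \<le> B * D f" using B_ge_1 by (intro mult_nonneg_nonneg energy_nonneg) auto
  have e0: "energy L f (full_kern t t) \<le> 552960 * (B * D f)" by (rule full_energy_same_le[OF t])
  \<comment> \<open>Each step turns a constant \<open>c\<close> into \<open>128 * (c + 1)\<close>;
    at most two rotations and one exchange are applied.\<close>
  have e1: "energy L f (full_kern t t1) \<le> 70779008 * (B * D f)"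
    using full_kern_step[OF link_step_rot t t, of f] e0 by (simp add: t1_def)
  have e2: "energy L f (full_kern t t2) \<le> 9059713152 * (B * D f)"
    using full_kern_step[OF link_step_rot t t1, of f] e1 by (simp add: t2_def)
  have e3: "energy L f (full_kern t (map exch s)) \<le> 1159643283584 * (B * D f)"
    if "s \<in> labellings" "energy L f (full_kern t s) \<le> 9059713152 * (B * D f)" for s
    using full_kern_step[OF link_step_exch t that(1), of f] that(2) by simp
  have "t' \<in> {t, t1, t2, map exch t, map exch t1, map exch t2}"
    using labelling_reachable[OF t t'] by (simp add: t1_def t2_def)
  then have "energy L f (full_kern t t') \<le> 1159643283584 * (B * D f)"
    using e0 e1 e2 e3[OF t] e3[OF t1] e3[OF t2] nn by (elim insertE emptyE) auto
  then show ?thesis using nn by simp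
qed

lemma X_eq: "X = {x \<in> L. \<exists>t\<in>labellings. \<forall>i<3. \<rho> (v ! i) (x ! i) = len (t ! i)}"
  using mset_map2_iff[OF v_in_L] by (auto simp: X_def)

lemma variance_le:
  "(\<Sum>x\<in>X. \<Sum>y\<in>X. (f x - f y)\<^sup>2) \<le> 36 * 10 ^ 13 * (B * D f)"
proof -
  have XL: "X \<subseteq> L" by (auto simp: X_def)
  \<comment> \<open>Only an inequality, since for \<open>p = 0\<close> a vertex carries several
    labellings.\<close>
  have pt: "of_bool (x \<in> X \<and> y \<in> X) \<le> (\<Sum>t\<in>labellings. \<Sum>t'\<in>labellings. full_kern t t' x y)" if "x \<in> L" "y \<in> L" for x y
  proof (cases "x \<in> X \<and> y \<in> X")
    case True
    then obtain t t' where t: "t \<in> labellings" "t' \<in> labellings"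
      "\<forall>i<3. \<rho> (v ! i) (x ! i) = len (t ! i)" "\<forall>i<3. \<rho> (v ! i) (y ! i) = len (t' ! i)"
      unfolding X_eq by blast
    then have "1 = full_kern t t' x y" by (simp add: full_kern_def pkern_def)
    also have "\<dots> \<le> (\<Sum>t'\<in>labellings. full_kern t t' x y)"
      by (rule member_le_sum) (use t in auto)
    also have "\<dots> \<le> (\<Sum>t\<in>labellings. \<Sum>t'\<in>labellings. full_kern t t' x y)"
      by (rule member_le_sum[of t]) (use t in \<open>auto intro: sum_nonneg\<close>)
    finally show ?thesis by simp
  next
    case False
    then show ?thesis by (simp only: of_bool_def if_False) (intro sum_nonneg kern_nonneg)
  qed
  have "(\<Sum>x\<in>X. \<Sum>y\<in>X. (f x - f y)\<^sup>2) = energy L f (\<lambda>x y. of_bool (x \<in> X \<and> y \<in> X))"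
    unfolding energy_def
    by (intro sum.mono_neutral_cong_left) (use XL in \<open>auto intro!: sum.mono_neutral_cong_left\<close>)
  also have "\<dots> \<le> energy L f (\<lambda>x y. \<Sum>t\<in>labellings. \<Sum>t'\<in>labellings. full_kern t t' x y)"
    using energy_mono[of L 1 "\<lambda>x y. of_bool (x \<in> X \<and> y \<in> X)" _ f] pt by simp
  also have "\<dots> = (\<Sum>t\<in>labellings. \<Sum>t'\<in>labellings. energy L f (full_kern t t'))"
    unfolding energy_def sum_distrib_right
    by (subst sum_rotate[symmetric], subst sum_rotate[symmetric]) (rule refl)
  also have "\<dots> \<le> (\<Sum>t\<in>labellings. \<Sum>t'\<in>labellings. 10 ^ 13 * (B * D f))"
    by (intro sum_mono full_energy_le)
  also have "\<dots> = 36 * 10 ^ 13 * (B * D f)" by (simp add: card_labellings)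
  finally show ?thesis .
qed

lemma card_X_ge: "B\<^sup>2 / 8 \<le> real (card X)"
proof -
  have t: "[0, 1, 2] \<in> labellings" by (simp add: labellings_def)
  have "N = real (card {x \<in> tuples 3 V. \<forall>i<3. \<rho> (v ! i) (x ! i) = len ([0, 1, 2] ! i)})"
    unfolding card_tuples_if[OF finite_V, of 3 "\<lambda>i a. \<rho> (v ! i) a = len ([0, 1, 2] ! i)"]
      of_nat_prod N_eq[OF t, symmetric]
    by (intro prod.cong refl) (simp add: sphere_bounds v_nth)
  also have "\<dots> \<le> real (card X)"
    unfolding of_nat_le_iff by (rule card_mono) (use t finite_L in \<open>auto simp: X_eq L_def\<close>)
  finally show ?thesis using N_bounds(1) by simp
qed

text \<open>A neighbour realises one of 36 pairs of labellings, towards the centre and towards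
  \<open>x\<close>. Each pair admits at most \<open>8 * B\<close> vertices, and none if one of the
  triangles is impossible.\<close>

lemma link_degree_le:
  assumes x: "x \<in> X"
  shows "real (card {y \<in> X. mset (map2 \<rho> x y) = S}) \<le> 288 * B"
proof -
  have xL: "x \<in> L" using x by (simp add: X_def)
  obtain t where t: "t \<in> labellings" "\<forall>i<3. \<rho> (v ! i) (x ! i) = len (t ! i)"
    using x unfolding X_eq by blast
  define Y where "Y t' t'' = {y \<in> tuples 3 V. \<forall>i<3. \<rho> (v ! i) (y ! i) = len (t' ! i) \<and> \<rho> (x ! i) (y ! i) = len (t'' ! i)}"
    for t' t''
  have "{y \<in> X. mset (map2 \<rho> x y) = S} \<subseteq> (\<Union>t'\<in>labellings. \<Union>t''\<in>labellings. Y t' t'')"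
  proof
    fix y assume "y \<in> {y \<in> X. mset (map2 \<rho> x y) = S}"
    then have y: "y \<in> X" "y \<in> L" "mset (map2 \<rho> x y) = S" by (auto simp: X_def)
    obtain t' where "t' \<in> labellings" "\<forall>i<3. \<rho> (v ! i) (y ! i) = len (t' ! i)"
      using y(1) unfolding X_eq by blast
    moreover obtain t'' where "t'' \<in> labellings" "\<forall>i<3. \<rho> (x ! i) (y ! i) = len (t'' ! i)"
      using mset_map2_iff[OF xL y(2)] y(3) by blast
    ultimately show "y \<in> (\<Union>t'\<in>labellings. \<Union>t''\<in>labellings. Y t' t'')"
      using y(2) unfolding Y_def L_def by blast
  qed
  then have "card {y \<in> X. mset (map2 \<rho> x y) = S} \<le> card (\<Union>t'\<in>labellings. \<Union>t''\<in>labellings. Y t' t'')"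
    by (intro card_mono finite_UN_I) (auto simp: Y_def finite_V)
  also have "\<dots> \<le> (\<Sum>t'\<in>labellings. card (\<Union>t''\<in>labellings. Y t' t''))"
    by (rule card_UN_le) simp
  also have "\<dots> \<le> (\<Sum>t'\<in>labellings. \<Sum>t''\<in>labellings. card (Y t' t''))"
    by (intro sum_mono card_UN_le) simp
  finally have "real (card {y \<in> X. mset (map2 \<rho> x y) = S}) \<le> (\<Sum>t'\<in>labellings. \<Sum>t''\<in>labellings. real (card (Y t' t'')))"
    by (simp only: of_nat_sum[symmetric] of_nat_le_iff)
  also have "\<dots> \<le> (\<Sum>t'\<in>labellings. \<Sum>t''\<in>labellings. 8 * B)"
  proof (intro sum_mono)
    fix t' t'' assume t': "t' \<in> labellings" "t'' \<in> labellings"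
    have card: "real (card (Y t' t'')) = (\<Prod>i<3. real (tree_count d (len (t ! i)) (len (t' ! i)) (len (t'' ! i))))"
      unfolding Y_def card_tuples_if[OF finite_V, of 3 "\<lambda>i a. \<rho> (v ! i) a = len (t' ! i) \<and> \<rho> (x ! i) a = len (t'' ! i)"] of_nat_prod
      by (intro prod.cong refl) (use card_triangle_len v_nth L_nth[OF xL] t(2) in simp)
    show "real (card (Y t' t'')) \<le> 8 * B"
    proof (cases "\<forall>i<3. tripod (len (t ! i)) (len (t' ! i)) (len (t'' ! i))")
      case True
      then show ?thesis unfolding card by (intro prod_tree_count_labelling(2) t t') auto
    next
      case False
      then obtain i :: nat where i: "i < 3" "tree_count d (len (t ! i)) (len (t' ! i)) (len (t'' ! i)) = 0"
        using tree_count_eq_0 by blast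
      have "(\<Prod>i<3. real (tree_count d (len (t ! i)) (len (t' ! i)) (len (t'' ! i)))) = 0"
        by (rule prod_zero) (use i in auto)
      then show ?thesis unfolding card using B_ge_1 by linarith
    qed
  qed
  also have "\<dots> = 288 * B" by (simp add: card_labellings)
  finally show ?thesis .
qed

text \<open>For mean zero the variance sum is \<open>2 * (card X * W)\<close>, while
  \<open>D f\<close> is \<open>2 * (b * W - Q)\<close>. As \<open>X\<close> has at least order
  \<open>B\<^sup>2\<close> and \<open>b\<close> at most order \<open>B\<close>, the powers of
  \<open>B\<close> in \<open>variance_le\<close> cancel, and \<open>b * W\<close> is at most a
  constant times \<open>b * W - Q\<close>.\<close>

theorem link_form_le:
  assumes b: "\<And>x. x \<in> X \<Longrightarrow> card {y \<in> X. mset (map2 \<rho> x y) = S} = b"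
    and f: "(\<Sum>x\<in>X. f x) = 0"
  shows "(\<Sum>x\<in>X. \<Sum>y\<in>X. (if mset (map2 \<rho> x y) = S then 1 else 0) * f x * f y)
    \<le> (1 - 1 / 10 ^ 18) * real b * (\<Sum>x\<in>X. f x * f x)"
proof -
  define A where "A x y = (if mset (map2 \<rho> x y) = S then 1 else 0 :: real)" for x y
  define W where "W = (\<Sum>x\<in>X. f x * f x)"
  define Q where "Q = (\<Sum>x\<in>X. \<Sum>y\<in>X. A x y * f x * f y)"
  have XL: "X \<subseteq> L" by (auto simp: X_def)
  have finX: "finite X" using XL finite_L finite_subset by blast
  have Asym: "A x y = A y x" if "x \<in> X" "y \<in> X" for x y
  proof -
    have xy: "x \<in> L" "y \<in> L" using that XL by auto
    then have "map2 \<rho> x y = map2 \<rho> y x"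
      by (intro nth_equalityI) (auto simp: L_def tuples_def dist_commute subset_iff)
    then show ?thesis by (simp add: A_def)
  qed
  have Arow: "(\<Sum>y\<in>X. A x y) = real b" if "x \<in> X" for x
    using b[OF that] finX by (simp add: A_def sum.If_cases Int_def)
  have D_eq: "D f = (\<Sum>x\<in>X. \<Sum>y\<in>X. A x y * (f x - f y)\<^sup>2)"
  proof -
    have "D f = (\<Sum>x\<in>X. \<Sum>y\<in>L. link_kern x y * (f x - f y)\<^sup>2)"
      unfolding energy_def by (intro sum.mono_neutral_right finite_L XL) (auto simp: link_kern_def)
    also have "\<dots> = (\<Sum>x\<in>X. \<Sum>y\<in>X. link_kern x y * (f x - f y)\<^sup>2)"
      by (intro sum.cong refl sum.mono_neutral_right finite_L XL) (auto simp: link_kern_def)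
    also have "\<dots> = (\<Sum>x\<in>X. \<Sum>y\<in>X. A x y * (f x - f y)\<^sup>2)"
      by (intro sum.cong refl) (simp add: link_kern_def A_def)
    finally show ?thesis .
  qed
  have "D f = (\<Sum>x\<in>X. \<Sum>y\<in>X. A x y * (f x * f x)) + (\<Sum>x\<in>X. \<Sum>y\<in>X. A x y * (f y * f y)) - 2 * Q"
    unfolding D_eq Q_def sum_distrib_left sum.distrib[symmetric] sum_subtractf[symmetric]
    by (intro sum.cong refl) (simp add: power2_eq_square algebra_simps)
  also have "(\<Sum>x\<in>X. \<Sum>y\<in>X. A x y * (f y * f y)) = (\<Sum>x\<in>X. \<Sum>y\<in>X. A x y * (f x * f x))"
    by (subst sum.swap, intro sum.cong refl) (use Asym in auto)
  also have "(\<Sum>x\<in>X. \<Sum>y\<in>X. A x y * (f x * f x)) = real b * W"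
    unfolding W_def sum_distrib_left by (intro sum.cong refl) (simp add: Arow sum_distrib_right[symmetric])
  finally have D1: "D f = 2 * (real b * W - Q)" by simp
  have "(\<Sum>x\<in>X. \<Sum>y\<in>X. (f x - f y)\<^sup>2) = (\<Sum>x\<in>X. \<Sum>y\<in>X. f x * f x + f y * f y - 2 * (f x * f y))"
    by (intro sum.cong refl) (simp add: power2_eq_square algebra_simps)
  also have "\<dots> = 2 * (real (card X) * W) - 2 * ((\<Sum>x\<in>X. f x) * (\<Sum>y\<in>X. f y))"
  proof -
    have "2 * ((\<Sum>x\<in>X. f x) * (\<Sum>y\<in>X. f y)) = (\<Sum>x\<in>X. \<Sum>y\<in>X. 2 * (f x * f y))"
      unfolding sum_product unfolding sum_distrib_left ..
    then show ?thesis by (simp add: sum.distrib sum_subtractf W_def sum_distrib_left)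
  qed
  finally have var: "2 * (real (card X) * W) \<le> 36 * 10 ^ 13 * (B * D f)"
    using variance_le[of f] f by simp
  have W0: "0 \<le> W" unfolding W_def by (intro sum_nonneg) auto
  have "B * (2 * (B / 8 * W)) \<le> 2 * (real (card X) * W)"
    using mult_right_mono[OF card_X_ge W0] by (simp add: power2_eq_square mult_ac)
  also note var
  finally have "B * (2 * (B / 8 * W)) \<le> B * (36 * 10 ^ 13 * D f)" by simp
  then have BW: "B * W \<le> 144 * 10 ^ 13 * D f" using B_ge_1 by (simp add: mult_le_cancel_left mult.commute)
  have "X \<noteq> {}" using card_X_ge B_ge_1 by auto
  then obtain x where x: "x \<in> X" by blast
  have "real b \<le> 288 * B" using link_degree_le[OF x] b[OF x] by simp
  then have "real b * W \<le> 288 * (B * W)" using mult_right_mono[OF _ W0] by fastforce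
  moreover have "0 \<le> D f" by (simp add: energy_nonneg)
  \<comment> \<open>The product 288 * 144 * 2 * 10^13 is about 8.3 * 10^17, rounded up to
    \<open>10 ^ 18\<close>.\<close>
  moreover have "u \<le> 10 ^ 18 * e" if "u \<le> 288 * w" "0 \<le> 2 * e" "w \<le> 144 * 10 ^ 13 * (2 * e)" for u w e :: real
    using that by simp
  ultimately have "real b * W \<le> 10 ^ 18 * (real b * W - Q)" using BW unfolding D1 by blast
  then show ?thesis unfolding A_def[symmetric] Q_def[symmetric] W_def[symmetric]
    by (simp add: algebra_simps)
qed

end

section \<open>The spectrum of the polygraph\<close>

text \<open>
  The eigenvalue of the normalized distance-\<open>l\<close> operator belonging to the eigenvalue \<open>d * x\<close> of
  the adjacency operator.
\<close>

fun sphere_poly :: "nat \<Rightarrow> nat \<Rightarrow> real \<Rightarrow> real" where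
  "sphere_poly d 0 x = 1"
| "sphere_poly d (Suc 0) x = x"
| "sphere_poly d (Suc (Suc l)) x =
    (real d * x * sphere_poly d (Suc l) x - sphere_poly d l x) / (real d - 1)"

text \<open>
  The quadratic form below is multiplied by \<open>\<theta>\<close> when \<open>l\<close> grows by one. If the next value exceeds
  the previous one in absolute value, this forces the next value to be small, uniformly in \<open>d\<close>.
\<close>

lemma sphere_poly_form:
  assumes "3 \<le> d"
  defines "\<theta> \<equiv> 1 / (real d - 1)"
  shows "(sphere_poly d (Suc l) x)\<^sup>2 - (1 + \<theta>) * x * sphere_poly d (Suc l) x * sphere_poly d l x
    + \<theta> * (sphere_poly d l x)\<^sup>2 = \<theta> ^ Suc l * (1 - x\<^sup>2)"
proof (induction l)
  case 0
  show ?case by (simp add: algebra_simps power2_eq_square)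
next
  case (Suc l)
  define a b c where "a = sphere_poly d l x" and "b = sphere_poly d (Suc l) x" and "c = sphere_poly d (Suc (Suc l)) x"
  have "real d / (real d - 1) = 1 + \<theta>" using assms(1) by (simp add: \<theta>_def field_simps)
  moreover have "c = real d / (real d - 1) * x * b - \<theta> * a"
    by (simp add: a_def b_def c_def \<theta>_def diff_divide_distrib)
  ultimately have c: "c = (1 + \<theta>) * x * b - \<theta> * a" by (simp only:)
  have "c\<^sup>2 - (1 + \<theta>) * x * c * b + \<theta> * b\<^sup>2 = \<theta> * (b\<^sup>2 - (1 + \<theta>) * x * b * a + \<theta> * a\<^sup>2)"
    unfolding c by (simp add: algebra_simps power2_eq_square)
  also have "\<dots> = \<theta> * (\<theta> ^ Suc l * (1 - x\<^sup>2))"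
    using Suc.IH by (simp only: a_def b_def)
  finally show ?case by (simp add: a_def b_def c_def)
qed

text \<open>In absolute values the form splits into
  \<open>(1 - y) * (Q\<^sup>2 + \<theta> * w\<^sup>2)\<close> and
  \<open>y * ((Q - w) * (Q - \<theta> * w))\<close>, both nonnegative because \<open>w < Q\<close>.
  The first part alone gives \<open>Q\<^sup>2 \<le> \<theta>\<^sup>2 * (1 + y) \<le> 1 / 2\<close>,
  and \<open>3 / 4\<close> is a convenient bound above the root.\<close>

lemma abs_le_if_form_small:
  fixes P u x \<theta> :: real
  assumes \<theta>: "0 < \<theta>" "\<theta> \<le> 1 / 2" and x: "\<bar>x\<bar> \<le> 1" and less: "\<bar>u\<bar> < \<bar>P\<bar>"
    and form: "P\<^sup>2 - (1 + \<theta>) * x * P * u + \<theta> * u\<^sup>2 \<le> \<theta>\<^sup>2 * (1 - x\<^sup>2)"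
  shows "\<bar>P\<bar> \<le> 3 / 4"
proof -
  define y w Q where "y = \<bar>x\<bar>" and "w = \<bar>u\<bar>" and "Q = \<bar>P\<bar>"
  have y: "0 \<le> y" "y \<le> 1" and w: "0 \<le> w" "w < Q" using x less by (auto simp: y_def w_def Q_def)
  have sq: "P\<^sup>2 = Q\<^sup>2" "u\<^sup>2 = w\<^sup>2" "x\<^sup>2 = y\<^sup>2" by (simp_all add: y_def w_def Q_def)
  have "x * P * u \<le> y * Q * w" unfolding y_def w_def Q_def abs_mult[symmetric] by simp
  then have "(1 + \<theta>) * (x * P * u) \<le> (1 + \<theta>) * (y * Q * w)" using \<theta> by (intro mult_left_mono) auto
  then have "Q\<^sup>2 - (1 + \<theta>) * (y * Q * w) + \<theta> * w\<^sup>2 \<le> \<theta>\<^sup>2 * (1 - y\<^sup>2)"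
    using form unfolding sq by (simp add: mult.assoc)
  moreover have "Q\<^sup>2 - (1 + \<theta>) * (y * Q * w) + \<theta> * w\<^sup>2
      = (1 - y) * Q\<^sup>2 + (1 - y) * (\<theta> * w\<^sup>2) + y * ((Q - w) * (Q - \<theta> * w))"
    by (simp add: algebra_simps power2_eq_square)
  moreover have "0 \<le> (1 - y) * (\<theta> * w\<^sup>2)" using y \<theta> by simp
  ultimately have le: "(1 - y) * Q\<^sup>2 + y * ((Q - w) * (Q - \<theta> * w)) \<le> \<theta>\<^sup>2 * (1 - y\<^sup>2)" by linarith
  have "\<theta> * w \<le> 1 * w" using \<theta> w by (intro mult_right_mono) auto
  then have pos: "0 < (Q - w) * (Q - \<theta> * w)" using w by (intro mult_pos_pos) auto
  have y1: "y < 1"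
  proof (rule ccontr)
    assume "\<not> y < 1"
    then have "y = 1" using y by simp
    then show False using le pos by simp
  qed
  have "0 \<le> y * ((Q - w) * (Q - \<theta> * w))" using y pos by simp
  with le have "(1 - y) * Q\<^sup>2 \<le> (1 - y) * (\<theta>\<^sup>2 * (1 + y))"
    by (simp add: algebra_simps power2_eq_square)
  then have "Q\<^sup>2 \<le> \<theta>\<^sup>2 * (1 + y)" using y1 by (simp add: mult_le_cancel_left)
  also have "\<dots> \<le> (1 / 2)\<^sup>2 * 2" using \<theta> y by (intro mult_mono power_mono) auto
  also have "\<dots> \<le> (3 / 4)\<^sup>2" by (simp add: power2_eq_square)
  finally show ?thesis unfolding Q_def[symmetric] by (rule power2_le_imp_le) simp
qed

text \<open>If the absolute value does not grow from one degree to the next, the induction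
  hypothesis passes on; if it grows, the invariant form bounds it by \<open>3 / 4\<close>
  outright.\<close>

lemma abs_sphere_poly_le:
  assumes d: "3 \<le> d" and x: "\<bar>x\<bar> \<le> 1"
  shows "\<bar>sphere_poly d (Suc l) x\<bar> \<le> max \<bar>x\<bar> (3 / 4)"
proof (induction l)
  case (Suc l)
  define \<theta> where "\<theta> = 1 / (real d - 1)"
  have \<theta>: "0 < \<theta>" "\<theta> \<le> 1 / 2" using d by (simp_all add: \<theta>_def field_simps)
  show ?case
  proof (cases "\<bar>sphere_poly d (Suc l) x\<bar> < \<bar>sphere_poly d (Suc (Suc l)) x\<bar>")
    case True
    \<comment> \<open>The induction starts at degree 1, so the exponent in the invariant is at least
      2 here, as \<open>abs_le_if_form_small\<close> requires.\<close>
    have "\<theta> ^ Suc (Suc l) \<le> \<theta>\<^sup>2" using \<theta> by (intro power_decreasing) auto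
    moreover have "x\<^sup>2 \<le> 1" using x by (simp add: abs_square_le_1)
    ultimately have "\<theta> ^ Suc (Suc l) * (1 - x\<^sup>2) \<le> \<theta>\<^sup>2 * (1 - x\<^sup>2)"
      by (intro mult_right_mono) auto
    then have "\<bar>sphere_poly d (Suc (Suc l)) x\<bar> \<le> 3 / 4"
      using sphere_poly_form[OF d, of "Suc l" x] unfolding \<theta>_def[symmetric]
      by (intro abs_le_if_form_small[OF \<theta> x True]) simp
    then show ?thesis by (rule max.coboundedI2)
  next
    case False
    then show ?thesis using Suc.IH by linarith
  qed
qed simp

lemma abs_sphere_poly_le_1:
  assumes "3 \<le> d" "\<bar>x\<bar> \<le> 1"
  shows "\<bar>sphere_poly d l x\<bar> \<le> 1"
  using abs_sphere_poly_le[OF assms, of "l - 1"] assms(2) by (cases l) (auto simp: max_def split: if_splits)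

lemma kernel_product:
  fixes \<phi> :: "nat \<Rightarrow> 'a \<Rightarrow> real"
  assumes orth: "\<And>k l. k < n \<Longrightarrow> l < n \<Longrightarrow> (\<Sum>z\<in>V. \<phi> k z * \<phi> l z) = (if k = l then 1 else 0)"
  shows "(\<Sum>z\<in>V. (\<Sum>k<n. a k * \<phi> k x * \<phi> k z) * (\<Sum>l<n. b l * \<phi> l z * \<phi> l y))
    = (\<Sum>k<n. a k * b k * \<phi> k x * \<phi> k y)"
proof -
  have eq: "(a k * \<phi> k x * \<phi> k z) * (b l * \<phi> l z * \<phi> l y) = a k * \<phi> k x * (b l * \<phi> l y) * (\<phi> k z * \<phi> l z)" for k l z
    by simp
  have "(\<Sum>z\<in>V. (\<Sum>k<n. a k * \<phi> k x * \<phi> k z) * (\<Sum>l<n. b l * \<phi> l z * \<phi> l y))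
      = (\<Sum>z\<in>V. \<Sum>k<n. \<Sum>l<n. a k * \<phi> k x * (b l * \<phi> l y) * (\<phi> k z * \<phi> l z))"
    unfolding sum_product by (intro sum.cong refl eq)
  also have "\<dots> = (\<Sum>k<n. \<Sum>l<n. \<Sum>z\<in>V. a k * \<phi> k x * (b l * \<phi> l y) * (\<phi> k z * \<phi> l z))"
    by (rule sum_rotate)
  also have "\<dots> = (\<Sum>k<n. \<Sum>l<n. (a k * \<phi> k x * (b l * \<phi> l y)) * (if k = l then 1 else 0))"
    by (intro sum.cong refl) (simp only: sum_distrib_left[symmetric] lessThan_iff orth)
  also have "\<dots> = (\<Sum>k<n. a k * \<phi> k x * (b k * \<phi> k y))"
    by (intro sum.cong refl) (simp only: sum_delta_mult finite_lessThan lessThan_iff)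
  finally show ?thesis by (simp add: mult_ac)
qed

definition sphere_size :: "nat \<Rightarrow> nat \<Rightarrow> real" where
  "sphere_size d l = real (tree_count d 0 l l)"

lemma sphere_size_eq: "sphere_size d l = (if l = 0 then 1 else real d * real (d - 1) ^ (l - 1))"
  using tree_count_eq[of d 0 0 l] by (simp add: sphere_size_def)

text \<open>The distance operators of a tree satisfy \<open>A_1 A_(l+1) = A_(l+2) + c A_l\<close>,
  where \<open>c\<close> is \<open>d\<close> for \<open>l = 0\<close> and \<open>d - 1\<close>
  otherwise. Normalised by the sphere sizes this is the recursion of
  \<open>sphere_poly\<close>.\<close>

lemma (in local_tree) distance_kernel_expansion:
  fixes \<phi> :: "nat \<Rightarrow> 'a \<Rightarrow> real"
  assumes d: "3 \<le> d"
    and orth: "\<And>k l. k < n \<Longrightarrow> l < n \<Longrightarrow> (\<Sum>z\<in>V. \<phi> k z * \<phi> l z) = (if k = l then 1 else 0)"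
    and compl: "\<And>x y. x \<in> V \<Longrightarrow> y \<in> V \<Longrightarrow> (\<Sum>k<n. \<phi> k x * \<phi> k y) = (if x = y then 1 else 0)"
    and kern: "\<And>x y. x \<in> V \<Longrightarrow> y \<in> V \<Longrightarrow> (\<Sum>k<n. ev k * \<phi> k x * \<phi> k y) = (if \<rho> x y = 1 then 1 else 0)"
    and l: "2 * l \<le> R" and V: "x \<in> V" "y \<in> V"
  shows "(\<Sum>k<n. sphere_size d l * sphere_poly d l (ev k / real d) * \<phi> k x * \<phi> k y) = of_bool (\<rho> x y = l)"
  using l V
proof (induction l arbitrary: x y rule: induct_nat_012)
  case 0
  then show ?case using compl[of x y] dist_0_iff[of x y] by (simp add: sphere_size_eq)
next
  case 1
  have "d \<noteq> 0" using d by simp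
  then show ?case using kern[of x y] 1 by (simp add: sphere_size_eq)
next
  case (ge2 l)
  define a where "a k = sphere_size d (Suc l) * sphere_poly d (Suc l) (ev k / real d)" for k
  define c where "c = (if l = 0 then real d else real d - 1)"
  have cd: "c = real (if l = 0 then d else d - 1)" using d by (simp add: c_def of_nat_diff)
  have size: "sphere_size d (Suc l) = c * sphere_size d l" "sphere_size d (Suc (Suc l)) = (real d - 1) * sphere_size d (Suc l)"
    using d by (cases l; simp add: sphere_size_eq c_def of_nat_diff)+
  have coeff: "sphere_size d (Suc (Suc l)) * sphere_poly d (Suc (Suc l)) (ev k / real d)
      = ev k * a k - c * (sphere_size d l * sphere_poly d l (ev k / real d))" for k
  proof -
    have "sphere_size d (Suc (Suc l)) * sphere_poly d (Suc (Suc l)) (ev k / real d)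
        = sphere_size d (Suc l) * (real d * (ev k / real d) * sphere_poly d (Suc l) (ev k / real d) - sphere_poly d l (ev k / real d))"
      unfolding size(2) using d by simp
    also have "real d * (ev k / real d) = ev k" using d by simp
    finally show ?thesis by (simp add: a_def right_diff_distrib size(1))
  qed
  have rec: "(\<Sum>z\<in>V. of_bool (\<rho> x z = 1) * of_bool (\<rho> z y = Suc l))
      = of_bool (\<rho> x y = Suc (Suc l)) + c * of_bool (\<rho> x y = l)"
  proof -
    have "(\<Sum>z\<in>V. of_bool (\<rho> x z = 1) * of_bool (\<rho> z y = Suc l) :: real)
        = (\<Sum>z\<in>V. of_bool (\<rho> x z = 1 \<and> \<rho> y z = Suc l))"
      using dist_commute[OF _ ge2.prems(3)] by (intro sum.cong refl) simp
    also have "\<dots> = real (card {z \<in> V. \<rho> x z = 1 \<and> \<rho> y z = Suc l})"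
      using finite_V by (simp add: of_bool_def sum.If_cases Int_def)
    also have "\<dots> = of_bool (\<rho> x y = Suc (Suc l)) + c * of_bool (\<rho> x y = l)"
    proof (cases "\<rho> x y \<le> Suc (Suc l)")
      case True
      then have "card {z \<in> V. \<rho> x z = 1 \<and> \<rho> y z = Suc l} = tree_count d (\<rho> x y) 1 (Suc l)"
        using ge2.prems by (intro card_triangle) auto
      also consider "\<rho> x y = Suc (Suc l)" | "\<rho> x y = l" | "\<not> tripod (\<rho> x y) 1 (Suc l)"
      proof -
        have "\<rho> x y = Suc (Suc l) \<or> \<rho> x y = l" if "tripod (\<rho> x y) 1 (Suc l)"
        proof -
          have "l \<le> \<rho> x y" "even (\<rho> x y + 1 + Suc l)" using that by (simp_all add: tripod_iff)
          then show ?thesis using True by (metis add.commute add_Suc_right dvd_refl even_Suc even_add le_SucE le_antisym plus_1_eq_Suc)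
        qed
        then show ?thesis using that by blast
      qed
      then have "real (tree_count d (\<rho> x y) 1 (Suc l)) = of_bool (\<rho> x y = Suc (Suc l)) + c * of_bool (\<rho> x y = l)"
      proof cases
        case 1
        then show ?thesis using tree_count_eq[of d 1 "Suc l" 0] by simp
      next
        case 2
        then show ?thesis using tree_count_eq[of d 0 l 1] by (simp add: cd)
      next
        case 3
        then have "\<rho> x y \<noteq> Suc (Suc l)" "\<rho> x y \<noteq> l" by (auto simp: tripod_iff)
        then show ?thesis using tree_count_eq_0[OF 3] by simp
      qed
      finally show ?thesis .
    next
      case False
      then have none: "\<not> (\<rho> x z = 1 \<and> \<rho> y z = Suc l)" if "z \<in> V" for z
        using dist_triangle[of x z y] dist_commute[of y z] that ge2.prems by auto
      then have none: "{z \<in> V. \<rho> x z = 1 \<and> \<rho> y z = Suc l} = {}" by blast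
      show ?thesis unfolding none using False by simp
    qed
    finally show ?thesis .
  qed
  have "(\<Sum>k<n. sphere_size d (Suc (Suc l)) * sphere_poly d (Suc (Suc l)) (ev k / real d) * \<phi> k x * \<phi> k y)
      = (\<Sum>k<n. ev k * a k * \<phi> k x * \<phi> k y)
        - c * (\<Sum>k<n. sphere_size d l * sphere_poly d l (ev k / real d) * \<phi> k x * \<phi> k y)"
    unfolding coeff sum_distrib_left sum_subtractf[symmetric]
    by (intro sum.cong refl) (simp add: algebra_simps)
  also have "(\<Sum>k<n. sphere_size d l * sphere_poly d l (ev k / real d) * \<phi> k x * \<phi> k y) = of_bool (\<rho> x y = l)"
    using ge2.IH(1)[of x y] ge2.prems by simp
  also have "(\<Sum>k<n. ev k * a k * \<phi> k x * \<phi> k y)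
      = (\<Sum>z\<in>V. (\<Sum>k<n. ev k * \<phi> k x * \<phi> k z) * (\<Sum>k<n. a k * \<phi> k z * \<phi> k y))"
    by (rule kernel_product[OF orth, symmetric])
  also have "\<dots> = (\<Sum>z\<in>V. of_bool (\<rho> x z = 1) * of_bool (\<rho> z y = Suc l))"
  proof (intro sum.cong refl)
    fix z assume z: "z \<in> V"
    have "(\<Sum>k<n. a k * \<phi> k z * \<phi> k y) = of_bool (\<rho> z y = Suc l)"
      unfolding a_def using ge2.IH(2)[of z y] ge2.prems z by simp
    then show "(\<Sum>k<n. ev k * \<phi> k x * \<phi> k z) * (\<Sum>k<n. a k * \<phi> k z * \<phi> k y)
        = of_bool (\<rho> x z = 1) * of_bool (\<rho> z y = Suc l)"
      using kern[of x z] z ge2.prems by simp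
  qed
  also note rec
  finally show ?case by simp
qed

text \<open>Lists of lengths and not of labels: for \<open>p = 0 < q\<close> there are only three of
  them, hence merely the bound 6. The last fact lets \<open>q\<close>, which is positive in the
  application, be placed at any coordinate.\<close>

lemma triple_perms:
  fixes p q :: nat
  defines "P \<equiv> {ts. mset ts = {#p, q, p + q#}}"
  shows "finite P" "card P \<le> 6" "[p, q, p + q] \<in> P" "\<And>ts. ts \<in> P \<Longrightarrow> length ts = 3"
    and "\<And>ts g. ts \<in> P \<Longrightarrow> (\<Prod>i<3. g (ts ! i)) = g p * g q * (g (p + q) :: real)"
    and "\<And>i. i < 3 \<Longrightarrow> \<exists>ts\<in>P. ts ! i = q"
proof -
  define l where "l a = (if a = 0 then p else if a = 1 then q else p + q)" for a :: nat
  have S: "{#p, q, p + q#} = image_mset l {#0, 1, 2#}" by (simp add: l_def)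
  have len: "length ts = 3" if "ts \<in> P" for ts
  proof -
    have "size (mset ts) = size {#p, q, p + q#}" using that by (simp add: P_def)
    then show ?thesis by simp
  qed
  have P: "P = map l ` labellings"
  proof (intro equalityI subsetI)
    fix ts assume ts: "ts \<in> P"
    then have "mset ts = image_mset l {#0, 1, 2#}" using S by (simp add: P_def)
    then show "ts \<in> map l ` labellings" using mset_eq_iff_labelling[OF len[OF ts], of l] by blast
  next
    fix ts assume "ts \<in> map l ` labellings"
    then show "ts \<in> P" unfolding P_def S labellings_def by auto
  qed
  show "finite P" by (simp add: P)
  show "card P \<le> 6" unfolding P using card_image_le[OF finite_labellings, of "map l"] card_labellings by simp
  show "[p, q, p + q] \<in> P" by (simp add: P_def)
  show "length ts = 3" if "ts \<in> P" for ts by (rule len[OF that])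
  show "(\<Prod>i<3. g (ts ! i)) = g p * g q * g (p + q)" if ts: "ts \<in> P" for ts and g :: "nat \<Rightarrow> real"
  proof -
    obtain t where t: "t \<in> labellings" "ts = map l t" using ts P by blast
    have "(\<Prod>i<3. g (ts ! i)) = (\<Prod>i<3. g (l (t ! i)))"
      using t length_labelling by (intro prod.cong) auto
    also have "\<dots> = g p * g q * g (p + q)"
      using prod_labelling[OF t(1), of "\<lambda>a. g (l a)"] by (simp add: l_def)
    finally show ?thesis .
  qed
  show "\<exists>ts\<in>P. ts ! i = q" if "i < 3" for i
  proof -
    have "[q, p, p + q] \<in> P" "[p, p + q, q] \<in> P" "[p, q, p + q] \<in> P" by (simp_all add: P_def add_mset_commute)
    moreover have "i = 0 \<or> i = 1 \<or> i = 2" using that by linarith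
    ultimately show ?thesis by (elim disjE) (auto intro: bexI[rotated])
  qed
qed

text \<open>One of at most six terms loses \<delta>, so the average loses at least \<delta> /
  6.\<close>

lemma mean_le_if_one_small:
  fixes w :: "'b \<Rightarrow> real"
  assumes P: "finite P" "card P \<le> 6" and t: "t \<in> P" "w t \<le> 1 - \<delta>" and w: "\<And>s. s \<in> P \<Longrightarrow> w s \<le> 1" and \<delta>: "0 \<le> \<delta>"
  shows "(\<Sum>s\<in>P. w s) \<le> (1 - \<delta> / 6) * real (card P)"
proof -
  have "(\<Sum>s\<in>P. w s) \<le> (\<Sum>s\<in>P. 1 - (if s = t then \<delta> else 0))"
    by (intro sum_mono) (use t w in auto)
  also have "\<dots> = real (card P) - \<delta>"
    using P(1) t(1) by (simp add: sum_subtractf)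
  finally have "(\<Sum>s\<in>P. w s) \<le> real (card P) - \<delta>" .
  moreover have "\<delta> / 6 * real (card P) \<le> \<delta> / 6 * 6" using P(2) \<delta> by (intro mult_left_mono) auto
  moreover have "(1 - \<delta> / 6) * real (card P) = real (card P) - \<delta> / 6 * real (card P)"
    by (simp only: left_diff_distrib mult_1_left)
  ultimately show ?thesis by linarith
qed

lemma quadratic_form_expansion:
  fixes \<Phi> :: "'j \<Rightarrow> 'b \<Rightarrow> real"
  shows "(\<Sum>x\<in>L. \<Sum>y\<in>L. (\<Sum>J\<in>I. m J * \<Phi> J x * \<Phi> J y) * f x * f y)
    = (\<Sum>J\<in>I. m J * ((\<Sum>x\<in>L. f x * \<Phi> J x) * (\<Sum>x\<in>L. f x * \<Phi> J x)))"
proof -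
  have "(\<Sum>x\<in>L. \<Sum>y\<in>L. (\<Sum>J\<in>I. m J * \<Phi> J x * \<Phi> J y) * f x * f y)
      = (\<Sum>x\<in>L. \<Sum>y\<in>L. \<Sum>J\<in>I. m J * ((f x * \<Phi> J x) * (f y * \<Phi> J y)))"
    unfolding sum_distrib_right by (intro sum.cong refl) simp
  also have "\<dots> = (\<Sum>J\<in>I. \<Sum>x\<in>L. \<Sum>y\<in>L. m J * ((f x * \<Phi> J x) * (f y * \<Phi> J y)))"
    by (rule sum_rotate[symmetric])
  also have "\<dots> = (\<Sum>J\<in>I. m J * ((\<Sum>x\<in>L. f x * \<Phi> J x) * (\<Sum>x\<in>L. f x * \<Phi> J x)))"
    unfolding sum_product unfolding sum_distrib_left ..
  finally show ?thesis .
qed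

lemma triple_perms_nth_le:
  assumes "mset ts = {#p, q, p + q :: nat#}" "i < 3"
  shows "ts ! i \<le> p + q"
proof -
  have "length ts = 3" using triple_perms(4) assms(1) by simp
  then have "ts ! i \<in> set ts" using assms(2) by simp
  then have "ts ! i \<in># mset ts" by simp
  then show ?thesis unfolding assms(1) by auto
qed

context local_tree
begin

lemma of_bool_mset_map2:
  assumes "x \<in> tuples 3 V" "y \<in> tuples 3 V"
  shows "of_bool (mset (map2 \<rho> x y) = {#p, q, p + q#})
    = (\<Sum>ts\<in>{ts. mset ts = {#p, q, p + q#}}. \<Prod>i<3. of_bool (\<rho> (x ! i) (y ! i) = ts ! i) :: real)"
proof -
  have "(\<Prod>i<3. of_bool (\<rho> (x ! i) (y ! i) = ts ! i)) = (of_bool (ts = map2 \<rho> x y) :: real)"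
    if "ts \<in> {ts. mset ts = {#p, q, p + q#}}" for ts
  proof -
    have "length ts = 3" "length x = 3" "length y = 3"
      using triple_perms(4) that assms by (auto simp: tuples_def)
    then have "ts = map2 \<rho> x y \<longleftrightarrow> (\<forall>i<3. \<rho> (x ! i) (y ! i) = ts ! i)"
      by (auto simp: list_eq_iff_nth_eq)
    then show ?thesis by (simp add: prod_of_bool Ball_def)
  qed
  then have "(\<Sum>ts\<in>{ts. mset ts = {#p, q, p + q#}}. \<Prod>i<3. of_bool (\<rho> (x ! i) (y ! i) = ts ! i) :: real)
      = (\<Sum>ts\<in>{ts. mset ts = {#p, q, p + q#}}. of_bool (ts = map2 \<rho> x y))"
    by (rule sum.cong[OF refl])
  also have "\<dots> = of_bool (map2 \<rho> x y \<in> {ts. mset ts = {#p, q, p + q#}})"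
    using triple_perms(1) by (simp add: of_bool_def sum.delta')
  finally show ?thesis by simp
qed

definition poly_degree :: "nat \<Rightarrow> nat \<Rightarrow> real" where
  "poly_degree p q = real (card {ts. mset ts = {#p, q, p + q#}}) *
    (sphere_size d p * sphere_size d q * sphere_size d (p + q))"

lemma card_polygraph_neighbours:
  assumes R: "2 * (p + q) \<le> R" and x: "x \<in> tuples 3 V"
  shows "real (card {y \<in> tuples 3 V. mset (map2 \<rho> x y) = {#p, q, p + q#}}) = poly_degree p q"
proof -
  define P where "P = {ts. mset ts = {#p, q, p + q#}}"
  have "real (card {y \<in> tuples 3 V. mset (map2 \<rho> x y) = {#p, q, p + q#}})
      = (\<Sum>y\<in>tuples 3 V. of_bool (mset (map2 \<rho> x y) = {#p, q, p + q#}))"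
    using finite_V by (simp add: of_bool_def sum.If_cases Int_def)
  also have "\<dots> = (\<Sum>y\<in>tuples 3 V. \<Sum>ts\<in>P. \<Prod>i<3. of_bool (\<rho> (x ! i) (y ! i) = ts ! i))"
    unfolding P_def by (intro sum.cong refl of_bool_mset_map2 x)
  also have "\<dots> = (\<Sum>ts\<in>P. \<Sum>y\<in>tuples 3 V. \<Prod>i<3. of_bool (\<rho> (x ! i) (y ! i) = ts ! i))"
    by (rule sum.swap)
  also have "\<dots> = (\<Sum>ts\<in>P. sphere_size d p * sphere_size d q * sphere_size d (p + q))"
  proof (intro sum.cong refl)
    fix ts assume ts: "ts \<in> P"
    have "(\<Sum>y\<in>tuples 3 V. \<Prod>i<3. of_bool (\<rho> (x ! i) (y ! i) = ts ! i) :: real)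
        = (\<Prod>i<3. \<Sum>y\<in>V. of_bool (\<rho> (x ! i) y = ts ! i))"
      by (rule sum_prod_tuples[OF finite_V, of "\<lambda>i y. of_bool (\<rho> (x ! i) y = ts ! i)"])
    also have "\<dots> = (\<Prod>i<3. sphere_size d (ts ! i))"
    proof (intro prod.cong refl)
      fix i :: nat assume "i \<in> {..<3}"
      then have i: "i < 3" by simp
      have "ts ! i \<le> p + q" using triple_perms_nth_le[OF _ i] ts by (simp add: P_def)
      then show "(\<Sum>y\<in>V. of_bool (\<rho> (x ! i) y = ts ! i)) = sphere_size d (ts ! i)"
        using card_sphere[OF tuples_nth[OF x i], of "ts ! i"] R finite_V
        by (simp add: of_bool_def sum.If_cases Int_def sphere_size_def)
    qed
    also have "\<dots> = sphere_size d p * sphere_size d q * sphere_size d (p + q)"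
      using triple_perms(5)[of ts p q "sphere_size d"] ts by (simp add: P_def)
    finally show "(\<Sum>y\<in>tuples 3 V. \<Prod>i<3. of_bool (\<rho> (x ! i) (y ! i) = ts ! i))
      = sphere_size d p * sphere_size d q * sphere_size d (p + q)" .
  qed
  also have "\<dots> = poly_degree p q" by (simp add: poly_degree_def P_def)
  finally show ?thesis .
qed

text \<open>The tensor products \<open>\<Phi> J\<close> of eigenfunctions diagonalise the polygraph
  with eigenvalues \<open>m J\<close>, and \<open>f\<close> is orthogonal to the one whose indices
  are all 0. Any other \<open>J\<close> has a coordinate of nonzero index; the arrangement that
  places \<open>q\<close> there has a factor at most \<open>1 - \<delta>\<close> in absolute value,
  and all normalised factors are at most 1. The length \<open>p\<close> would not do: its polynomial
  is constant for \<open>p = 0\<close>.\<close>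

theorem polygraph_form_le:
  fixes \<phi> :: "nat \<Rightarrow> 'a \<Rightarrow> real"
  assumes d: "3 \<le> d" and R: "2 * (p + q) \<le> R" and pq: "p < q" and n: "0 < n"
    and orth: "\<And>k l. k < n \<Longrightarrow> l < n \<Longrightarrow> (\<Sum>z\<in>V. \<phi> k z * \<phi> l z) = (if k = l then 1 else 0)"
    and compl: "\<And>x y. x \<in> V \<Longrightarrow> y \<in> V \<Longrightarrow> (\<Sum>k<n. \<phi> k x * \<phi> k y) = (if x = y then 1 else 0)"
    and kern: "\<And>x y. x \<in> V \<Longrightarrow> y \<in> V \<Longrightarrow> (\<Sum>k<n. ev k * \<phi> k x * \<phi> k y) = (if \<rho> x y = 1 then 1 else 0)"
    and ev: "\<And>k. k < n \<Longrightarrow> \<bar>ev k\<bar> \<le> real d" and gap: "\<And>k. 0 < k \<Longrightarrow> k < n \<Longrightarrow> \<bar>ev k\<bar> \<le> (1 - \<gamma>) * real d"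
    and \<gamma>: "0 < \<gamma>"
    and f: "(\<Sum>x\<in>tuples 3 V. f x * (\<Prod>i<3. \<phi> 0 (x ! i))) = 0"
  shows "(\<Sum>x\<in>tuples 3 V. \<Sum>y\<in>tuples 3 V. of_bool (mset (map2 \<rho> x y) = {#p, q, p + q#}) * f x * f y)
    \<le> (1 - min \<gamma> (1 / 4) / 6) * poly_degree p q * (\<Sum>x\<in>tuples 3 V. f x * f x)"
proof -
  define P where "P = {ts. mset ts = {#p, q, p + q#}}"
  define L where "L = tuples 3 V"
  define I where "I = tuples 3 {..<n}"
  \<comment> \<open>The minimum with \<open>1 / 4\<close> comes from the bound \<open>3 / 4\<close>
    in \<open>abs_sphere_poly_le\<close>.\<close>
  define \<delta> where "\<delta> = min \<gamma> (1 / 4)"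
  define x' where "x' k = ev k / real d" for k
  define \<Phi> where "\<Phi> J x = (\<Prod>i<3. \<phi> (J ! i) (x ! i))" for J :: "nat list" and x
  define m where "m J = (\<Sum>ts\<in>P. \<Prod>i<3. sphere_size d (ts ! i) * sphere_poly d (ts ! i) (x' (J ! i)))" for J
  define s where "s = sphere_size d p * sphere_size d q * sphere_size d (p + q)"
  have P: "finite P" "card P \<le> 6" unfolding P_def by (rule triple_perms)+
  have ts_le: "ts ! i \<le> p + q" if "ts \<in> P" "i < 3" for ts i
    using triple_perms_nth_le that by (simp add: P_def)
  have kernel: "of_bool (mset (map2 \<rho> x y) = {#p, q, p + q#}) = (\<Sum>J\<in>I. m J * \<Phi> J x * \<Phi> J y)"
    if x: "x \<in> L" and y: "y \<in> L" for x y
  proof -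
    have "of_bool (mset (map2 \<rho> x y) = {#p, q, p + q#}) = (\<Sum>ts\<in>P. \<Prod>i<3. of_bool (\<rho> (x ! i) (y ! i) = ts ! i) :: real)"
      unfolding P_def by (rule of_bool_mset_map2) (use x y in \<open>simp_all add: L_def\<close>)
    also have "\<dots> = (\<Sum>ts\<in>P. \<Prod>i<3. \<Sum>k<n. sphere_size d (ts ! i) * sphere_poly d (ts ! i) (x' k) * \<phi> k (x ! i) * \<phi> k (y ! i))"
    proof (intro sum.cong prod.cong refl)
      fix ts and i :: nat assume "ts \<in> P" "i \<in> {..<3}"
      then have i: "ts \<in> P" "i < 3" by simp_all
      have l: "2 * ts ! i \<le> R" using ts_le[OF i] R by simp
      have V: "x ! i \<in> V" "y ! i \<in> V" using x y i tuples_nth unfolding L_def by blast+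
      show "of_bool (\<rho> (x ! i) (y ! i) = ts ! i)
        = (\<Sum>k<n. sphere_size d (ts ! i) * sphere_poly d (ts ! i) (x' k) * \<phi> k (x ! i) * \<phi> k (y ! i))"
        unfolding x'_def by (rule distance_kernel_expansion[OF d orth compl kern l V, symmetric])
    qed
    also have "\<dots> = (\<Sum>ts\<in>P. \<Sum>J\<in>I. \<Prod>i<3. sphere_size d (ts ! i) * sphere_poly d (ts ! i) (x' (J ! i)) * \<phi> (J ! i) (x ! i) * \<phi> (J ! i) (y ! i))"
    proof (rule sum.cong[OF refl])
      fix ts
      show "(\<Prod>i<3. \<Sum>k<n. sphere_size d (ts ! i) * sphere_poly d (ts ! i) (x' k) * \<phi> k (x ! i) * \<phi> k (y ! i))
        = (\<Sum>J\<in>I. \<Prod>i<3. sphere_size d (ts ! i) * sphere_poly d (ts ! i) (x' (J ! i)) * \<phi> (J ! i) (x ! i) * \<phi> (J ! i) (y ! i))"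
        unfolding I_def by (rule sum_prod_tuples[OF finite_lessThan, symmetric,
          where g = "\<lambda>i k. sphere_size d (ts ! i) * sphere_poly d (ts ! i) (x' k) * \<phi> k (x ! i) * \<phi> k (y ! i)"])
    qed
    also have "\<dots> = (\<Sum>J\<in>I. m J * \<Phi> J x * \<Phi> J y)"
      unfolding m_def \<Phi>_def sum_distrib_right prod.distrib by (rule sum.swap)
    finally show ?thesis .
  qed
  have ident: "(if x = y then 1 else 0) = (\<Sum>J\<in>I. 1 * \<Phi> J x * \<Phi> J y)" if x: "x \<in> L" and y: "y \<in> L" for x y
  proof -
    have len: "length x = 3" "length y = 3" using x y by (simp_all add: L_def tuples_def)
    have "(\<Sum>J\<in>I. 1 * \<Phi> J x * \<Phi> J y) = (\<Sum>J\<in>I. \<Prod>i<3. \<phi> (J ! i) (x ! i) * \<phi> (J ! i) (y ! i))"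
      unfolding \<Phi>_def prod.distrib by simp
    also have "\<dots> = (\<Prod>i<3. \<Sum>k<n. \<phi> k (x ! i) * \<phi> k (y ! i))"
      unfolding I_def by (rule sum_prod_tuples[of "{..<n}" "\<lambda>i k. \<phi> k (x ! i) * \<phi> k (y ! i)"]) simp
    also have "\<dots> = (\<Prod>i<3. of_bool (x ! i = y ! i))"
    proof (intro prod.cong refl)
      fix i :: nat assume "i \<in> {..<3}"
      then have "x ! i \<in> V" "y ! i \<in> V" using x y tuples_nth unfolding L_def by blast+
      then show "(\<Sum>k<n. \<phi> k (x ! i) * \<phi> k (y ! i)) = of_bool (x ! i = y ! i)"
        by (simp only: compl of_bool_def)
    qed
    also have "\<dots> = (if x = y then 1 else 0)"
      using len by (simp add: prod_of_bool Ball_def list_eq_iff_nth_eq)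
    finally show ?thesis by simp
  qed
  define F where "F J = (\<Sum>x\<in>L. f x * \<Phi> J x)" for J
  have form: "(\<Sum>x\<in>L. \<Sum>y\<in>L. of_bool (mset (map2 \<rho> x y) = {#p, q, p + q#}) * f x * f y) = (\<Sum>J\<in>I. m J * (F J * F J))"
    unfolding F_def quadratic_form_expansion[symmetric] by (intro sum.cong refl) (simp only: kernel)
  have "(\<Sum>x\<in>L. f x * f x) = (\<Sum>x\<in>L. \<Sum>y\<in>L. (if x = y then 1 else 0) * f x * f y)"
    using finite_V by (intro sum.cong refl) (simp add: L_def if_distrib if_distribR cong: if_cong)
  also have "\<dots> = (\<Sum>J\<in>I. 1 * (F J * F J))"
    unfolding F_def quadratic_form_expansion[symmetric, where m = "\<lambda>_. 1"] by (intro sum.cong refl) (simp only: ident)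
  finally have norm: "(\<Sum>x\<in>L. f x * f x) = (\<Sum>J\<in>I. F J * F J)" by simp
  have s: "0 \<le> s" by (simp add: s_def sphere_size_def)
  have x1: "\<bar>x' k\<bar> \<le> 1" if "k < n" for k using ev[OF that] d by (simp add: x'_def)
  have m_le: "m J \<le> (1 - \<delta> / 6) * poly_degree p q" if J: "J \<in> I" and i: "i < 3" "J ! i \<noteq> 0" for J i
  proof -
    have Jn: "J ! j < n" if "j < 3" for j using tuples_nth[of J 3 "{..<n}" j] J that by (simp add: I_def)
    define w where "w ts = (\<Prod>j<3. sphere_poly d (ts ! j) (x' (J ! j)))" for ts
    have fac: "\<bar>sphere_poly d l (x' (J ! j))\<bar> \<le> 1" if "j < 3" for l j
      by (rule abs_sphere_poly_le_1[OF d x1[OF Jn[OF that]]])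
    have w1: "w ts \<le> 1" for ts
    proof -
      have "\<bar>w ts\<bar> \<le> 1" unfolding w_def abs_prod by (rule prod_le_1) (use fac in auto)
      then show ?thesis by simp
    qed
    obtain ts where ts: "ts \<in> P" "ts ! i = q" using triple_perms(6)[OF i(1)] by (auto simp: P_def)
    have "\<bar>x' (J ! i)\<bar> \<le> 1 - \<gamma>"
      using gap[of "J ! i"] Jn[OF i(1)] i(2) d by (simp add: x'_def field_simps)
    then have "max \<bar>x' (J ! i)\<bar> (3 / 4) \<le> 1 - \<delta>" by (auto simp: \<delta>_def)
    then have small: "\<bar>sphere_poly d (ts ! i) (x' (J ! i))\<bar> \<le> 1 - \<delta>"
    proof -
      have "Suc (q - 1) = q" using pq by simp
      then have "\<bar>sphere_poly d q (x' (J ! i))\<bar> \<le> max \<bar>x' (J ! i)\<bar> (3 / 4)"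
        using abs_sphere_poly_le[OF d x1[OF Jn[OF i(1)]], of "q - 1"] by (simp only:)
      then show ?thesis unfolding ts(2) using \<open>max _ _ \<le> 1 - \<delta>\<close> by (rule order_trans)
    qed
    have "\<bar>w ts\<bar> = \<bar>sphere_poly d (ts ! i) (x' (J ! i))\<bar> * (\<Prod>j\<in>{..<3} - {i}. \<bar>sphere_poly d (ts ! j) (x' (J ! j))\<bar>)"
      unfolding w_def abs_prod using i by (intro prod.remove) auto
    also have "\<dots> \<le> (1 - \<delta>) * 1"
      using fac small by (intro mult_mono prod_le_1 small prod_nonneg) auto
    finally have "w ts \<le> 1 - \<delta>" by simp
    moreover have "0 \<le> \<delta>" using \<gamma> by (simp add: \<delta>_def)
    ultimately have "(\<Sum>ts\<in>P. w ts) \<le> (1 - \<delta> / 6) * real (card P)"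
      using mean_le_if_one_small[OF P ts(1)] w1 by blast
    moreover have "m J = s * (\<Sum>ts\<in>P. w ts)"
      unfolding m_def w_def prod.distrib sum_distrib_left s_def
      by (intro sum.cong refl) (use triple_perms(5)[of _ p q "sphere_size d"] in \<open>simp add: P_def\<close>)
    ultimately have "m J \<le> s * ((1 - \<delta> / 6) * real (card P))" using mult_left_mono[OF _ s] by simp
    then show ?thesis by (simp add: poly_degree_def s_def P_def mult_ac)
  qed
  have "(\<Sum>J\<in>I. m J * (F J * F J)) \<le> (\<Sum>J\<in>I. (1 - \<delta> / 6) * poly_degree p q * (F J * F J))"
  proof (intro sum_mono)
    fix J assume J: "J \<in> I"
    show "m J * (F J * F J) \<le> (1 - \<delta> / 6) * poly_degree p q * (F J * F J)"
    proof (cases "\<exists>i<3. J ! i \<noteq> 0")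
      case True
      then show ?thesis using m_le[OF J] by (intro mult_right_mono) auto
    next
      case False
      then have "F J = 0" using f by (simp add: F_def \<Phi>_def L_def)
      then show ?thesis by simp
    qed
  qed
  then show ?thesis
    unfolding L_def[symmetric] form norm \<delta>_def[symmetric] by (simp only: sum_distrib_left)
qed

end

section \<open>Links, degrees and gaps of the polygraph\<close>

text \<open>Here \<alpha> holds the coordinate distances along an edge, \<beta> and \<gamma> those
  from its ends to a common neighbour. Summing over lists of lengths counts each common neighbour
  once, also for \<open>p = 0\<close>.\<close>

definition link_degree :: "nat \<Rightarrow> nat \<Rightarrow> nat \<Rightarrow> nat list \<Rightarrow> nat" where
  "link_degree d p q \<alpha> = (\<Sum>\<beta>\<in>{ts. mset ts = {#p, q, p + q#}}. \<Sum>\<gamma>\<in>{ts. mset ts = {#p, q, p + q#}}.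
    \<Prod>i<3. tree_count d (\<alpha> ! i) (\<beta> ! i) (\<gamma> ! i))"

text \<open>One permutation of the coordinates applied to \<alpha>, \<beta> and \<gamma> alike
  leaves the products unchanged and permutes the ranges of summation.\<close>

lemma link_degree_cong:
  assumes \<alpha>: "mset \<alpha> = {#p, q, p + q#}" and \<alpha>': "mset \<alpha>' = {#p, q, p + q#}"
  shows "link_degree d p q \<alpha> = link_degree d p q \<alpha>'"
proof -
  define P where "P = {ts. mset ts = {#p, q, p + q#}}"
  have finP: "finite P" unfolding P_def by (rule triple_perms)
  have len: "length ts = 3" if "ts \<in> P" for ts using triple_perms(4) that by (simp add: P_def)
  have "mset \<alpha> = mset \<alpha>'" using assms by simp
  then obtain \<pi> where \<pi>: "\<pi> permutes {..<length \<alpha>'}" "permute_list \<pi> \<alpha>' = \<alpha>"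
    by (rule mset_eq_permutation)
  have \<pi>3: "\<pi> permutes {..<3}" using \<pi>(1) len[of \<alpha>'] \<alpha>' by (simp add: P_def)
  have nth: "permute_list \<pi> ts ! i = ts ! \<pi> i" if "ts \<in> P" "i < 3" for ts i
    using permute_list_nth[of \<pi> ts i] \<pi>3 len[OF that(1)] that(2) by simp
  have bij: "bij_betw (permute_list \<pi>) P P"
  proof -
    have "permute_list \<pi> ` P \<subseteq> P"
    proof
      fix us assume "us \<in> permute_list \<pi> ` P"
      then obtain ts where ts: "ts \<in> P" "us = permute_list \<pi> ts" by blast
      have "mset us = mset ts" unfolding ts(2) by (rule mset_permute_list) (use \<pi>3 len[OF ts(1)] in simp)
      then show "us \<in> P" using ts(1) by (simp add: P_def)
    qed
    moreover have "inj_on (permute_list \<pi>) P"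
    proof (rule inj_onI)
      fix x y assume xy: "x \<in> P" "y \<in> P" and eq: "permute_list \<pi> x = permute_list \<pi> y"
      show "x = y"
      proof (rule nth_equalityI)
        show "length x = length y" using len xy by simp
        fix j assume "j < length x"
        then have j: "j \<in> {..<3}" using len xy by simp
        then obtain i where "i < 3" "\<pi> i = j" using permutes_image[OF \<pi>3] by (metis image_iff lessThan_iff)
        then show "x ! j = y ! j" using nth[OF xy(1), of i] nth[OF xy(2), of i] eq by simp
      qed
    qed
    ultimately show ?thesis using endo_inj_surj[OF finP] by (simp add: bij_betw_def)
  qed
  have "link_degree d p q \<alpha> = (\<Sum>\<beta>\<in>P. \<Sum>\<gamma>\<in>P. \<Prod>i<3. tree_count d (\<alpha> ! i) (permute_list \<pi> \<beta> ! i) (permute_list \<pi> \<gamma> ! i))"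
    unfolding link_degree_def P_def[symmetric]
    by (subst sum.reindex_bij_betw[OF bij, symmetric], rule sum.cong[OF refl],
        subst sum.reindex_bij_betw[OF bij, symmetric], rule refl)
  also have "\<dots> = (\<Sum>\<beta>\<in>P. \<Sum>\<gamma>\<in>P. \<Prod>i<3. tree_count d (\<alpha>' ! i) (\<beta> ! i) (\<gamma> ! i))"
  proof (rule sum.cong[OF refl], rule sum.cong[OF refl])
    fix \<beta> \<gamma> assume P: "\<beta> \<in> P" "\<gamma> \<in> P"
    have "\<alpha>' \<in> P" using \<alpha>' by (simp add: P_def)
    then have "(\<Prod>i<3. tree_count d (\<alpha> ! i) (permute_list \<pi> \<beta> ! i) (permute_list \<pi> \<gamma> ! i))
        = (\<Prod>i<3. tree_count d (\<alpha>' ! \<pi> i) (\<beta> ! \<pi> i) (\<gamma> ! \<pi> i))"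
      unfolding \<pi>(2)[symmetric] using P by (intro prod.cong refl) (simp add: nth)
    also have "\<dots> = (\<Prod>i<3. tree_count d (\<alpha>' ! i) (\<beta> ! i) (\<gamma> ! i))"
      using prod.permute[OF \<pi>3, of "\<lambda>i. tree_count d (\<alpha>' ! i) (\<beta> ! i) (\<gamma> ! i)"] by (simp add: o_def)
    finally show "(\<Prod>i<3. tree_count d (\<alpha> ! i) (permute_list \<pi> \<beta> ! i) (permute_list \<pi> \<gamma> ! i))
        = (\<Prod>i<3. tree_count d (\<alpha>' ! i) (\<beta> ! i) (\<gamma> ! i))" .
  qed
  also have "\<dots> = link_degree d p q \<alpha>'" by (simp add: link_degree_def P_def)
  finally show ?thesis .
qed

text \<open>In each coordinate the three distances add up to at most \<open>3 * (p + q)\<close>, so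
  \<open>card_triangle\<close> counts the third vertex; the order of the distances along the edge
  does not matter by \<open>link_degree_cong\<close>.\<close>

lemma (in local_tree) card_link_neighbours:
  assumes R: "3 * (p + q) \<le> R" and x: "x \<in> tuples 3 V" and y: "y \<in> tuples 3 V"
    and xy: "mset (map2 \<rho> x y) = {#p, q, p + q#}"
  shows "card {z \<in> tuples 3 V. mset (map2 \<rho> x z) = {#p, q, p + q#} \<and> mset (map2 \<rho> y z) = {#p, q, p + q#}}
    = link_degree d p q [p, q, p + q]"
proof -
  define P where "P = {ts. mset ts = {#p, q, p + q#}}"
  have le: "ts ! i \<le> p + q" if "ts \<in> P" "i < 3" for ts i
    using triple_perms_nth_le that by (simp add: P_def)
  have len: "length x = 3" "length y = 3" using x y by (simp_all add: tuples_def)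
  have \<alpha>: "map2 \<rho> x y ! i = \<rho> (x ! i) (y ! i)" if "i < 3" for i using len that by simp
  have "real (card {z \<in> tuples 3 V. mset (map2 \<rho> x z) = {#p, q, p + q#} \<and> mset (map2 \<rho> y z) = {#p, q, p + q#}})
      = (\<Sum>z\<in>tuples 3 V. of_bool (mset (map2 \<rho> x z) = {#p, q, p + q#}) * of_bool (mset (map2 \<rho> y z) = {#p, q, p + q#}))"
    unfolding of_bool_conj[symmetric] using finite_V by (simp add: of_bool_def sum.If_cases Int_def)
  also have "\<dots> = (\<Sum>z\<in>tuples 3 V. \<Sum>\<beta>\<in>P. \<Sum>\<gamma>\<in>P. \<Prod>i<3. of_bool (\<rho> (x ! i) (z ! i) = \<beta> ! i) * of_bool (\<rho> (y ! i) (z ! i) = \<gamma> ! i))"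
    unfolding prod.distrib sum_product[symmetric] P_def
    by (intro sum.cong refl) (simp only: of_bool_mset_map2[OF x] of_bool_mset_map2[OF y])
  also have "\<dots> = (\<Sum>\<beta>\<in>P. \<Sum>\<gamma>\<in>P. \<Sum>z\<in>tuples 3 V. \<Prod>i<3. of_bool (\<rho> (x ! i) (z ! i) = \<beta> ! i) * of_bool (\<rho> (y ! i) (z ! i) = \<gamma> ! i))"
    by (rule sum_rotate)
  also have "\<dots> = (\<Sum>\<beta>\<in>P. \<Sum>\<gamma>\<in>P. real (\<Prod>i<3. tree_count d (map2 \<rho> x y ! i) (\<beta> ! i) (\<gamma> ! i)))"
  proof (rule sum.cong[OF refl], rule sum.cong[OF refl])
    fix \<beta> \<gamma> assume P: "\<beta> \<in> P" "\<gamma> \<in> P"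
    have "(\<Sum>z\<in>tuples 3 V. \<Prod>i<3. of_bool (\<rho> (x ! i) (z ! i) = \<beta> ! i) * of_bool (\<rho> (y ! i) (z ! i) = \<gamma> ! i))
        = (\<Prod>i<3. \<Sum>z\<in>V. of_bool (\<rho> (x ! i) z = \<beta> ! i) * of_bool (\<rho> (y ! i) z = \<gamma> ! i) :: real)"
      by (rule sum_prod_tuples[OF finite_V, where g = "\<lambda>i z. of_bool (\<rho> (x ! i) z = \<beta> ! i) * of_bool (\<rho> (y ! i) z = \<gamma> ! i)"])
    also have "\<dots> = (\<Prod>i<3. real (tree_count d (map2 \<rho> x y ! i) (\<beta> ! i) (\<gamma> ! i)))"
    proof (intro prod.cong refl)
      fix i :: nat assume "i \<in> {..<3}"
      then have i: "i < 3" by simp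
      have m: "map2 \<rho> x y \<in> P" using xy by (simp add: P_def)
      have "\<rho> (x ! i) (y ! i) + \<beta> ! i + \<gamma> ! i \<le> R"
        using add_mono[OF add_mono[OF le[OF m i, unfolded \<alpha>[OF i]] le[OF P(1) i]] le[OF P(2) i]] R by simp
      then have "card {z \<in> V. \<rho> (x ! i) z = \<beta> ! i \<and> \<rho> (y ! i) z = \<gamma> ! i} = tree_count d (\<rho> (x ! i) (y ! i)) (\<beta> ! i) (\<gamma> ! i)"
        using card_triangle tuples_nth[OF x i] tuples_nth[OF y i] by blast
      then show "(\<Sum>z\<in>V. of_bool (\<rho> (x ! i) z = \<beta> ! i) * of_bool (\<rho> (y ! i) z = \<gamma> ! i))
          = real (tree_count d (map2 \<rho> x y ! i) (\<beta> ! i) (\<gamma> ! i))"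
        unfolding of_bool_conj[symmetric] \<alpha>[OF i] using finite_V by (simp add: of_bool_def sum.If_cases Int_def)
    qed
    finally show "(\<Sum>z\<in>tuples 3 V. \<Prod>i<3. of_bool (\<rho> (x ! i) (z ! i) = \<beta> ! i) * of_bool (\<rho> (y ! i) (z ! i) = \<gamma> ! i))
        = real (\<Prod>i<3. tree_count d (map2 \<rho> x y ! i) (\<beta> ! i) (\<gamma> ! i))" by simp
  qed
  also have "\<dots> = real (link_degree d p q (map2 \<rho> x y))"
    unfolding link_degree_def P_def of_nat_sum ..
  also have "link_degree d p q (map2 \<rho> x y) = link_degree d p q [p, q, p + q]"
    by (rule link_degree_cong) (use xy in simp_all)
  finally show ?thesis by (simp only: of_nat_eq_iff)
qed

definition polygraph_degree :: "nat \<Rightarrow> nat \<Rightarrow> nat \<Rightarrow> nat" where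
  "polygraph_degree d p q = card {ts. mset ts = {#p, q, p + q#}} *
    (tree_count d 0 p p * tree_count d 0 q q * tree_count d 0 (p + q) (p + q))"

lemma (in local_tree) poly_degree_eq: "poly_degree p q = real (polygraph_degree d p q)"
  by (simp add: poly_degree_def polygraph_degree_def sphere_size_def)

lemma normalized_gap_geI:
  assumes "adj_eigenvalues H ! 1 \<le> (1 - \<epsilon>) * real k" "\<epsilon> \<le> 1"
  shows "\<epsilon> \<le> normalized_gap k H"
\<comment> \<open>For \<open>k = 0\<close> the division yields 0 and the gap is 1, whence the
  condition \<open>\<epsilon> \<le> 1\<close>.\<close>
proof (cases "k = 0")
  case False
  then have "adj_eigenvalues H ! 1 / real k \<le> 1 - \<epsilon>" using assms(1) by (simp add: divide_le_eq)
  then show ?thesis by (simp add: normalized_gap_def)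
qed (use assms(2) in \<open>simp add: normalized_gap_def\<close>)

section \<open>Extremal eigenvalues of the base graph\<close>

context pair_graph
begin

text \<open>
  An eigenfunction for \<open>d\<close> is constant along edges and one for \<open>- d\<close> changes its sign along them,
  because the corresponding Dirichlet sum vanishes.
\<close>

lemma eigenvalue_bounds:
  fixes g :: "'a \<Rightarrow> real"
  assumes conn: "Digraph_Component.connected G" and reg: "\<And>x. x \<in> pverts G \<Longrightarrow> card {y \<in> pverts G. (x, y) \<in> parcs G} = d"
    and form: "(\<Sum>x\<in>pverts G. \<Sum>y\<in>pverts G. (if (x, y) \<in> parcs G then 1 else 0) * g x * g y) = e"
    and norm: "(\<Sum>x\<in>pverts G. g x * g x) = 1"
  shows "\<bar>e\<bar> \<le> real d"
    and "e = real d \<Longrightarrow> x \<in> pverts G \<Longrightarrow> y \<in> pverts G \<Longrightarrow> g x = g y"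
    and "e = - real d \<Longrightarrow> bipartite G"
proof -
  let ?A = "\<lambda>x y. if (x, y) \<in> parcs G then 1 else 0 :: real"
  have fin: "finite (pverts G)" by (rule pair_finite_verts)
  have row: "(\<Sum>y\<in>pverts G. ?A x y) = real d" if "x \<in> pverts G" for x
    using reg[OF that] fin by (simp add: sum.If_cases Int_def)
  have sym: "?A x y = ?A y x" for x y using arcs_symmetric by auto
  \<comment> \<open>The sign \<open>s = - 1\<close> tests the value \<open>d\<close>, the sign
    \<open>s = 1\<close> the value \<open>- d\<close>.\<close>
  have dir: "(\<Sum>x\<in>pverts G. \<Sum>y\<in>pverts G. ?A x y * (g x + s * g y)\<^sup>2) = 2 * (real d + s * e)"
    if s: "s * s = 1" for s
  proof -
    have "?A x y * (g x + s * g y)\<^sup>2 = ?A x y * (g x * g x) + ?A x y * (g y * g y) + 2 * s * (?A x y * g x * g y)" for x y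
    proof -
      have "(g x + s * g y)\<^sup>2 = g x * g x + (s * s) * (g y * g y) + 2 * s * (g x * g y)"
        by (simp add: power2_eq_square algebra_simps)
      then show ?thesis unfolding s by simp
    qed
    then have "(\<Sum>x\<in>pverts G. \<Sum>y\<in>pverts G. ?A x y * (g x + s * g y)\<^sup>2)
        = (\<Sum>x\<in>pverts G. \<Sum>y\<in>pverts G. ?A x y * (g x * g x)) + (\<Sum>x\<in>pverts G. \<Sum>y\<in>pverts G. ?A x y * (g y * g y))
          + 2 * s * e"
      unfolding form[symmetric] by (simp only: sum.distrib sum_distrib_left)
    also have "(\<Sum>x\<in>pverts G. \<Sum>y\<in>pverts G. ?A x y * (g y * g y)) = (\<Sum>x\<in>pverts G. \<Sum>y\<in>pverts G. ?A x y * (g x * g x))"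
      by (subst sum.swap) (simp only: sym)
    also have "(\<Sum>x\<in>pverts G. \<Sum>y\<in>pverts G. ?A x y * (g x * g x)) = (\<Sum>x\<in>pverts G. real d * (g x * g x))"
      by (rule sum.cong[OF refl]) (simp only: sum_distrib_right[symmetric] row)
    also have "\<dots> = real d" by (simp only: sum_distrib_left[symmetric] norm)
    finally show ?thesis by (simp add: algebra_simps)
  qed
  have nonneg: "0 \<le> (\<Sum>x\<in>pverts G. \<Sum>y\<in>pverts G. ?A x y * (g x + s * g y)\<^sup>2)" for s
    by (intro sum_nonneg) auto
  show "\<bar>e\<bar> \<le> real d" using nonneg[of 1] nonneg[of "- 1"] dir[of 1] dir[of "- 1"] by simp
  have edge: "g x = - s * g y" if s: "s * s = 1" "real d + s * e = 0" and xy: "(x, y) \<in> parcs G" for s x y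
  proof -
    have V: "x \<in> pverts G" "y \<in> pverts G" using xy in_arcsD1 in_arcsD2 by blast+
    have "(\<Sum>x\<in>pverts G. \<Sum>y\<in>pverts G. ?A x y * (g x + s * g y)\<^sup>2) = 0" using dir[OF s(1)] s(2) by simp
    then have "(\<Sum>y\<in>pverts G. ?A x y * (g x + s * g y)\<^sup>2) = 0"
      using V(1) by (subst (asm) sum_nonneg_eq_0_iff[OF fin]) (auto intro: sum_nonneg)
    then have "?A x y * (g x + s * g y)\<^sup>2 = 0"
      using V(2) by (subst (asm) sum_nonneg_eq_0_iff[OF fin]) auto
    then show ?thesis using xy by simp
  qed
  have reach: "(x, y) \<in> (parcs G)\<^sup>*" if "x \<in> pverts G" "y \<in> pverts G" for x y
    by (rule rtrancl_if_connected[OF conn that])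
  show "g x = g y" if e: "e = real d" and V: "x \<in> pverts G" "y \<in> pverts G"
    using reach[OF V]
  proof (induction rule: rtrancl_induct)
    case (step u w)
    have "g u = - (- 1) * g w" by (rule edge) (use e step in simp_all)
    then show ?case using step by simp
  qed simp
  show "bipartite G" if e: "e = - real d"
  proof -
    have flip: "g u = - g w" if "(u, w) \<in> parcs G" for u w
      using edge[of 1 u w] e that by simp
    have "\<exists>x0\<in>pverts G. g x0 \<noteq> 0"
    proof (rule ccontr)
      assume "\<not> ?thesis"
      then have "(\<Sum>x\<in>pverts G. g x * g x) = 0" by simp
      then show False using norm by simp
    qed
    then obtain x0 where x0: "x0 \<in> pverts G" "g x0 \<noteq> 0" by blast
    have nz: "g y \<noteq> 0" if "y \<in> pverts G" for y
      using reach[OF x0(1) that]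
    proof (induction rule: rtrancl_induct)
      case base
      show ?case by (rule x0(2))
    next
      case (step u w)
      then show ?case using flip[of u w] by simp
    qed
    show ?thesis
      unfolding bipartite_def
    proof (rule exI[of _ "{x \<in> pverts G. 0 < g x}"], rule exI[of _ "{x \<in> pverts G. g x < 0}"], intro conjI allI impI)
      show "verts G = {x \<in> pverts G. 0 < g x} \<union> {x \<in> pverts G. g x < 0}"
        using nz by (auto simp: not_less less_le)
      fix u w assume "u \<rightarrow>\<^bsub>G\<^esub> w"
      then have uw: "(u, w) \<in> parcs G" by simp
      then have "u \<in> pverts G" "w \<in> pverts G" "g u = - g w" "g w \<noteq> 0"
        using in_arcsD1 in_arcsD2 flip nz by blast+
      then show "u \<in> {x \<in> pverts G. 0 < g x} \<and> w \<in> {x \<in> pverts G. g x < 0} \<or>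
          u \<in> {x \<in> pverts G. g x < 0} \<and> w \<in> {x \<in> pverts G. 0 < g x}"
        by auto
    qed auto
  qed
qed

end

lemma out_degree_with_proj: "out_degree (with_proj H) u = card {w. (u, w) \<in> parcs H}"
proof -
  have "out_arcs (with_proj H) u = Pair u ` {w. (u, w) \<in> parcs H}"
    by (auto simp: out_arcs_def)
  then show ?thesis by (simp add: out_degree_def card_image inj_on_def)
qed

lemma verts_link: "verts (link (with_proj H) v) = {w. (v, w) \<in> parcs H}"
  by (simp add: link_def)

lemma dominates_link_iff:
  "u \<rightarrow>\<^bsub>link (with_proj H) v\<^esub> w \<longleftrightarrow> (v, u) \<in> parcs H \<and> (v, w) \<in> parcs H \<and> (u, w) \<in> parcs H"
  by (auto simp: link_def arcs_ends_conv image_iff)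

lemma out_degree_link:
  assumes "(v, u) \<in> parcs H"
  shows "out_degree (link (with_proj H) v) u = card {w. (v, w) \<in> parcs H \<and> (u, w) \<in> parcs H}"
proof -
  have "out_arcs (link (with_proj H) v) u = Pair u ` {w. (v, w) \<in> parcs H \<and> (u, w) \<in> parcs H}"
    using assms by (auto simp: out_arcs_def link_def)
  then show ?thesis by (simp add: out_degree_def card_image inj_on_def)
qed

context pair_graph
begin

lemma pverts_polygraph: "pverts (polygraph G S) = tuples (size S) (pverts G)"
  by (simp add: polygraph_def tuples_def)

text \<open>The embedding of the naturals into \<open>ereal\<close> is injective, and so is its lift
  to multisets; hence distances may be compared as natural numbers.\<close>

lemma parcs_polygraph_iff:
  assumes conn: "Digraph_Component.connected G"
  shows "(xs, ys) \<in> parcs (polygraph G S) \<longleftrightarrow> xs \<in> tuples (size S) (pverts G) \<and> ys \<in> tuples (size S) (pverts G) \<and>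
    mset (map2 (rel_dist (parcs G)) xs ys) = S"
proof -
  have "mset (map2 (graph_metric G) xs ys) = image_mset (\<lambda>l. ereal (real l)) S \<longleftrightarrow>
      mset (map2 (rel_dist (parcs G)) xs ys) = S"
    if xy: "xs \<in> tuples (size S) (pverts G)" "ys \<in> tuples (size S) (pverts G)"
  proof -
    have "map2 (graph_metric G) xs ys = map (\<lambda>l. ereal (real l)) (map2 (rel_dist (parcs G)) xs ys)"
    proof (rule nth_equalityI)
      show "length (map2 (graph_metric G) xs ys) = length (map (\<lambda>l. ereal (real l)) (map2 (rel_dist (parcs G)) xs ys))"
        by simp
      fix i assume "i < length (map2 (graph_metric G) xs ys)"
      then have "i < size S" "i < length xs" "i < length ys" using xy by (simp_all add: tuples_def)
      then show "map2 (graph_metric G) xs ys ! i = map (\<lambda>l. ereal (real l)) (map2 (rel_dist (parcs G)) xs ys) ! i"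
        using graph_metric_eq_rel_dist[OF conn tuples_nth[OF xy(1)] tuples_nth[OF xy(2)]] by simp
    qed
    then have "mset (map2 (graph_metric G) xs ys) = image_mset (\<lambda>l. ereal (real l)) (mset (map2 (rel_dist (parcs G)) xs ys))"
      by (simp only: mset_map)
    moreover have "inj (\<lambda>l. ereal (real l))" by (simp add: inj_on_def)
    then have "inj (image_mset (\<lambda>l. ereal (real l)))" by (rule multiset.inj_map)
    ultimately show ?thesis by (simp only: inj_eq)
  qed
  then show ?thesis unfolding polygraph_def Let_def tuples_def by auto
qed

text \<open>Turns the maximum in \<open>two_sided_gap\<close> into a bound for every index but 0.
  The gap is positive because \<open>d\<close> is a simple eigenvalue of a connected graph and
  \<open>- d\<close> does not occur in a non-bipartite one.\<close>

theorem spectral_data: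
  assumes conn: "Digraph_Component.connected G" and nbip: "\<not> bipartite G"
    and reg: "\<And>x. x \<in> pverts G \<Longrightarrow> card {y \<in> pverts G. (x, y) \<in> parcs G} = d" and d: "3 \<le> d"
  defines "n \<equiv> card (pverts G)" and "\<gamma> \<equiv> two_sided_gap d G"
  obtains \<phi> :: "nat \<Rightarrow> 'a \<Rightarrow> real" and ev :: "nat \<Rightarrow> real"
  where "\<And>k l. k < n \<Longrightarrow> l < n \<Longrightarrow> (\<Sum>x\<in>pverts G. \<phi> k x * \<phi> l x) = (if k = l then 1 else 0)"
    and "\<And>x y. x \<in> pverts G \<Longrightarrow> y \<in> pverts G \<Longrightarrow> (\<Sum>k<n. \<phi> k x * \<phi> k y) = (if x = y then 1 else 0)"
    and "\<And>x y. x \<in> pverts G \<Longrightarrow> y \<in> pverts G \<Longrightarrow> (\<Sum>k<n. ev k * \<phi> k x * \<phi> k y) = (if (x, y) \<in> parcs G then 1 else 0)"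
    and "\<And>k. k < n \<Longrightarrow> \<bar>ev k\<bar> \<le> real d"
    and "\<And>k. 0 < k \<Longrightarrow> k < n \<Longrightarrow> \<bar>ev k\<bar> \<le> (1 - \<gamma>) * real d"
    and "0 < \<gamma>" and "2 \<le> n"
proof -
  define es where "es = adj_eigenvalues G"
  have fin: "finite (verts G)" using pair_finite_verts by simp
  have symm: "\<And>x y. x \<rightarrow>\<^bsub>G\<^esub> y \<Longrightarrow> y \<rightarrow>\<^bsub>G\<^esub> x" using arcs_symmetric by simp
  have "\<exists>\<phi> :: nat \<Rightarrow> 'a \<Rightarrow> real. length es = n \<and> sorted_wrt (\<ge>) es \<and>
      (\<forall>k<n. \<forall>l<n. (\<Sum>x\<in>pverts G. \<phi> k x * \<phi> l x) = (if k = l then 1 else 0)) \<and>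
      (\<forall>x\<in>pverts G. \<forall>y\<in>pverts G. (\<Sum>k<n. \<phi> k x * \<phi> k y) = (if x = y then 1 else 0)) \<and>
      (\<forall>x\<in>pverts G. \<forall>y\<in>pverts G. (\<Sum>k<n. es ! k * \<phi> k x * \<phi> k y) = (if (x, y) \<in> parcs G then 1 else 0))"
    by (rule adj_eigenvalues_spectral[OF fin], erule symm)
      (simp only: es_def n_def with_proj_simps, blast)
  then obtain \<phi> :: "nat \<Rightarrow> 'a \<Rightarrow> real" where len: "length es = n" and sorted: "sorted_wrt (\<ge>) es"
    and orth': "\<forall>k<n. \<forall>l<n. (\<Sum>x\<in>pverts G. \<phi> k x * \<phi> l x) = (if k = l then 1 else 0)"
    and compl': "\<forall>x\<in>pverts G. \<forall>y\<in>pverts G. (\<Sum>k<n. \<phi> k x * \<phi> k y) = (if x = y then 1 else 0)"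
    and kern': "\<forall>x\<in>pverts G. \<forall>y\<in>pverts G. (\<Sum>k<n. es ! k * \<phi> k x * \<phi> k y) = (if (x, y) \<in> parcs G then 1 else 0)"
    by blast
  have orth: "(\<Sum>x\<in>pverts G. \<phi> k x * \<phi> l x) = (if k = l then 1 else 0)" if "k < n" "l < n" for k l
    using orth' that by blast
  have kern: "(\<Sum>k<n. es ! k * \<phi> k x * \<phi> k y) = (if (x, y) \<in> parcs G then 1 else 0)"
    if "x \<in> pverts G" "y \<in> pverts G" for x y
    using kern' that by blast
  have form: "(\<Sum>x\<in>pverts G. \<Sum>y\<in>pverts G. (if (x, y) \<in> parcs G then 1 else 0) * \<phi> k x * \<phi> k y) = es ! k"
    if k: "k < n" for k
  proof -
    have "(\<Sum>x\<in>pverts G. \<Sum>y\<in>pverts G. (if (x, y) \<in> parcs G then 1 else 0) * \<phi> k x * \<phi> k y)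
        = (\<Sum>x\<in>pverts G. \<Sum>y\<in>pverts G. (\<Sum>j<n. es ! j * \<phi> j x * \<phi> j y) * \<phi> k x * \<phi> k y)"
      by (intro sum.cong refl) (simp only: kern)
    also have "\<dots> = (\<Sum>j<n. es ! j * ((\<Sum>x\<in>pverts G. \<phi> k x * \<phi> j x) * (\<Sum>x\<in>pverts G. \<phi> k x * \<phi> j x)))"
      by (rule quadratic_form_expansion)
    also have "\<dots> = (\<Sum>j<n. if k = j then es ! j else 0)"
      by (rule sum.cong[OF refl]) (use k orth in simp)
    also have "\<dots> = es ! k" using k by simp
    finally show ?thesis .
  qed
  have norm: "(\<Sum>x\<in>pverts G. \<phi> k x * \<phi> k x) = 1" if "k < n" for k
    using orth[OF that that] by simp
  note bounds = eigenvalue_bounds[OF conn reg form norm]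
  have "pverts G \<noteq> {}" using conn by (simp add: connected_conv)
  then obtain x0 where x0: "x0 \<in> pverts G" by blast
  have "card {y \<in> pverts G. (x0, y) \<in> parcs G} \<le> n"
    unfolding n_def by (intro card_mono pair_finite_verts) auto
  then have n: "2 \<le> n" using reg[OF x0] d by simp
  have ev: "\<bar>es ! k\<bar> \<le> real d" if "k < n" for k by (rule bounds(1)) (use that in auto)
  have strict: "\<bar>es ! k\<bar> < real d" if k: "0 < k" "k < n" for k
  proof -
    have "es ! k \<noteq> - real d" using bounds(3)[of k] k nbip by blast
    moreover have "es ! k \<noteq> real d"
    proof
      assume ek: "es ! k = real d"
      have "es ! k \<le> es ! 0" using sorted k len by (simp add: sorted_wrt_iff_nth_less)
      then have e0: "es ! 0 = real d" using ev[of 0] ek k by simp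
      \<comment> \<open>Both eigenfunctions are constant and nonzero, which contradicts their
        orthogonality.\<close>
      have c: "\<phi> 0 x = \<phi> 0 x0" "\<phi> k x = \<phi> k x0" if "x \<in> pverts G" for x
        using bounds(2)[of 0 x x0] bounds(2)[of k x x0] e0 ek k x0 that by simp_all
      have "(\<Sum>x\<in>pverts G. \<phi> 0 x * \<phi> k x) = real n * (\<phi> 0 x0 * \<phi> k x0)"
        unfolding n_def by (simp add: c cong: sum.cong)
      then have "\<phi> 0 x0 * \<phi> k x0 = 0" using orth[of 0 k] k n by simp
      moreover have "(\<Sum>x\<in>pverts G. \<phi> j x * \<phi> j x) = real n * (\<phi> j x0 * \<phi> j x0)" if "j = 0 \<or> j = k" for j
        unfolding n_def using that by (elim disjE) (simp_all add: c cong: sum.cong)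
      then have "\<phi> 0 x0 \<noteq> 0" "\<phi> k x0 \<noteq> 0" using norm[of 0] norm[of k] k by fastforce+
      ultimately show False by simp
    qed
    ultimately show ?thesis using ev[OF k(2)] by linarith
  qed
  define M where "M = Max (abs ` set (tl es))"
  have tl: "set (tl es) = {es ! k |k. 0 < k \<and> k < n}"
  proof (intro equalityI subsetI)
    fix e assume "e \<in> set (tl es)"
    then obtain j where "j < length (tl es)" "tl es ! j = e" by (auto simp: in_set_conv_nth)
    then have "es ! Suc j = e" "Suc j < n" using len by (auto simp: nth_tl)
    then show "e \<in> {es ! k |k. 0 < k \<and> k < n}" by blast
  next
    fix e assume "e \<in> {es ! k |k. 0 < k \<and> k < n}"
    then obtain k where k: "0 < k" "k < n" "e = es ! k" by blast
    then have "tl es ! (k - 1) = e" "k - 1 < length (tl es)" using len by (auto simp: nth_tl)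
    then show "e \<in> set (tl es)" by (metis nth_mem)
  qed
  \<comment> \<open>\<open>Max\<close> is only meaningful on a nonempty set;
    \<open>2 \<le> n\<close> provides an eigenvalue besides the first.\<close>
  have ne: "set (tl es) \<noteq> {}" unfolding tl using n by auto
  have "M \<in> abs ` set (tl es)" unfolding M_def by (rule Max_in) (use ne in auto)
  then have "M < real d" using strict unfolding tl by blast
  moreover have \<gamma>: "\<gamma> = 1 - M / real d" by (simp add: \<gamma>_def two_sided_gap_def M_def es_def)
  ultimately have \<gamma>0: "0 < \<gamma>" using d by simp
  have gap: "\<bar>es ! k\<bar> \<le> (1 - \<gamma>) * real d" if k: "0 < k" "k < n" for k
  proof -
    have "\<bar>es ! k\<bar> \<le> M" unfolding M_def by (rule Max_ge) (use k tl in auto)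
    then show ?thesis using d by (simp add: \<gamma>)
  qed
  show thesis
    by (rule that[of \<phi> "\<lambda>k. es ! k"]) (use orth compl' kern ev gap \<gamma>0 n in blast)+
qed

theorem polygraph_gaps:
  assumes conn: "Digraph_Component.connected G" and nbip: "\<not> bipartite G" and reg: "regular d G" and d: "3 \<le> d"
    and girth: "girth G > enat (3 * p + 3 * q)" and pq: "even p" "even q" "p < q"
  defines "H \<equiv> polygraph G {#p, q, p + q#}" and "a \<equiv> polygraph_degree d p q" and "b \<equiv> link_degree d p q [p, q, p + q]"
  shows "link_regular a b H"
    and "\<And>v. v \<in> pverts H \<Longrightarrow> 1 / 10 ^ 18 \<le> normalized_gap b (link H v)"
    and "0 < two_sided_gap d G"
    and "min (two_sided_gap d G) (1 / 4) / 6 \<le> normalized_gap a H"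
proof -
  define V \<rho> where "V = pverts G" and "\<rho> = rel_dist (parcs G)"
  interpret T: local_tree V \<rho> d "3 * (p + q)"
    unfolding V_def \<rho>_def by (rule local_tree_if_large_girth[OF conn reg]) (use girth in \<open>simp add: algebra_simps\<close>)
  have vH: "pverts H = tuples 3 V"
    unfolding H_def V_def by (simp add: pverts_polygraph numeral_3_eq_3)
  have arc: "(x, y) \<in> parcs H \<longleftrightarrow> x \<in> tuples 3 V \<and> y \<in> tuples 3 V \<and> mset (map2 \<rho> x y) = {#p, q, p + q#}" for x y
    unfolding H_def V_def \<rho>_def parcs_polygraph_iff[OF conn] by (simp add: numeral_3_eq_3)
  have comm: "map2 \<rho> x y = map2 \<rho> y x" if "x \<in> tuples 3 V" "y \<in> tuples 3 V" for x y
    using that by (intro nth_equalityI) (auto simp: tuples_def T.dist_commute subset_iff)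
  have sym: "(y, x) \<in> parcs H" if "(x, y) \<in> parcs H" for x y
  proof -
    have "map2 \<rho> y x = map2 \<rho> x y" using that comm[of x y] unfolding arc by metis
    then show ?thesis using that unfolding arc by (metis (no_types))
  qed
  have out: "real (out_degree H x) = real a" if "x \<in> tuples 3 V" for x
  proof -
    have "{w. (x, w) \<in> parcs H} = {y \<in> tuples 3 V. mset (map2 \<rho> x y) = {#p, q, p + q#}}"
      using that by (auto simp: arc)
    then show ?thesis
      using T.card_polygraph_neighbours[OF _ that] by (simp add: out_degree_with_proj a_def T.poly_degree_eq)
  qed
  have link_deg: "card {w. (v, w) \<in> parcs H \<and> (x, w) \<in> parcs H} = b" if "(v, x) \<in> parcs H" for v x
  proof -
    have vx: "v \<in> tuples 3 V" "x \<in> tuples 3 V" "mset (map2 \<rho> v x) = {#p, q, p + q#}" using that by (simp_all add: arc)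
    have "{w. (v, w) \<in> parcs H \<and> (x, w) \<in> parcs H}
        = {z \<in> tuples 3 V. mset (map2 \<rho> v z) = {#p, q, p + q#} \<and> mset (map2 \<rho> x z) = {#p, q, p + q#}}"
      using vx by (auto simp: arc)
    then show ?thesis using T.card_link_neighbours[OF _ vx] by (simp add: b_def)
  qed
  show "link_regular a b H"
    unfolding link_regular_def regular_def
  proof (intro conjI ballI)
    fix v assume "v \<in> verts H"
    then show "out_degree H v = a" using out by (simp add: vH)
  next
    fix v x assume "v \<in> verts H" "x \<in> verts (link H v)"
    then have "(v, x) \<in> parcs H" by (simp add: verts_link)
    then show "out_degree (link H v) x = b" by (simp add: out_degree_link link_deg)
  qed
  show "1 / 10 ^ 18 \<le> normalized_gap b (link H v)" if v: "v \<in> pverts H" for v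
  proof (rule normalized_gap_geI)
    interpret K: link_of_triple V \<rho> d p q v
      by unfold_locales (use d pq v in \<open>simp_all add: vH\<close>)
    have X: "verts (link H v) = K.X"
      using v by (auto simp: verts_link arc vH K.X_def K.L_def)
    have XL: "x \<in> tuples 3 V" if "x \<in> K.X" for x using that by (simp add: K.X_def K.L_def)
    have dom: "x \<rightarrow>\<^bsub>link H v\<^esub> y \<longleftrightarrow> mset (map2 \<rho> x y) = {#p, q, p + q#}" if "x \<in> K.X" "y \<in> K.X" for x y
      using that v by (simp add: dominates_link_iff arc vH K.X_def K.L_def)
    show "adj_eigenvalues (link H v) ! 1 \<le> (1 - 1 / 10 ^ 18) * real b"
    proof (rule second_eigenvalue_le[where w = "\<lambda>_. 1"])
      show "finite (verts (link H v))" unfolding X K.X_def by simp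
      show "y \<rightarrow>\<^bsub>link H v\<^esub> x" if "x \<rightarrow>\<^bsub>link H v\<^esub> y" for x y
        using that sym by (auto simp: dominates_link_iff)
      \<comment> \<open>A second eigenvalue exists only if there are two vertices;
        \<open>B \<ge> 4\<close> gives \<open>B\<^sup>2 / 8 \<ge> 2\<close> of them.\<close>
      have "4 \<le> (d - 1) ^ (p + q)"
      proof -
        have "(2::nat) ^ 2 \<le> (d - 1) ^ 2" using d by (intro power_mono) auto
        also have "\<dots> \<le> (d - 1) ^ (p + q)" using d pq by (intro power_increasing) (auto elim!: evenE)
        finally show ?thesis by simp
      qed
      then have "4 \<le> K.B" unfolding K.B_def by (simp only: of_nat_le_iff[symmetric, where 'a = real] of_nat_numeral)
      then have "4 * 4 \<le> K.B * K.B" by (intro mult_mono) auto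
      then have "2 \<le> real (card K.X)" using K.card_X_ge by (simp add: power2_eq_square)
      then show "2 \<le> card (verts (link H v))" unfolding X by simp
      fix f :: "'a list \<Rightarrow> real"
      assume "(\<Sum>x\<in>verts (link H v). f x * 1) = 0"
      then have f: "(\<Sum>x\<in>K.X. f x) = 0" by (simp add: X)
      have deg: "card {y \<in> K.X. mset (map2 \<rho> x y) = {#p, q, p + q#}} = b" if x: "x \<in> K.X" for x
      proof -
        have vx: "(v, x) \<in> parcs H" using x v by (simp add: arc vH K.X_def K.L_def)
        have "{y \<in> K.X. mset (map2 \<rho> x y) = {#p, q, p + q#}} = {w. (v, w) \<in> parcs H \<and> (x, w) \<in> parcs H}"
          using x v by (auto simp: arc vH K.X_def K.L_def)
        then show ?thesis using link_deg[OF vx] by simp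
      qed
      have "(\<Sum>x\<in>K.X. \<Sum>y\<in>K.X. (if x \<rightarrow>\<^bsub>link H v\<^esub> y then 1 else 0) * f x * f y)
          = (\<Sum>x\<in>K.X. \<Sum>y\<in>K.X. (if mset (map2 \<rho> x y) = {#p, q, p + q#} then 1 else 0) * f x * f y)"
        by (intro sum.cong refl) (simp only: dom)
      also have "\<dots> \<le> (1 - 1 / 10 ^ 18) * real b * (\<Sum>x\<in>K.X. f x * f x)"
        by (rule K.link_form_le[OF deg f])
      finally show "(\<Sum>x\<in>verts (link H v). \<Sum>y\<in>verts (link H v). (if x \<rightarrow>\<^bsub>link H v\<^esub> y then 1 else 0) * f x * f y)
          \<le> (1 - 1 / 10 ^ 18) * real b * (\<Sum>x\<in>verts (link H v). f x * f x)"
        unfolding X .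
    qed
  qed simp
  have edge: "\<rho> x y = 1 \<longleftrightarrow> (x, y) \<in> parcs G" if "x \<in> V" "y \<in> V" for x y
    using rel_dist_eq_1_iff[OF conn] that by (simp add: V_def \<rho>_def)
  have deg: "card {y \<in> pverts G. (x, y) \<in> parcs G} = d" if "x \<in> pverts G" for x
  proof -
    have "{y \<in> pverts G. (x, y) \<in> parcs G} = {y \<in> V. \<rho> x y = 1}"
      using edge that by (auto simp: V_def)
    then show ?thesis using T.degree[of x] that by (simp add: V_def)
  qed
  define n where "n = card (pverts G)"
  obtain \<phi> :: "nat \<Rightarrow> 'a \<Rightarrow> real" and ev :: "nat \<Rightarrow> real" where
    orth: "\<And>k l. k < n \<Longrightarrow> l < n \<Longrightarrow> (\<Sum>x\<in>V. \<phi> k x * \<phi> l x) = (if k = l then 1 else 0)"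
    and compl: "\<And>x y. x \<in> V \<Longrightarrow> y \<in> V \<Longrightarrow> (\<Sum>k<n. \<phi> k x * \<phi> k y) = (if x = y then 1 else 0)"
    and kern: "\<And>x y. x \<in> V \<Longrightarrow> y \<in> V \<Longrightarrow> (\<Sum>k<n. ev k * \<phi> k x * \<phi> k y) = (if (x, y) \<in> parcs G then 1 else 0)"
    and ev: "\<And>k. k < n \<Longrightarrow> \<bar>ev k\<bar> \<le> real d"
    and gap: "\<And>k. 0 < k \<Longrightarrow> k < n \<Longrightarrow> \<bar>ev k\<bar> \<le> (1 - two_sided_gap d G) * real d"
    and \<gamma>: "0 < two_sided_gap d G" and n2: "2 \<le> n"
    unfolding V_def n_def
    apply (rule spectral_data[OF conn nbip _ d])
     apply (erule deg)
    subgoal premises p for \<phi> ev by (rule p(1)[of \<phi> ev]) (rule p(2-8); assumption)+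
    done
  show "0 < two_sided_gap d G" by (rule \<gamma>)
  show "min (two_sided_gap d G) (1 / 4) / 6 \<le> normalized_gap a H"
  proof (rule normalized_gap_geI)
    show "adj_eigenvalues H ! 1 \<le> (1 - min (two_sided_gap d G) (1 / 4) / 6) * real a"
    \<comment> \<open>The tensor power of the leading eigenfunction, the one direction in which
      \<open>polygraph_form_le\<close> offers no gain.\<close>
    proof (rule second_eigenvalue_le[where w = "\<lambda>x. \<Prod>i<3. \<phi> 0 (x ! i)"])
      show fin: "finite (verts H)" by (simp add: vH T.finite_V)
      show "y \<rightarrow>\<^bsub>H\<^esub> x" if "x \<rightarrow>\<^bsub>H\<^esub> y" for x y using that sym by simp
      obtain x y where xy: "x \<in> V" "y \<in> V" "x \<noteq> y"
        using n2 unfolding n_def V_def by (metis card_le_Suc0_iff_eq not_less_eq_eq numeral_2_eq_2 pair_finite_verts)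
      have "card {[x, x, x], [y, y, y]} \<le> card (verts H)"
        by (rule card_mono[OF fin]) (use xy in \<open>simp add: vH tuples_def\<close>)
      then show "2 \<le> card (verts H)" using xy by simp
      fix f :: "'a list \<Rightarrow> real"
      assume "(\<Sum>x\<in>verts H. f x * (\<Prod>i<3. \<phi> 0 (x ! i))) = 0"
      then have f: "(\<Sum>x\<in>tuples 3 V. f x * (\<Prod>i<3. \<phi> 0 (x ! i))) = 0" by (simp add: vH)
      have kern1: "(\<Sum>k<n. ev k * \<phi> k x * \<phi> k y) = (if \<rho> x y = 1 then 1 else 0)" if "x \<in> V" "y \<in> V" for x y
        unfolding kern[OF that] edge[OF that] ..
      have "(\<Sum>x\<in>tuples 3 V. \<Sum>y\<in>tuples 3 V. (if x \<rightarrow>\<^bsub>H\<^esub> y then 1 else 0) * f x * f y)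
          = (\<Sum>x\<in>tuples 3 V. \<Sum>y\<in>tuples 3 V. of_bool (mset (map2 \<rho> x y) = {#p, q, p + q#}) * f x * f y)"
        by (intro sum.cong refl) (simp add: arc of_bool_def)
      also have "\<dots> \<le> (1 - min (two_sided_gap d G) (1 / 4) / 6) * T.poly_degree p q * (\<Sum>x\<in>tuples 3 V. f x * f x)"
        by (rule T.polygraph_form_le[OF d _ pq(3) _ orth compl kern1 ev gap \<gamma> f]) (use n2 in simp_all)
      finally show "(\<Sum>x\<in>verts H. \<Sum>y\<in>verts H. (if x \<rightarrow>\<^bsub>H\<^esub> y then 1 else 0) * f x * f y)
          \<le> (1 - min (two_sided_gap d G) (1 / 4) / 6) * real a * (\<Sum>x\<in>verts H. f x * f x)"
        by (simp add: vH T.poly_degree_eq a_def)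
    qed
  qed simp
qed

end

theorem theorem1p3:
  fixes p q :: nat
  assumes "even p" and "even q" and "p < q"
  shows "\<exists>\<epsilon>>0. \<exists>\<epsilon>' :: real \<Rightarrow> real. (\<forall>\<gamma>>0. \<epsilon>' \<gamma> > 0) \<and>
    (\<forall>d\<ge>3. \<exists>a b. \<forall>G :: 'a pair_pre_digraph.
      pair_graph G \<and> Digraph_Component.connected G \<and> \<not> bipartite G \<and> regular d G \<and>
      girth G > enat (3 * p + 3 * q) \<longrightarrow>
        link_regular a b (polygraph G {#p, q, p + q#}) \<and>
        (\<forall>v\<in>pverts (polygraph G {#p, q, p + q#}).
          normalized_gap b (link (polygraph G {#p, q, p + q#}) v) \<ge> \<epsilon>) \<and>
        normalized_gap a (polygraph G {#p, q, p + q#}) \<ge> \<epsilon>' (two_sided_gap d G) \<and>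
        \<epsilon>' (two_sided_gap d G) > 0)"
\<comment> \<open>The first witness is the absolute constant of \<open>link_form_le\<close>. In the
  second, \<open>1 / 4\<close> stems from the bound \<open>3 / 4\<close> on the polynomials, and 6
  bounds the number of arrangements of the three distances.\<close>
proof (intro exI[of _ "1 / 10 ^ 18 :: real"] conjI exI[of _ "\<lambda>\<gamma>. min \<gamma> (1 / 4) / 6"] allI impI)
  fix d :: nat assume d: "3 \<le> d"
  show "\<exists>a b. \<forall>G :: 'a pair_pre_digraph.
      pair_graph G \<and> Digraph_Component.connected G \<and> \<not> bipartite G \<and> regular d G \<and>
      girth G > enat (3 * p + 3 * q) \<longrightarrow>
        link_regular a b (polygraph G {#p, q, p + q#}) \<and>
        (\<forall>v\<in>pverts (polygraph G {#p, q, p + q#}).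
          normalized_gap b (link (polygraph G {#p, q, p + q#}) v) \<ge> 1 / 10 ^ 18) \<and>
        normalized_gap a (polygraph G {#p, q, p + q#}) \<ge> min (two_sided_gap d G) (1 / 4) / 6 \<and>
        min (two_sided_gap d G) (1 / 4) / 6 > 0"
  proof (rule exI[of _ "polygraph_degree d p q"], rule exI[of _ "link_degree d p q [p, q, p + q]"], intro allI impI)
    fix G :: "'a pair_pre_digraph"
    assume G: "pair_graph G \<and> Digraph_Component.connected G \<and> \<not> bipartite G \<and> regular d G \<and>
      girth G > enat (3 * p + 3 * q)"
    interpret pair_graph G using G by blast
    have "Digraph_Component.connected G" "\<not> bipartite G" "regular d G" "girth G > enat (3 * p + 3 * q)"
      using G by blast+
    note gaps = polygraph_gaps[OF this(1-3) d this(4) assms]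
    show "link_regular (polygraph_degree d p q) (link_degree d p q [p, q, p + q]) (polygraph G {#p, q, p + q#}) \<and>
        (\<forall>v\<in>pverts (polygraph G {#p, q, p + q#}).
          normalized_gap (link_degree d p q [p, q, p + q]) (link (polygraph G {#p, q, p + q#}) v) \<ge> 1 / 10 ^ 18) \<and>
        normalized_gap (polygraph_degree d p q) (polygraph G {#p, q, p + q#}) \<ge> min (two_sided_gap d G) (1 / 4) / 6 \<and>
        min (two_sided_gap d G) (1 / 4) / 6 > 0"
      using gaps(1,2,4) gaps(3) by simp
  qed
qed simp_all

end
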